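(* Let $\mathcal H$ be a hypergraph on $n$ vertices (multiple copies of the same hyperedge are allowed) that contains no Berge-$C_4$. Then $$\sum_{h\in \mathcal H}(|h|-3)\leq (1+o(1))\,\tfrac12\, n^{3/2},$$ where $o(1)$ denotes a quantity tending to $0$ as $n\to\infty$, uniformly over all such hypergraphs. Furthermore, there exist Berge-$C_4$-free hypergraphs $\mathcal H$ on $n$ vertices with $$\sum_{h\in \mathcal H}(|h|-3)\geq (1+o(1))\,\frac{1}{2\sqrt6}\, n^{3/2}\qquad (n\to\infty).$$
   Context: A hypergraph consists of a finite vertex set and a collection (multiset) of hyperedges, each a subset of the vertex set; multi-hyperedges are allowed. A Berge cycle of length $k$ (Berge-$C_k$) is an alternating sequence $v_1,h_1,v_2,h_2,\ldots,v_k,h_k$ of distinct vertices $v_i$ and distinct hyperedges $h_i$ (distinct as members of the multiset) such that $v_i,v_{i+1}\in h_i$ for each $i\in\{1,\ldots,k-1\}$ and $v_k,v_1\in h_k$. A hypergraph is Berge-$C_4$-free if it contains no Berge cycle of length $4$. *)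

theory Defs
  imports Complex_Main
begin

text \<open>A hypergraph on the vertex set {0..<n} is a list H of hyperedges (subsets of the
vertex set); list positions identify hyperedges, so repeated hyperedges are allowed
(the list represents a multiset of hyperedges).\<close>

definition hypergraph_on :: "nat \<Rightarrow> nat set list \<Rightarrow> bool" where
  "hypergraph_on n H \<longleftrightarrow> (\<forall>h\<in>set H. h \<subseteq> {..<n})"

definition has_berge_C4 :: "nat set list \<Rightarrow> bool" where
  "has_berge_C4 H \<longleftrightarrow>
    (\<exists>v1 v2 v3 v4 i1 i2 i3 i4.
       distinct [v1, v2, v3, v4] \<and> distinct [i1, i2, i3, i4] \<and>
       i1 < length H \<and> i2 < length H \<and> i3 < length H \<and> i4 < length H \<and>
       v1 \<in> H ! i1 \<and> v2 \<in> H ! i1 \<and>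
       v2 \<in> H ! i2 \<and> v3 \<in> H ! i2 \<and>
       v3 \<in> H ! i3 \<and> v4 \<in> H ! i3 \<and>
       v4 \<in> H ! i4 \<and> v1 \<in> H ! i4)"

definition excess :: "nat set list \<Rightarrow> real" where
  "excess H = (\<Sum>i<length H. real (card (H ! i)) - 3)"

end

theory Submission
  imports Defs "HOL-Complex_Analysis.Complex_Analysis" "HOL-Number_Theory.Number_Theory"
    "HOL-Real_Asymp.Real_Asymp"
begin

text \<open>Upper bound. Call a pair of vertices heavy if it lies in at least four hyperedges. Inside a
hyperedge h the heavy pairs contain no path with three edges (h itself would close it to a Berge-C4),
so they are so sparse that one can choose 3(|h| - 3) light pairs of h with all degrees at most 6. In the
multigraph of all chosen pairs, coloured by hyperedges, a pair of vertices is joined by at most 9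
two-coloured paths of length two, apart from a negligible number of exceptional pairs: two such paths
with different midpoints and four different colours form a Berge-C4. Counting paths of length two by
their midpoint and using Cauchy--Schwarz bounds the number of chosen pairs by (3/2 + o(1)) n^(3/2).

Lower bound. Take the point-line incidence graph of the affine plane over Z/p without vertical lines,
replace every vertex by three copies and every edge by the six copies of its ends. This
needs 6p^2 \<le> n with p asymptotic to sqrt(n/6), that is, primes in the intervals [(1 - \<epsilon>)x, x] for large x. They
come from the prime number theorem, for which we follow Newman's proof: psi(n) - n is
summed against the weights 1/(n(n+1)).\<close>

section \<open>Newman's Tauberian theorem\<close>

text \<open>The constant 1/2 is sqrt 9 / 6. In ordered pairs, the choice inside h has at least 6(|h|
  - 3) members. A light pair lies in at most three hyperedges, so one midpoint carries at most 3 * 3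
  paths between two given ends, and Cauchy--Schwarz turns 9 n^2 paths into 3 n^(3/2) chosen ordered
  pairs. The threshold for heavy is four because the last edge of a heavy path inside h must avoid h
  and the two hyperedges already picked. The degree bound 6 keeps the error terms linear in the
  number of chosen pairs; with unbounded degrees a single large hyperedge could dominate the paths
  with repeated colours. In the lower bound, 3 p^3 with p about sqrt(n/6) is n^(3/2) / (2 sqrt 6);
  primes known only up to a constant factor would spoil this constant. The weight 1/(n(n+1)) is the
  integral of u^(-2) over [n, n+1], so the series is Newman's integral of (psi(u) - u)/u^2 with the
  numerator frozen on unit intervals. Its truncations are finite sums, hence entire.\<close>

lemma arc_kernel:
  fixes z :: complex
  assumes "norm z = R" "R > 0"
  shows "1 / z + z / of_real (R\<^sup>2) = of_real (2 * Re z / R\<^sup>2)"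
proof -
  have "z \<noteq> 0" using assms by auto
  have "1 / z = cnj z / of_real (R\<^sup>2)"
    using \<open>z \<noteq> 0\<close> complex_norm_square[of z] assms by (simp add: field_simps)
  then have "1 / z + z / of_real (R\<^sup>2) = (z + cnj z) / of_real (R\<^sup>2)"
    by (simp add: add_divide_distrib)
  then show ?thesis by (simp add: complex_add_cnj)
qed

lemma right_arc_point:
  assumes "z \<in> path_image (part_circlepath 0 R (-pi/2) (pi/2))" "R > 0"
  shows "norm z = R" "Re z \<ge> 0"
proof -
  obtain t where t: "-pi/2 \<le> t" "t \<le> pi/2" "z = of_real R * cis t"
    using assms by (auto simp: path_image_part_circlepath' closed_segment_eq_real_ivl)
  show "norm z = R" using t assms by (simp add: norm_mult)
  show "Re z \<ge> 0" using t assms cos_ge_zero[of t] by simp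
qed

lemma left_arc_point:
  assumes "z \<in> path_image (part_circlepath 0 R (pi/2) (3*pi/2))" "R > 0"
  shows "norm z = R" "Re z \<le> 0"
proof -
  obtain t where t: "pi/2 \<le> t" "t \<le> 3*pi/2" "z = of_real R * cis t"
    using assms by (auto simp: path_image_part_circlepath' closed_segment_eq_real_ivl)
  show "norm z = R" using t assms by (simp add: norm_mult)
  have "cos (t - pi) \<ge> 0" using t by (intro cos_ge_zero) auto
  then show "Re z \<le> 0" using t assms by (simp add: mult_le_0_iff)
qed

text \<open>Isolates the two points of the circle at which bounds of the form C / |Re z| say
  nothing; a finite exceptional set is harmless in the arc estimates.\<close>

lemma norm_eq_Re_0:
  assumes "norm z = R" "Re z = 0" shows "z \<in> {\<i> * of_real R, -\<i> * of_real R}"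
proof -
  have "\<bar>Im z\<bar> = R" using assms by (simp add: cmod_def)
  then show ?thesis using assms by (auto simp: complex_eq_iff abs_if split: if_splits)
qed

lemma arc_integral_inverse:
  assumes "R > 0" "a < b"
  shows "((\<lambda>z. c / z) has_contour_integral (c * \<i> * of_real (b - a))) (part_circlepath 0 R a b)"
proof -
  have "((\<lambda>t. c * \<i>) has_integral (b - a) *\<^sub>R (c * \<i>)) {a..b}"
    using has_integral_const_real[of "c * \<i>" a b] assms by simp
  then show ?thesis
    using assms by (simp add: has_contour_integral_part_circlepath_iff scaleR_conv_of_real mult_ac)
qed

lemma arcs_integral_entire:
  assumes F: "F holomorphic_on UNIV"
  shows "contour_integral (part_circlepath 0 R (-pi/2) (pi/2)) F
       + contour_integral (part_circlepath 0 R (pi/2) (3*pi/2)) F = 0"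
proof -
  let ?A = "part_circlepath 0 R (-pi/2) (pi/2)" and ?B = "part_circlepath 0 R (pi/2) (3*pi/2)"
  have e: "exp (\<i> * of_real (3*pi/2)) = exp (\<i> * of_real (-pi/2))"
  proof -
    have "3*pi/2 = -pi/2 + 2*pi" by simp
    then have "cis (3*pi/2) = cis (-pi/2)"
      by (simp only: complex_eq_iff cis.sel sin_periodic cos_periodic)
    then show ?thesis by (simp only: cis_conv_exp)
  qed
  have fin: "pathfinish ?B = pathstart ?A" using e by simp
  have j: "pathfinish ?A = pathstart ?B" by simp
  have "(F has_contour_integral 0) (?A +++ ?B)"
    using fin j by (intro Cauchy_theorem_convex_simple[OF F]) (auto intro!: valid_path_join)
  moreover have "F contour_integrable_on ?A" "F contour_integrable_on ?B"
    using F by (auto intro!: contour_integrable_holomorphic_simple[where S=UNIV])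
  ultimately show ?thesis
    by (metis contour_integral_join contour_integral_unique valid_path_part_circlepath)
qed

text \<open>Removing \<open>G 0 / z\<close> leaves an entire function, whose integrals over the two
  arcs cancel. The summand z / R^2 does not change the residue at 0, but makes the kernel vanish at
  the two ends of each arc. The circle stays split because its halves are estimated
  differently.\<close>

lemma entire_arcs_kernel:
  assumes G: "G holomorphic_on UNIV" and R: "R > 0"
  shows "contour_integral (part_circlepath 0 R (-pi/2) (pi/2)) (\<lambda>z. G z * (1 / z + z / of_real (R\<^sup>2)))
       + contour_integral (part_circlepath 0 R (pi/2) (3*pi/2)) (\<lambda>z. G z * (1 / z + z / of_real (R\<^sup>2)))
       = 2 * of_real pi * \<i> * G 0"
proof -
  define q where "q = (\<lambda>z. (if z = 0 then deriv G 0 else (G z - G 0) / (z - 0)) + G z * z / of_real (R\<^sup>2))"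
  have q: "q holomorphic_on UNIV"
    unfolding q_def using G R by (intro holomorphic_intros pole_lemma_open) auto
  have split: "contour_integral (part_circlepath 0 R a b) (\<lambda>z. G z * (1 / z + z / of_real (R\<^sup>2)))
     = contour_integral (part_circlepath 0 R a b) q + G 0 * \<i> * of_real (b - a)" if ab: "a < b" for a b
  proof -
    have "(q has_contour_integral contour_integral (part_circlepath 0 R a b) q) (part_circlepath 0 R a b)"
      using q by (intro has_contour_integral_integral contour_integrable_holomorphic_simple[where S=UNIV]) auto
    from has_contour_integral_add[OF this arc_integral_inverse[OF R ab, of "G 0"]]
    have "((\<lambda>z. q z + G 0 / z) has_contour_integral
        (contour_integral (part_circlepath 0 R a b) q + G 0 * \<i> * of_real (b - a))) (part_circlepath 0 R a b)" .
    moreover have "q z + G 0 / z = G z * (1 / z + z / of_real (R\<^sup>2))"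
      if "z \<in> path_image (part_circlepath 0 R a b)" for z
    proof -
      have "z \<noteq> 0" using that R ab by (auto simp: path_image_part_circlepath')
      then show ?thesis by (simp add: q_def field_simps)
    qed
    ultimately show ?thesis
      by (metis (no_types, lifting) contour_integral_unique has_contour_integral_eq)
  qed
  show ?thesis
    using arcs_integral_entire[OF q, of R] split[of "-pi/2" "pi/2"] split[of "pi/2" "3*pi/2"]
    by (simp add: algebra_simps add_eq_0_iff)
qed

text \<open>A Riemann--Lebesgue estimate: integrating by parts gains the factor 1 / L.\<close>
lemma oscillating_segment_integral:
  assumes U: "open U" "\<And>z. Re z = 0 \<Longrightarrow> z \<in> U" and F: "F holomorphic_on U" and R: "R > 0"
  shows "\<exists>M. \<forall>L>0. norm (contour_integral (linepath (\<i> * of_real R) (-\<i> * of_real R))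
                          (\<lambda>z. F z * exp (of_real L * z))) \<le> M / L"
proof -
  define a b where "a = \<i> * of_real R" and "b = -\<i> * of_real R"
  have seg: "Re z = 0" if "z \<in> closed_segment a b" for z
    using that by (auto simp: closed_segment_def a_def b_def)
  have segU: "closed_segment a b \<subseteq> U" using seg U by auto
  have F': "deriv F holomorphic_on U" using F U by (intro holomorphic_deriv)
  obtain B where B: "\<And>z. z \<in> closed_segment a b \<Longrightarrow> norm (F z) \<le> B"
  proof -
    have "compact (F ` closed_segment a b)"
      using F segU by (intro compact_continuous_image)
        (auto intro: holomorphic_on_imp_continuous_on holomorphic_on_subset)
    then show ?thesis using that by (meson bounded_iff compact_imp_bounded image_eqI)
  qed
  obtain B' where B': "\<And>z. z \<in> closed_segment a b \<Longrightarrow> norm (deriv F z) \<le> B'"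
  proof -
    have "compact (deriv F ` closed_segment a b)"
      using F' segU by (intro compact_continuous_image)
        (auto intro: holomorphic_on_imp_continuous_on holomorphic_on_subset)
    then show ?thesis using that by (meson bounded_iff compact_imp_bounded image_eqI)
  qed
  have B'0: "B' \<ge> 0" using B'[of a] norm_ge_zero[of "deriv F a"] by (meson ends_in_segment(1) order_trans)
  have "norm (contour_integral (linepath a b) (\<lambda>z. F z * exp (of_real L * z)))
          \<le> (2 * B + B' * norm (b - a)) / L" if L: "L > 0" for L
  proof -
    define e where "e = (\<lambda>z. exp (of_real L * z :: complex))"
    have ne: "norm (e z) = 1" if "z \<in> closed_segment a b" for z
      using seg[OF that] by (simp add: e_def)
    have hF: "(F has_field_derivative deriv F z) (at z)" if "z \<in> U" for z
      using F U that by (meson holomorphic_derivI)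
    have der: "((\<lambda>z. F z * e z) has_field_derivative (deriv F z * e z + of_real L * (F z * e z))) (at z)"
      if "z \<in> U" for z
      unfolding e_def by (rule derivative_eq_intros hF that refl | simp add: algebra_simps)+
    have "((\<lambda>z. deriv F z * e z + of_real L * (F z * e z)) has_contour_integral
        (F b * e b - F a * e a)) (linepath a b)"
    proof -
      have "((\<lambda>z. deriv F z * e z + of_real L * (F z * e z)) has_contour_integral
          ((\<lambda>z. F z * e z) (pathfinish (linepath a b)) - (\<lambda>z. F z * e z) (pathstart (linepath a b)))) (linepath a b)"
        using segU by (intro contour_integral_primitive[where S=U])
          (auto intro: has_field_derivative_at_within der)
      then show ?thesis by simp
    qed
    moreover have I1: "((\<lambda>z. deriv F z * e z) has_contour_integral
        contour_integral (linepath a b) (\<lambda>z. deriv F z * e z)) (linepath a b)"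
      unfolding e_def using F F' segU U
      by (intro has_contour_integral_integral contour_integrable_holomorphic_simple[where S=U] holomorphic_intros) auto
    moreover have I2: "((\<lambda>z. F z * e z) has_contour_integral
        contour_integral (linepath a b) (\<lambda>z. F z * e z)) (linepath a b)"
      unfolding e_def using F segU U
      by (intro has_contour_integral_integral contour_integrable_holomorphic_simple[where S=U] holomorphic_intros) auto
    moreover have "((\<lambda>z. deriv F z * e z + of_real L * (F z * e z)) has_contour_integral
        (contour_integral (linepath a b) (\<lambda>z. deriv F z * e z)
         + of_real L * contour_integral (linepath a b) (\<lambda>z. F z * e z))) (linepath a b)"
      by (intro has_contour_integral_add has_contour_integral_lmul I1 I2)
    ultimately have "F b * e b - F a * e a = contour_integral (linepath a b) (\<lambda>z. deriv F z * e z)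
         + of_real L * contour_integral (linepath a b) (\<lambda>z. F z * e z)"
      by (intro has_contour_integral_unique)
    then have eq: "of_real L * contour_integral (linepath a b) (\<lambda>z. F z * e z)
        = F b * e b - F a * e a - contour_integral (linepath a b) (\<lambda>z. deriv F z * e z)"
      by simp
    have "norm (contour_integral (linepath a b) (\<lambda>z. deriv F z * e z)) \<le> B' * norm (b - a)"
      using I1 B'0 B' ne by (intro has_contour_integral_bound_linepath) (auto simp: norm_mult)
    moreover have "norm (F b * e b) \<le> B" "norm (F a * e a) \<le> B"
      using B ne by (auto simp: norm_mult)
    moreover have "norm (u - v - w) \<le> norm u + norm v + norm w" for u v w :: complex
      using norm_triangle_ineq4[of "u - v" w] norm_triangle_ineq4[of u v] by linarith
    ultimately have "norm (of_real L * contour_integral (linepath a b) (\<lambda>z. F z * e z)) \<le> 2 * B + B' * norm (b - a)"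
      unfolding eq by (smt (verit))
    then show ?thesis using L by (simp add: norm_mult e_def pos_le_divide_eq mult.commute)
  qed
  then show ?thesis unfolding a_def b_def by blast
qed

text \<open>Newman's contour argument. The circle integral of \<open>P n\<close> times exp(L z)
  times the kernel is 2 pi i \<open>P n 0\<close>. On the right arc \<open>P n\<close> is
  \<open>S\<close> minus the tail \<open>S - P n\<close>: the kernel has size 2 |Re z| / R^2 and
  cancels the 1 / Re z in the bound of the tail, while the part with \<open>S\<close> moves to the
  diameter on the imaginary axis, where oscillation makes it O(1 / L). On the left arc
  \<open>P n\<close> is bounded directly. Altogether the limsup of |\<open>P n 0\<close>| is at most
  2 C / R.\<close>

lemma Newman_centered:
  fixes S :: "complex \<Rightarrow> complex" and P :: "nat \<Rightarrow> complex \<Rightarrow> complex" and L :: "nat \<Rightarrow> real"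
  assumes U: "open U" "{z. Re z \<ge> 0} \<subseteq> U" and S: "S holomorphic_on U" and S0: "S 0 = 0"
    and P: "\<And>n. P n holomorphic_on UNIV"
    and L: "filterlim L at_top sequentially"
    and C: "C \<ge> 0" "K \<ge> 0"
    and right: "\<And>n z. Re z > 0 \<Longrightarrow> norm (S z - P n z) \<le> C * exp (- L n * Re z) / Re z"
    and left: "\<And>n z. Re z < 0 \<Longrightarrow> z \<noteq> -1 \<Longrightarrow> norm (P n z) \<le> C * exp (- L n * Re z) / (- Re z) + K"
  shows "(\<lambda>n. P n 0) \<longlonglongrightarrow> 0"
proof (rule LIMSEQ_I)
  fix \<epsilon> :: real assume \<epsilon>: "\<epsilon> > 0"
  \<comment> \<open>R at least 2 keeps the left arc away from -1, where the left bound is not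
    assumed; R at least 4 C / \<epsilon> makes the limiting bound 2 C / R at most \<epsilon> /
    2.\<close>
  define R where "R = max 2 (4 * C / \<epsilon>)"
  have R: "R > 1" "R > 0" and CR: "2 * C / R \<le> \<epsilon> / 2"
    using \<epsilon> C by (auto simp: R_def field_simps max_def)
  define A where "A = part_circlepath 0 R (-pi/2) (pi/2)"
  define B where "B = part_circlepath 0 R (pi/2) (3*pi/2)"
  define k where "k = (\<lambda>z::complex. 1 / z + z / of_real (R\<^sup>2))"
  \<comment> \<open>The product of \<open>S\<close> and the kernel with its pole at 0 filled in.
    This is where \<open>S 0 = 0\<close> enters: the diameter runs through the origin.\<close>
  define F where "F = (\<lambda>z. (if z = 0 then deriv S 0 else (S z - S 0) / (z - 0)) + S z * z / of_real (R\<^sup>2))"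
  have F: "F holomorphic_on U"
    unfolding F_def using S U R by (intro holomorphic_intros pole_lemma_open) auto
  have FS: "F z = S z * k z" if "z \<noteq> 0" for z
    using that S0 by (simp add: F_def k_def field_simps)
  have "\<exists>M. \<forall>L>0. norm (contour_integral (linepath (\<i> * of_real R) (-\<i> * of_real R))
                          (\<lambda>z. F z * exp (of_real L * z))) \<le> M / L"
    by (rule oscillating_segment_integral[where U=U]) (use U F R in auto)
  then obtain M where M: "\<And>L. L > 0 \<Longrightarrow> norm (contour_integral (linepath (\<i> * of_real R) (-\<i> * of_real R))
                          (\<lambda>z. F z * exp (of_real L * z))) \<le> M / L" by blast
  have main: "2 * pi * norm (P n 0) \<le> M / L n + 2 * C / R\<^sup>2 * R * pi + (2 * C + 2 * K / L n) / R\<^sup>2 * R * pi"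
    if Ln: "L n > 0" for n
  proof -
    define e where "e = (\<lambda>z::complex. exp (of_real (L n) * z))"
    have ne: "norm (e z) = exp (L n * Re z)" for z by (simp add: e_def)
    have nk: "norm (k z) = 2 * \<bar>Re z\<bar> / R\<^sup>2" if "norm z = R" for z
      unfolding k_def arc_kernel[OF that R(2)] norm_of_real by (simp add: abs_mult)
    have G: "(\<lambda>z. P n z * e z) holomorphic_on UNIV"
      unfolding e_def by (intro holomorphic_intros P)
    have sum: "contour_integral A (\<lambda>z. P n z * e z * k z) + contour_integral B (\<lambda>z. P n z * e z * k z)
        = 2 * of_real pi * \<i> * P n 0"
      using entire_arcs_kernel[OF G R(2)] by (simp add: A_def B_def k_def e_def)
    have A0: "z \<noteq> 0" "norm z = R" "Re z \<ge> 0" if "z \<in> path_image A" for z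
      using right_arc_point[of z R] that R by (auto simp: A_def)
    have B0: "z \<noteq> 0" "norm z = R" "Re z \<le> 0" if "z \<in> path_image B" for z
      using left_arc_point[of z R] that R by (auto simp: B_def)
    have AU: "path_image A \<subseteq> U - {0}" using A0 U by auto
    have intA: "(\<lambda>z. P n z * e z * k z) contour_integrable_on A"
      unfolding k_def e_def using AU U R P
      by (intro contour_integrable_holomorphic_simple[where S="U - {0}"] holomorphic_intros)
         (auto simp: A_def intro: holomorphic_on_subset)
    have intB: "(\<lambda>z. P n z * e z * k z) contour_integrable_on B"
      unfolding k_def e_def using B0 R P
      by (intro contour_integrable_holomorphic_simple[where S="- {0}"] holomorphic_intros)
         (auto simp: B_def intro: holomorphic_on_subset[OF P])
    have intF: "(\<lambda>z. F z * e z) contour_integrable_on A"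
      unfolding e_def using AU U F
      by (intro contour_integrable_holomorphic_simple[where S="U"] holomorphic_intros)
         (auto simp: A_def)
    have diff: "contour_integral A (\<lambda>z. F z * e z - P n z * e z * k z)
        = contour_integral A (\<lambda>z. F z * e z) - contour_integral A (\<lambda>z. P n z * e z * k z)"
      using intF intA by (rule contour_integral_diff)
    have bA: "norm (contour_integral A (\<lambda>z. F z * e z - P n z * e z * k z)) \<le> 2 * C / R\<^sup>2 * R * (pi/2 - (-pi/2))"
      unfolding A_def
    proof (rule contour_integral_bound_part_circlepath_strong[where k="{\<i> * of_real R, -\<i> * of_real R}"])
      fix z assume "z \<in> path_image (part_circlepath 0 R (-pi/2) (pi/2)) - {\<i> * of_real R, -\<i> * of_real R}"
      then have z: "z \<noteq> 0" "norm z = R" "Re z \<ge> 0" "Re z \<noteq> 0"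
        using A0[of z] norm_eq_Re_0[of z R] by (auto simp: A_def)
      then have "norm (F z * e z - P n z * e z * k z) = norm (S z - P n z) * norm (e z) * norm (k z)"
        using FS[of z] by (simp add: algebra_simps flip: norm_mult)
      also have "\<dots> \<le> (C * exp (- L n * Re z) / Re z) * exp (L n * Re z) * (2 * Re z / R\<^sup>2)"
        unfolding ne nk[OF z(2)] using z right[of z n] C by (intro mult_mono) auto
      also have "\<dots> = 2 * C / R\<^sup>2 * (exp (- L n * Re z) * exp (L n * Re z))" using z by (simp add: field_simps)
      also have "\<dots> = 2 * C / R\<^sup>2" by (simp flip: exp_add)
      finally show "norm (F z * e z - P n z * e z * k z) \<le> 2 * C / R\<^sup>2" .
    next
      show "(\<lambda>z. F z * e z - P n z * e z * k z) contour_integrable_on part_circlepath 0 R (- pi / 2) (pi / 2)"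
        using intF intA unfolding A_def by (rule contour_integrable_diff)
    qed (use R C in auto)
    have bB: "norm (contour_integral B (\<lambda>z. P n z * e z * k z)) \<le> (2 * C + 2 * K / L n) / R\<^sup>2 * R * (3*pi/2 - pi/2)"
      unfolding B_def
    proof (rule contour_integral_bound_part_circlepath_strong[where k="{\<i> * of_real R, -\<i> * of_real R}"])
      fix z assume "z \<in> path_image (part_circlepath 0 R (pi/2) (3*pi/2)) - {\<i> * of_real R, -\<i> * of_real R}"
      then have z: "z \<noteq> 0" "norm z = R" "Re z < 0"
        using B0[of z] norm_eq_Re_0[of z R] by (auto simp: B_def order.strict_iff_order)
      have "z \<noteq> -1" using z R by auto
      have alg: "(C * p / x + K) * q * (2 * x / r) = 2 * C / r * (p * q) + 2 * K / r * (x * q)"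
        if "x \<noteq> 0" "r \<noteq> 0" for p q x r :: real
        using that by (simp add: field_simps)
      have "norm (P n z * e z * k z) = norm (P n z) * norm (e z) * norm (k z)"
        by (simp add: norm_mult)
      also have "\<dots> \<le> (C * exp (- L n * Re z) / (- Re z) + K) * exp (L n * Re z) * (2 * (- Re z) / R\<^sup>2)"
        unfolding ne nk[OF z(2)] using z left[OF z(3) \<open>z \<noteq> -1\<close>, of n]
        by (simp only: abs_of_neg) (intro mult_right_mono; simp add: divide_nonpos_nonneg)
      also have "\<dots> = 2 * C / R\<^sup>2 * (exp (- L n * Re z) * exp (L n * Re z)) + 2 * K / R\<^sup>2 * ((- Re z) * exp (L n * Re z))"
        using alg[of "- Re z" "R\<^sup>2"] z R by simp
      also have "\<dots> = 2 * C / R\<^sup>2 + 2 * K / R\<^sup>2 * ((- Re z) * exp (L n * Re z))" by (simp flip: exp_add)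
      \<comment> \<open>The constant K is not damped by the kernel alone, but x exp(- L x) is at
        most 1 / L, so its share vanishes as L grows.\<close>
      also have "\<dots> \<le> 2 * C / R\<^sup>2 + 2 * K / R\<^sup>2 * (1 / L n)"
      proof -
        have "L n * (- Re z) \<le> exp (L n * (- Re z))" using exp_ge_add_one_self[of "L n * (- Re z)"] by linarith
        then have "(- Re z) * exp (L n * Re z) \<le> 1 / L n"
          using Ln by (simp add: field_simps exp_minus)
        then show ?thesis using C R by (intro add_left_mono mult_left_mono) auto
      qed
      also have "\<dots> = (2 * C + 2 * K / L n) / R\<^sup>2" by (simp add: add_divide_distrib mult.commute)
      finally show "norm (P n z * e z * k z) \<le> (2 * C + 2 * K / L n) / R\<^sup>2" .
    next
      show "(\<lambda>z. P n z * e z * k z) contour_integrable_on part_circlepath 0 R (pi / 2) (3 * pi / 2)"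
        using intB by (simp add: B_def)
    qed (use R C Ln in auto)
    have closed: "contour_integral A (\<lambda>z. F z * e z)
        = - contour_integral (linepath (\<i> * of_real R) (-\<i> * of_real R)) (\<lambda>z. F z * e z)"
    proof -
      let ?l = "linepath (\<i> * of_real R) (-\<i> * of_real R)"
      have "exp (\<i> * of_real (pi/2)) = \<i>" "exp (\<i> * of_real (-pi/2)) = -\<i>"
        by (simp_all only: cis_conv_exp[symmetric]) (simp_all add: complex_eq_iff)
      then have ends: "pathfinish A = pathstart ?l" "pathfinish ?l = pathstart A"
        by (simp_all only: A_def pathfinish_part_circlepath pathstart_part_circlepath
              pathstart_linepath pathfinish_linepath) simp_all
      have sub: "path_image ?l \<subseteq> {z. Re z \<ge> 0}" by (auto simp: closed_segment_def)
      have "((\<lambda>z. F z * e z) has_contour_integral 0) (A +++ ?l)"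
      proof (rule Cauchy_theorem_convex_simple[where S="{z. Re z \<ge> 0}"])
        show "(\<lambda>z. F z * e z) holomorphic_on {z. Re z \<ge> 0}"
          unfolding e_def using F U by (intro holomorphic_intros) (auto intro: holomorphic_on_subset)
        show "convex {z. Re z \<ge> 0}" by (rule convex_halfspace_Re_ge)
        show "path_image (A +++ ?l) \<subseteq> {z. 0 \<le> Re z}"
          using sub A0 ends by (auto simp: path_image_join)
      qed (use ends in \<open>auto simp: A_def\<close>)
      then have "contour_integral (A +++ ?l) (\<lambda>z. F z * e z) = 0" by (rule contour_integral_unique)
      moreover have "(\<lambda>z. F z * e z) contour_integrable_on ?l"
        unfolding e_def using sub U F
        by (intro contour_integrable_holomorphic_simple[where S="U"] holomorphic_intros) auto
      then have "contour_integral (A +++ ?l) (\<lambda>z. F z * e z)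
          = contour_integral A (\<lambda>z. F z * e z) + contour_integral ?l (\<lambda>z. F z * e z)"
        using intF by (intro contour_integral_join) (auto simp: A_def)
      ultimately have "contour_integral A (\<lambda>z. F z * e z) + contour_integral ?l (\<lambda>z. F z * e z) = 0"
        by simp
      then show ?thesis by (simp add: add_eq_0_iff)
    qed
    have bF: "norm (contour_integral A (\<lambda>z. F z * e z)) \<le> M / L n"
      using M[OF Ln] unfolding closed norm_minus_cancel unfolding e_def .
    have tri: "norm (u - v + w) \<le> norm u + norm v + norm w" for u v w :: complex
      using norm_triangle_ineq[of "u - v" w] norm_triangle_ineq4[of u v] by linarith
    have "2 * of_real pi * \<i> * P n 0 = contour_integral A (\<lambda>z. F z * e z)
        - contour_integral A (\<lambda>z. F z * e z - P n z * e z * k z) + contour_integral B (\<lambda>z. P n z * e z * k z)"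
      using sum diff by simp
    then have "norm (2 * of_real pi * \<i> * P n 0) \<le> M / L n + 2 * C / R\<^sup>2 * R * (pi/2 - (-pi/2))
        + (2 * C + 2 * K / L n) / R\<^sup>2 * R * (3*pi/2 - pi/2)"
      using bF bA bB tri by (smt (verit))
    then show ?thesis by (simp add: norm_mult)
  qed
  have lim: "(\<lambda>n. (M / L n + 2 * C / R\<^sup>2 * R * pi + (2 * C + 2 * K / L n) / R\<^sup>2 * R * pi) / (2 * pi))
     \<longlonglongrightarrow> (0 + 2 * C / R\<^sup>2 * R * pi + (2 * C + 0) / R\<^sup>2 * R * pi) / (2 * pi)"
    by (intro tendsto_intros real_tendsto_divide_at_top[OF tendsto_const L]) (use R in auto)
  have "(0 + 2 * C / R\<^sup>2 * R * pi + (2 * C + 0) / R\<^sup>2 * R * pi) / (2 * pi) = 2 * C / R"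
    using R by (simp add: field_simps power2_eq_square)
  also have "\<dots> < \<epsilon>" using CR \<epsilon> by linarith
  finally have "eventually (\<lambda>n. (M / L n + 2 * C / R\<^sup>2 * R * pi + (2 * C + 2 * K / L n) / R\<^sup>2 * R * pi) / (2 * pi) < \<epsilon>) sequentially"
    using lim by (rule order_tendstoD(2)[rotated])
  moreover have "eventually (\<lambda>n. L n > 0) sequentially"
    using L by (simp add: filterlim_at_top_dense)
  ultimately have "eventually (\<lambda>n. norm (P n 0 - 0) < \<epsilon>) sequentially"
  proof eventually_elim
    case (elim n)
    have "norm (P n 0) \<le> (M / L n + 2 * C / R\<^sup>2 * R * pi + (2 * C + 2 * K / L n) / R\<^sup>2 * R * pi) / (2 * pi)"
      using main[OF elim(2)] by (subst pos_le_divide_eq) (auto simp: mult.commute)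
    then show ?case using elim by simp
  qed
  then show "\<exists>N. \<forall>n\<ge>N. norm (P n 0 - 0) < \<epsilon>" by (simp add: eventually_sequentially)
qed

text \<open>Subtracting the constant \<open>S 0\<close> from both functions reduces to the centred
  case: it cancels in the right bound and adds \<open>norm (S 0)\<close> to the left one.\<close>

lemma Newman_tauberian:
  fixes S :: "complex \<Rightarrow> complex" and P :: "nat \<Rightarrow> complex \<Rightarrow> complex" and L :: "nat \<Rightarrow> real"
  assumes U: "open U" "{z. Re z \<ge> 0} \<subseteq> U" and S: "S holomorphic_on U"
    and P: "\<And>n. P n holomorphic_on UNIV"
    and L: "filterlim L at_top sequentially"
    and C: "C \<ge> 0"
    and right: "\<And>n z. Re z > 0 \<Longrightarrow> norm (S z - P n z) \<le> C * exp (- L n * Re z) / Re z"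
    and left: "\<And>n z. Re z < 0 \<Longrightarrow> z \<noteq> -1 \<Longrightarrow> norm (P n z) \<le> C * exp (- L n * Re z) / (- Re z)"
  shows "(\<lambda>n. P n 0) \<longlonglongrightarrow> S 0"
proof -
  have "(\<lambda>n. P n 0 - S 0) \<longlonglongrightarrow> 0"
  proof (rule Newman_centered[where S="\<lambda>z. S z - S 0" and P="\<lambda>n z. P n z - S 0" and K="norm (S 0)" and U=U and C=C and L=L])
    show "norm (P n z - S 0) \<le> C * exp (- L n * Re z) / (- Re z) + norm (S 0)"
      if "Re z < 0" "z \<noteq> -1" for n z
      using left[OF that, of n] norm_triangle_ineq4[of "P n z" "S 0"] by linarith
  qed (use assms in \<open>auto intro!: holomorphic_intros\<close>)
  then show ?thesis by (simp add: LIM_zero_iff)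
qed

section \<open>The zeta function\<close>

lemma has_vector_derivative_of_real_powr:
  assumes "u > 0"
  shows "((\<lambda>u. of_real u powr w :: complex) has_vector_derivative w * of_real u powr (w - 1)) (at u)"
  using assms by (intro has_vector_derivative_real_field has_field_derivative_powr) auto

lemma norm_of_real_powr:
  "u > 0 \<Longrightarrow> norm (of_real u powr w :: complex) = u powr Re w"
  by (simp add: norm_powr_real_powr)

lemma powr_diff_le:
  assumes "0 < a" "a \<le> b" "Re w \<le> 1"
  shows "norm (of_real b powr w - of_real a powr w :: complex) \<le> norm w * a powr (Re w - 1) * (b - a)"
proof (cases "a = b")
  case False
  have "norm (of_real b powr w - of_real a powr w :: complex)
      \<le> norm w * a powr (Re w - 1) * b - norm w * a powr (Re w - 1) * a"
  proof (rule differentiable_bound_general)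
    show "((\<lambda>u. of_real u powr w :: complex) has_vector_derivative w * of_real u powr (w - 1)) (at u)"
      if "a < u" "u < b" for u using that assms by (intro has_vector_derivative_of_real_powr) auto
    show "continuous_on {a..b} (\<lambda>u. of_real u powr w :: complex)"
      using assms by (intro continuous_intros) (auto simp: complex_nonpos_Reals_iff)
    show "((\<lambda>u. norm w * a powr (Re w - 1) * u) has_vector_derivative norm w * a powr (Re w - 1)) (at u)" for u
      by (auto intro!: derivative_eq_intros simp flip: has_real_derivative_iff_has_vector_derivative)
    show "norm (w * of_real u powr (w - 1) :: complex) \<le> norm w * a powr (Re w - 1)"
      if "a < u" "u < b" for u
      using that assms by (auto simp: norm_mult norm_of_real_powr intro!: mult_left_mono powr_mono2')
  qed (use assms False in \<open>auto intro!: continuous_intros\<close>)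
  then show ?thesis by (simp add: algebra_simps)
qed auto

text \<open>The factor a is at most u on [a, b], so it can be moved under the integral of |w| u^(Re
  w - 1). The result is an increment of one fixed function and telescopes over unit intervals; the
  weight a is there to absorb a coefficient of linear growth.\<close>

lemma powr_diff_weighted_le:
  assumes "0 < a" "a \<le> b" "Re w + 1 \<noteq> 0"
  shows "a * norm (of_real b powr w - of_real a powr w :: complex)
           \<le> norm w * (b powr (Re w + 1) - a powr (Re w + 1)) / (Re w + 1)"
proof (cases "a = b")
  case False
  have "norm (of_real a * of_real b powr w - of_real a * of_real a powr w :: complex)
      \<le> norm w * b powr (Re w + 1) / (Re w + 1) - norm w * a powr (Re w + 1) / (Re w + 1)"
  proof (rule differentiable_bound_general)
    show "((\<lambda>u. of_real a * of_real u powr w :: complex) has_vector_derivative of_real a * (w * of_real u powr (w - 1))) (at u)"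
      if "a < u" "u < b" for u using that assms
      by (intro has_vector_derivative_mult_right has_vector_derivative_of_real_powr) auto
    show "continuous_on {a..b} (\<lambda>u. of_real a * of_real u powr w :: complex)"
      using assms by (intro continuous_intros) (auto simp: complex_nonpos_Reals_iff)
    show "((\<lambda>u. norm w * u powr (Re w + 1) / (Re w + 1)) has_vector_derivative norm w * u powr Re w) (at u)"
      if "a < u" "u < b" for u
      using that assms
      by (auto intro!: derivative_eq_intros simp flip: has_real_derivative_iff_has_vector_derivative)
    show "norm (of_real a * (w * of_real u powr (w - 1)) :: complex) \<le> norm w * u powr Re w"
      if "a < u" "u < b" for u
    proof -
      have "norm (of_real a * (w * of_real u powr (w - 1)) :: complex) = norm w * (a * u powr (Re w - 1))"
        using that assms by (simp add: norm_mult norm_of_real_powr)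
      also have "\<dots> \<le> norm w * (u * u powr (Re w - 1))"
        using that by (intro mult_left_mono mult_right_mono) auto
      also have "u * u powr (Re w - 1) = u powr Re w"
        using that assms by (simp add: powr_diff)
      finally show ?thesis .
    qed
    show "continuous_on {a..b} (\<lambda>u. norm w * u powr (Re w + 1) / (Re w + 1))"
      using assms by (intro continuous_intros) auto
  qed (use assms False in auto)
  moreover have "norm (of_real a * of_real b powr w - of_real a * of_real a powr w :: complex)
      = a * norm (of_real b powr w - of_real a powr w :: complex)"
    using assms by (simp flip: right_diff_distrib add: norm_mult)
  ultimately show ?thesis by (simp add: right_diff_distrib diff_divide_distrib)
qed auto

text \<open>For n > 0 this is (s - 1) times the difference between n^(-s) and the integral of u^(-s)
  over [n, n + 1]. The bracket telescopes away for Re s > 1, but it improves the decay by a factor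
  1/n and so gives convergence for Re s > 0. Since \<open>0 powr w = 0\<close>, the term with n = 0
  equals 1.\<close>

definition zterm :: "nat \<Rightarrow> complex \<Rightarrow> complex" where
  "zterm n s = (s - 1) * of_nat n powr (-s) + (of_nat (Suc n) powr (1 - s) - of_nat n powr (1 - s))"

text \<open>The regularised zeta function (s - 1) * zeta s, continued to Re s > 0.\<close>
definition zeta_reg :: "complex \<Rightarrow> complex" where
  "zeta_reg s = (\<Sum>n. zterm n s)"

lemma norm_zterm_le:
  assumes "n > 0" "Re s > 0"
  shows "norm (zterm n s) \<le> norm (s - 1) * norm s * real n powr (- Re s - 1)"
proof -
  define a where "a = real n"
  have a: "a > 0" using assms by (simp add: a_def)
  \<comment> \<open>u^(1 - s) minus a linear function with the same derivative at a; its increment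
    over [a, a + 1] is exactly \<open>zterm n s\<close>, so its derivative only has to be bounded by
    one more difference of powers.\<close>
  define f where "f = (\<lambda>u. of_real u powr (1 - s) - of_real u * ((1 - s) * of_real a powr (-s)) :: complex)"
  have "norm (f (a + 1) - f a) \<le> norm (s - 1) * norm s * a powr (- Re s - 1) * (a + 1)
       - norm (s - 1) * norm s * a powr (- Re s - 1) * a"
  proof (rule differentiable_bound_general)
    show "(f has_vector_derivative (1 - s) * of_real u powr (1 - s - 1) - 1 * ((1 - s) * of_real a powr (-s))) (at u)"
      if "a < u" "u < a + 1" for u
      unfolding f_def using that a
      by (intro has_vector_derivative_diff has_vector_derivative_of_real_powr has_vector_derivative_mult_left)
         (auto intro!: derivative_eq_intros)
    show "continuous_on {a..a+1} f" unfolding f_def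
      using a by (intro continuous_intros) (auto simp: complex_nonpos_Reals_iff)
    show "((\<lambda>u. norm (s - 1) * norm s * a powr (- Re s - 1) * u) has_vector_derivative norm (s - 1) * norm s * a powr (- Re s - 1)) (at u)" for u
      by (auto intro!: derivative_eq_intros simp flip: has_real_derivative_iff_has_vector_derivative)
    show "norm ((1 - s) * of_real u powr (1 - s - 1) - 1 * ((1 - s) * of_real a powr (-s)) :: complex)
         \<le> norm (s - 1) * norm s * a powr (- Re s - 1)" if u: "a < u" "u < a + 1" for u
    proof -
      have "norm ((1 - s) * of_real u powr (1 - s - 1) - 1 * ((1 - s) * of_real a powr (-s)) :: complex)
          = norm (s - 1) * norm (of_real u powr (-s) - of_real a powr (-s) :: complex)"
        by (simp flip: right_diff_distrib add: norm_mult norm_minus_commute)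
      also have "\<dots> \<le> norm (s - 1) * (norm (-s) * a powr (Re (-s) - 1) * (u - a))"
        using u a assms by (intro mult_left_mono powr_diff_le) auto
      also have "\<dots> \<le> norm (s - 1) * (norm (-s) * a powr (Re (-s) - 1) * 1)"
        using u by (intro mult_left_mono) auto
      finally show ?thesis by (simp add: mult_ac)
    qed
  qed (use a in \<open>auto intro!: continuous_intros\<close>)
  moreover have "f (a + 1) - f a = zterm n s"
    by (simp add: f_def zterm_def a_def algebra_simps)
  ultimately show ?thesis by (simp add: a_def algebra_simps)
qed

lemma zeta_reg_holomorphic: "zeta_reg holomorphic_on {s. Re s > 0}"
proof (rule holomorphic_uniform_sequence)
  show "open {s. Re s > 0}" by (rule open_halfspace_Re_gt)
  show "(\<lambda>s. \<Sum>n<N. zterm n s) holomorphic_on {s. Re s > 0}" for N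
    unfolding zterm_def by (intro holomorphic_intros)
  fix x assume x: "x \<in> {s. Re s > 0}"
  define d where "d = Re x / 2"
  have d: "d > 0" using x by (simp add: d_def)
  have Re_z: "Re z \<ge> d" if "z \<in> cball x d" for z
    using that abs_Re_le_cmod[of "x - z"] by (simp add: dist_norm d_def)
  have nz: "norm z \<le> norm x + d" if "z \<in> cball x d" for z
    using that norm_triangle_ineq4[of x "x - z"] by (simp add: dist_norm)
  have "uniform_limit (cball x d) (\<lambda>N s. \<Sum>n<N. zterm n s) zeta_reg sequentially"
    unfolding zeta_reg_def
  proof (rule Weierstrass_m_test_ev)
    show "summable (\<lambda>n. (norm x + d + 1) * (norm x + d) * real n powr (- d - 1))"
      using d by (intro summable_mult) (simp add: summable_real_powr_iff)
    show "\<forall>\<^sub>F n in sequentially. \<forall>s\<in>cball x d. norm (zterm n s) \<le> (norm x + d + 1) * (norm x + d) * real n powr (- d - 1)"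
      using eventually_gt_at_top[of 0]
    proof eventually_elim
      case (elim n)
      show ?case
      proof
        fix s assume s: "s \<in> cball x d"
        have "norm (zterm n s) \<le> norm (s - 1) * norm s * real n powr (- Re s - 1)"
          using elim Re_z[OF s] d by (intro norm_zterm_le) auto
        also have "\<dots> \<le> (norm x + d + 1) * (norm x + d) * real n powr (- d - 1)"
          using nz[OF s] Re_z[OF s] d elim norm_triangle_ineq4[of s 1]
          by (intro mult_mono powr_mono) auto
        finally show "norm (zterm n s) \<le> (norm x + d + 1) * (norm x + d) * real n powr (- d - 1)" .
      qed
    qed
  qed
  moreover have "cball x d \<subseteq> {s. Re s > 0}" using Re_z d by force
  ultimately show "\<exists>d>0. cball x d \<subseteq> {s. 0 < Re s} \<and> uniform_limit (cball x d) (\<lambda>N s. \<Sum>n<N. zterm n s) zeta_reg sequentially"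
    using d by blast
qed

lemma zeta_reg_1 [simp]: "zeta_reg 1 = 1"
proof -
  have "zterm n 1 = (if n = 0 then 1 else 0)" for n
    by (auto simp: zterm_def powr_def simp del: of_nat_Suc)
  then show ?thesis unfolding zeta_reg_def
    using sums_unique[OF sums_single[of 0 "\<lambda>_. 1 :: complex"]] by simp
qed

section \<open>The Dirichlet series of zeta and of the von Mangoldt function\<close>

definition zeta :: "complex \<Rightarrow> complex" where "zeta s = (\<Sum>n. of_nat n powr (-s))"

lemma norm_nat_powr: "norm (of_nat n powr s :: complex) = (if n = 0 then 0 else real n powr Re s)"
  using norm_of_real_powr[of "real n" s] by auto

lemma summable_norm_zeta: "Re s > 1 \<Longrightarrow> summable (\<lambda>n. norm (of_nat n powr (-s) :: complex))"
  by (rule summable_comparison_test[where g="\<lambda>n. real n powr (- Re s)"])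
     (auto simp: summable_real_powr_iff norm_nat_powr)

lemma zeta_sums: "Re s > 1 \<Longrightarrow> (\<lambda>n. of_nat n powr (-s)) sums zeta s"
  unfolding zeta_def by (rule summable_sums[OF summable_norm_cancel[OF summable_norm_zeta]])

lemma nat_powr_tendsto_0:
  assumes "Re s < 0" shows "(\<lambda>n. of_nat n powr s :: complex) \<longlonglongrightarrow> 0"
proof (rule tendsto_norm_zero_cancel)
  have "(\<lambda>n. real n powr Re s) \<longlonglongrightarrow> 0"
    using assms filterlim_real_sequentially by (intro tendsto_neg_powr)
  then show "(\<lambda>n. norm (of_nat n powr s :: complex)) \<longlonglongrightarrow> 0"
    by (rule Lim_transform_eventually)
       (auto simp: norm_nat_powr eventually_sequentially intro!: exI[of _ 1])
qed

lemma zeta_reg_eq: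
  assumes "Re s > 1" shows "zeta_reg s = (s - 1) * zeta s"
proof -
  have "(\<lambda>n. of_nat (Suc n) powr (1 - s) - of_nat n powr (1 - s) :: complex) sums (0 - of_nat 0 powr (1 - s))"
    using assms by (intro telescope_sums nat_powr_tendsto_0) auto
  then have "(\<lambda>n. of_nat (Suc n) powr (1 - s) - of_nat n powr (1 - s) :: complex) sums 0" by simp
  from sums_add[OF sums_mult[OF zeta_sums[OF assms], of "s - 1"] this]
  show ?thesis by (simp add: zeta_reg_def zterm_def sums_iff)
qed

lemma zeta_has_derivative:
  assumes "Re s > 1"
  shows "(zeta has_field_derivative (\<Sum>n. - of_real (ln (real n)) * of_nat n powr (-s))) (at s)"
    and "summable (\<lambda>n. of_real (ln (real n)) * of_nat n powr (-s) :: complex)"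
proof -
  have "\<exists>g g'. \<forall>x \<in> {s. Re s > 1}. ((\<lambda>n. of_nat n powr (-x)) sums g x) \<and>
     ((\<lambda>n. - of_real (ln (real n)) * of_nat n powr (-x)) sums g' x) \<and> (g has_field_derivative g' x) (at x)"
  proof (rule series_and_derivative_comparison_local)
    show "open {s. Re s > 1}" by (rule open_halfspace_Re_gt)
    show "((\<lambda>s. of_nat n powr (-s)) has_field_derivative - of_real (ln (real n)) * of_nat n powr (-x)) (at x)"
      for n and x :: complex
    proof (cases "n = 0")
      case False
      then show ?thesis
        using DERIV_chain2[OF has_field_derivative_powr_right[of "of_nat n" "-x"] DERIV_minus[OF DERIV_ident]]
        by (simp add: Ln_of_nat)
    qed auto
    fix x assume x: "x \<in> {s. Re s > 1}"
    define d where "d = (Re x - 1) / 2"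
    have d: "d > 0" using x by (simp add: d_def)
    have Re_z: "Re z \<ge> 1 + d" if "z \<in> ball x d" for z
      using that abs_Re_le_cmod[of "x - z"] by (simp add: dist_norm d_def field_simps)
    have "summable (\<lambda>n. real n powr (- 1 - d))" using d by (simp add: summable_real_powr_iff)
    moreover have "norm (of_nat n powr (-y) :: complex) \<le> real n powr (- 1 - d)" if "y \<in> ball x d" for n y
      using Re_z[OF that] by (cases "n = 0") (auto simp: norm_nat_powr intro!: powr_mono)
    ultimately show "\<exists>d h. 0 < d \<and> summable h \<and>
       (\<forall>\<^sub>F n in sequentially. \<forall>y\<in>ball x d \<inter> {s. Re s > 1}. norm (of_nat n powr (-y) :: complex) \<le> h n)"
      using d by (intro exI[of _ d] exI[of _ "\<lambda>n. real n powr (- 1 - d)"]) auto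
  qed
  then obtain g g' where g: "\<And>x. Re x > 1 \<Longrightarrow> ((\<lambda>n. of_nat n powr (-x)) sums g x)"
    "\<And>x. Re x > 1 \<Longrightarrow> ((\<lambda>n. - of_real (ln (real n)) * of_nat n powr (-x)) sums g' x)"
    "\<And>x. Re x > 1 \<Longrightarrow> (g has_field_derivative g' x) (at x)" by blast
  have "(zeta has_field_derivative g' s) (at s)"
  proof (rule has_field_derivative_transform_within_open[OF g(3)[OF assms]])
    show "open {s. Re s > 1}" by (rule open_halfspace_Re_gt)
    show "g x = zeta x" if "x \<in> {s. Re s > 1}" for x
      using g(1)[of x] zeta_sums[of x] that sums_unique2 by blast
  qed (use assms in auto)
  then show "(zeta has_field_derivative (\<Sum>n. - of_real (ln (real n)) * of_nat n powr (-s))) (at s)"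
    using g(2)[OF assms] by (simp add: sums_iff)
  show "summable (\<lambda>n. of_real (ln (real n)) * of_nat n powr (-s) :: complex)"
    using sums_summable[OF g(2)[OF assms]] by (simp add: summable_minus_iff)
qed

definition mangoldt_series :: "complex \<Rightarrow> complex" where
  "mangoldt_series s = (\<Sum>n. mangoldt n * of_nat n powr (-s))"

lemma summable_norm_mangoldt:
  assumes "Re s > 1" shows "summable (\<lambda>n. norm (mangoldt n * of_nat n powr (-s) :: complex))"
proof (rule summable_comparison_test)
  define d where "d = (Re s - 1) / 2"
  have d: "d > 0" using assms by (simp add: d_def)
  show "summable (\<lambda>n. 1 / d * real n powr (- 1 - d))"
    using d by (intro summable_mult) (simp add: summable_real_powr_iff)
  show "\<exists>N. \<forall>n\<ge>N. norm (norm (mangoldt n * of_nat n powr (-s) :: complex)) \<le> 1 / d * real n powr (- 1 - d)"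
  proof (intro exI[of _ 1] allI impI)
    fix n :: nat assume n: "n \<ge> 1"
    have "(mangoldt n :: real) \<le> real n powr d / d"
      using mangoldt_le[of n] ln_powr_bound[of "real n" d] n d by (auto simp: Suc_le_eq)
    then have "mangoldt n * real n powr (- Re s) \<le> real n powr d / d * real n powr (- Re s)"
      by (intro mult_right_mono) auto
    also have "real n powr d / d * real n powr (- Re s) = 1 / d * real n powr (d + (- Re s))"
      by (simp only: powr_add) simp
    also have "d + - Re s = - 1 - d" by (simp add: d_def field_simps)
    finally show "norm (norm (mangoldt n * of_nat n powr (-s) :: complex)) \<le> 1 / d * real n powr (- 1 - d)"
      using n by (simp add: norm_mult norm_nat_powr abs_mult)
  qed
qed

lemma mangoldt_sums: "Re s > 1 \<Longrightarrow> (\<lambda>n. mangoldt n * of_nat n powr (-s)) sums mangoldt_series s"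
  unfolding mangoldt_series_def by (rule summable_sums[OF summable_norm_cancel[OF summable_norm_mangoldt]])

text \<open>Passes to unordered sums, which may be regrouped. The index 0 is left out because it has
  infinitely many divisors.\<close>

lemma suminf_eq_infsum_pos:
  fixes f :: "nat \<Rightarrow> complex"
  assumes "summable (\<lambda>n. norm (f n))" "f 0 = 0"
  shows "suminf f = infsum f {0<..}"
proof -
  have "(f has_sum suminf f) UNIV"
    by (rule norm_summable_imp_has_sum[OF assms(1) summable_sums[OF summable_norm_cancel[OF assms(1)]]])
  then have "suminf f = infsum f UNIV" by (simp add: infsumI)
  also have "\<dots> = infsum f {0<..}" using assms by (intro infsum_cong_neutral) auto
  finally show ?thesis .
qed

lemma mangoldt_series_times_zeta:
  assumes s: "Re s > 1"
  shows "mangoldt_series s * zeta s = (\<Sum>n. of_real (ln (real n)) * of_nat n powr (-s))"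
proof -
  define a where "a = (\<lambda>n. mangoldt n * of_nat n powr (-s) :: complex)"
  define b where "b = (\<lambda>n. of_nat n powr (-s) :: complex)"
  define I where "I = {0::nat<..}"
  have sa: "summable (\<lambda>n. norm (a n))" unfolding a_def by (rule summable_norm_mangoldt[OF s])
  have sb: "summable (\<lambda>n. norm (b n))" unfolding b_def by (rule summable_norm_zeta[OF s])
  have aI: "(\<lambda>x. norm (a x)) summable_on I" and bI: "(\<lambda>x. norm (b x)) summable_on I"
    using sa sb by (auto intro!: summable_on_subset_banach[OF norm_summable_imp_summable_on])
  have 1: "(\<lambda>x. norm ((\<lambda>(d, m). a d * b m) x)) summable_on I \<times> I"
  proof -
    have "(\<lambda>d. norm (a d) * (\<Sum>\<^sub>\<infinity>m\<in>I. norm (b m))) summable_on I"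
      using aI by (rule summable_on_cmult_left)
    moreover have "(\<Sum>\<^sub>\<infinity>m\<in>I. norm (b m)) \<ge> 0" by (intro infsum_nonneg) auto
    ultimately show ?thesis
      unfolding Infinite_Sum.abs_summable_on_Sigma_iff using bI
      by (auto simp: norm_mult infsum_cmult_right' abs_mult intro: summable_on_cmult_right)
  qed
  have sm: "(\<lambda>(d, m). a d * b m) summable_on I \<times> I" by (rule abs_summable_summable[OF 1])
  \<comment> \<open>Regrouping the double series by the product n = d m; the inner sum then becomes
    the divisor sum of \<open>mangoldt\<close>, which is ln n.\<close>
  have bij: "bij_betw (\<lambda>(n, d). (d, n div d)) (SIGMA n:I. {d. d dvd n}) (I \<times> I)"
    by (rule bij_betw_byWitness[where f'="\<lambda>(d, m). (d * m, d)"]) (auto simp: I_def elim!: dvdE)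
  have "mangoldt_series s * zeta s = infsum a I * infsum b I"
    unfolding mangoldt_series_def zeta_def a_def[symmetric] b_def[symmetric] I_def
    using sa sb by (simp add: suminf_eq_infsum_pos a_def b_def)
  also have "\<dots> = infsum (\<lambda>d. infsum (\<lambda>m. a d * b m) I) I"
    by (simp add: infsum_cmult_left' infsum_cmult_right')
  also have "\<dots> = infsum (\<lambda>(d, m). a d * b m) (I \<times> I)"
    by (rule infsum_Sigma'_banach[OF sm])
  also have "\<dots> = infsum (\<lambda>(n, d). a d * b (n div d)) (SIGMA n:I. {d. d dvd n})"
    using infsum_reindex_bij_betw[OF bij, of "\<lambda>(d, m). a d * b m"] by (simp add: case_prod_unfold)
  also have "\<dots> = infsum (\<lambda>n. infsum (\<lambda>d. a d * b (n div d)) {d. d dvd n}) I"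
  proof (rule infsum_Sigma'_banach[symmetric])
    show "(\<lambda>(n, d). a d * b (n div d)) summable_on (SIGMA n:I. {d. d dvd n})"
      using summable_on_reindex_bij_betw[OF bij, of "\<lambda>(d, m). a d * b m"] sm by (simp add: case_prod_unfold)
  qed
  also have "\<dots> = infsum (\<lambda>n. of_real (ln (real n)) * of_nat n powr (-s)) I"
  proof (rule infsum_cong)
    fix n assume "n \<in> I"
    then have n: "n > 0" by (simp add: I_def)
    have "a d * b (n div d) = mangoldt d * of_nat n powr (-s)" if "d dvd n" for d
    proof -
      from that obtain m where m: "n = d * m" by (elim dvdE)
      with n have "d > 0" "m > 0" by auto
      then have "(of_nat d * of_nat m) powr (-s) = of_nat d powr (-s) * (of_nat m powr (-s) :: complex)"
        by (intro powr_times_real) auto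
      then show ?thesis using \<open>d > 0\<close> by (simp add: a_def b_def m)
    qed
    then have "infsum (\<lambda>d. a d * b (n div d)) {d. d dvd n} = (\<Sum>d | d dvd n. mangoldt d * of_nat n powr (-s))"
      using n by (simp add: infsum_finite)
    also have "\<dots> = of_real (ln (real n)) * of_nat n powr (-s)"
      using mangoldt_sum[of n, where ?'a = complex] n by (simp flip: sum_distrib_right)
    finally show "infsum (\<lambda>d. a d * b (n div d)) {d. d dvd n} = of_real (ln (real n)) * of_nat n powr (-s)" .
  qed
  also have "\<dots> = (\<Sum>n. of_real (ln (real n)) * of_nat n powr (-s))"
  proof (rule suminf_eq_infsum_pos[symmetric, folded I_def])
    define d where "d = (Re s - 1) / 2"
    have d: "d > 0" using s by (simp add: d_def)
    show "summable (\<lambda>n. norm (of_real (ln (real n)) * of_nat n powr (-s) :: complex))"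
    proof (rule summable_comparison_test)
      show "summable (\<lambda>n. 1 / d * real n powr (- 1 - d))"
        using d by (intro summable_mult) (simp add: summable_real_powr_iff)
      show "\<exists>N. \<forall>n\<ge>N. norm (norm (of_real (ln (real n)) * of_nat n powr (-s) :: complex)) \<le> 1 / d * real n powr (- 1 - d)"
      proof (intro exI[of _ 1] allI impI)
        fix n :: nat assume n: "n \<ge> 1"
        have "ln (real n) \<le> real n powr d / d" "ln (real n) \<ge> 0"
          using ln_powr_bound[of "real n" d] n d by auto
        then have "ln (real n) * real n powr (- Re s) \<le> real n powr d / d * real n powr (- Re s)"
          by (intro mult_right_mono) auto
        also have "real n powr d / d * real n powr (- Re s) = 1 / d * real n powr (d + (- Re s))"
          by (simp only: powr_add) simp
        also have "d + - Re s = - 1 - d" by (simp add: d_def field_simps)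
        finally show "norm (norm (of_real (ln (real n)) * of_nat n powr (-s) :: complex)) \<le> 1 / d * real n powr (- 1 - d)"
          using n \<open>ln (real n) \<ge> 0\<close> by (simp add: norm_mult norm_nat_powr abs_mult)
      qed
    qed
  qed simp
  finally show ?thesis .
qed

lemma mangoldt_series_eq:
  assumes s: "Re s > 1"
  shows "mangoldt_series s * zeta s = - deriv zeta s"
proof -
  have "deriv zeta s = (\<Sum>n. - of_real (ln (real n)) * of_nat n powr (-s))"
    by (rule DERIV_imp_deriv[OF zeta_has_derivative(1)[OF s]])
  also have "\<dots> = - (\<Sum>n. of_real (ln (real n)) * of_nat n powr (-s))"
    using suminf_minus[OF zeta_has_derivative(2)[OF s]] by simp
  finally show ?thesis using mangoldt_series_times_zeta[OF s] by simp
qed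

section \<open>Orders of zeros and non-vanishing for Re s at least 1\<close>

lemma log_deriv_limit:
  assumes f: "f holomorphic_on S" and S: "open S" "connected S" and nc: "\<not> f constant_on S" and z0: "z0 \<in> S"
  shows "\<exists>m::nat. ((\<lambda>z. (z - z0) * (deriv f z / f z)) \<longlongrightarrow> of_nat m) (at z0) \<and> (m = 0 \<longleftrightarrow> f z0 \<noteq> 0)"
proof (cases "f z0 = 0")
  case False
  have "isCont f z0" "isCont (deriv f) z0"
    using f holomorphic_deriv[OF f S(1)] S(1) z0
    by (auto simp: continuous_on_eq_continuous_at dest!: holomorphic_on_imp_continuous_on)
  then have "((\<lambda>z. (z - z0) * (deriv f z / f z)) \<longlongrightarrow> (z0 - z0) * (deriv f z0 / f z0)) (at z0)"
    using False by (intro tendsto_intros) (auto simp: isCont_def)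
  then show ?thesis using False by (intro exI[of _ 0]) auto
next
  case True
  obtain g r n where g: "0 < n" "0 < r" "ball z0 r \<subseteq> S" "g holomorphic_on ball z0 r"
    "\<And>w. w \<in> ball z0 r \<Longrightarrow> f w = (w - z0)^n * g w" "\<And>w. w \<in> ball z0 r \<Longrightarrow> g w \<noteq> 0"
    using holomorphic_factor_zero_nonconstant[OF f S z0 True nc] by metis
  have "isCont g z0" "isCont (deriv g) z0"
    using g(2,4) holomorphic_deriv[OF g(4) open_ball]
    by (auto simp: continuous_on_eq_continuous_at dest!: holomorphic_on_imp_continuous_on)
  then have "((\<lambda>z. of_nat n + (z - z0) * (deriv g z / g z)) \<longlongrightarrow> of_nat n + (z0 - z0) * (deriv g z0 / g z0)) (at z0)"
    using g(2,6) by (intro tendsto_intros) (auto simp: isCont_def)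
  moreover have "eventually (\<lambda>z. z \<in> ball z0 r - {z0}) (at z0)"
    using g(2) eventually_at_in_open[OF open_ball, of z0 z0 r] by simp
  then have "eventually (\<lambda>z. of_nat n + (z - z0) * (deriv g z / g z) = (z - z0) * (deriv f z / f z)) (at z0)"
  proof eventually_elim
    case (elim z)
    then have z: "z \<in> ball z0 r" "z \<noteq> z0" by auto
    have "(g has_field_derivative deriv g z) (at z)"
      using g(4) z by (intro holomorphic_derivI[OF _ open_ball])
    then have "((\<lambda>w. (w - z0)^n * g w) has_field_derivative
        (of_nat n * (z - z0)^(n - 1) * g z + (z - z0)^n * deriv g z)) (at z)"
      by (auto intro!: derivative_eq_intros)
    then have "(f has_field_derivative
        (of_nat n * (z - z0)^(n - 1) * g z + (z - z0)^n * deriv g z)) (at z)"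
      by (rule has_field_derivative_transform_within_open[OF _ open_ball z(1)]) (simp add: g(5))
    then have D: "deriv f z = of_nat n * (z - z0)^(n - 1) * g z + (z - z0)^n * deriv g z"
      by (rule DERIV_imp_deriv)
    have P: "(z - z0)^n = (z - z0) * (z - z0)^(n - 1)" using g(1) by (simp flip: power_Suc)
    have alg: "of_nat n + d * (G' / G) = d * ((of_nat n * X * G + d * X * G') / (d * X * G))"
      if "d \<noteq> 0" "X \<noteq> 0" "G \<noteq> 0" for d X G G' :: complex
      using that by (simp add: field_simps)
    show ?case unfolding D g(5)[OF z(1)] P by (rule alg) (use z g(6)[OF z(1)] in auto)
  qed
  ultimately have "((\<lambda>z. (z - z0) * (deriv f z / f z)) \<longlongrightarrow> of_nat n) (at z0)"
    by (simp add: Lim_transform_eventually)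
  then show ?thesis using True g(1) by (intro exI[of _ n]) auto
qed

lemma Re_nat_powr: "n > 0 \<Longrightarrow> Re (of_nat n powr (- s)) = real n powr (- Re s) * cos (Im s * ln (real n))"
  by (simp add: powr_def Ln_of_nat Re_exp mult_ac)

text \<open>m is the order of the zero at s, read off from the logarithmic derivative because that
  is what the von Mangoldt series computes. The approach is from the right, so that the series is
  available at the points s + \<delta> even when s lies on the line Re s = 1.\<close>

lemma zeta_reg_order:
  assumes "Re s > 0"
  obtains m :: nat where "((\<lambda>\<delta>. of_real \<delta> * (deriv zeta_reg (s + of_real \<delta>) / zeta_reg (s + of_real \<delta>))) \<longlongrightarrow> of_nat m) (at_right 0)"
    "m = 0 \<longleftrightarrow> zeta_reg s \<noteq> 0"
proof -
  have "connected {s. Re s > 0}" by (intro convex_connected convex_halfspace_Re_gt)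
  \<comment> \<open>If \<open>zeta_reg\<close> were constant, it would be 1 and zeta 4 would be 1/3,
    although the term 1 of the series alone forces a real part of at least 1.\<close>
  moreover have nc: "\<not> zeta_reg constant_on {s. Re s > 0}"
  proof
    assume "zeta_reg constant_on {s. Re s > 0}"
    then have c: "zeta_reg s = 1" if "Re s > 0" for s
      using that zeta_reg_1 unfolding constant_on_def by (metis mem_Collect_eq one_complex.sel(1) zero_less_one)
    have z: "(s - 1) * zeta s = 1" if "Re s > 1" for s
      using c[of s] zeta_reg_eq[OF that] that by simp
    have sm: "(\<lambda>k. Re (of_nat k powr (- 4))) sums Re (zeta 4)"
      by (rule sums_Re[OF zeta_sums]) simp
    have "Re (of_nat k powr (- 4)) \<ge> 0" for k
      using Re_nat_powr[of k 4] by (cases "k = 0") auto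
    then have "(\<Sum>k\<in>{1}. Re (of_nat k powr (- 4))) \<le> (\<Sum>k. Re (of_nat k powr (- 4)))"
      using sums_summable[OF sm] by (intro sum_le_suminf) auto
    then have "Re (zeta 4) \<ge> 1" using sums_unique[OF sm] by simp
    moreover have "zeta 4 * 3 = 1" using z[of 4] by (simp add: mult.commute)
    then have "Re (zeta 4 * 3) = 1" by (simp only: one_complex.sel)
    ultimately show False by simp
  qed
  ultimately obtain m :: nat where m: "((\<lambda>z. (z - s) * (deriv zeta_reg z / zeta_reg z)) \<longlongrightarrow> of_nat m) (at s)"
      "m = 0 \<longleftrightarrow> zeta_reg s \<noteq> 0"
    using log_deriv_limit[OF zeta_reg_holomorphic open_halfspace_Re_gt _ nc, of s] assms by auto
  have "filterlim (\<lambda>\<delta>. s + of_real \<delta>) (at s) (at_right 0)"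
    unfolding filterlim_at
  proof
    have "((\<lambda>\<delta>. s + of_real \<delta>) \<longlongrightarrow> s + of_real 0) (at_right 0)" by (intro tendsto_intros)
    then show "((\<lambda>\<delta>. s + of_real \<delta>) \<longlongrightarrow> s) (at_right 0)" by simp
    show "\<forall>\<^sub>F \<delta> in at_right 0. s + of_real \<delta> \<in> UNIV \<and> s + of_real \<delta> \<noteq> s"
      using eventually_at_right_less[of "0::real"] by eventually_elim auto
  qed
  from filterlim_compose[OF m(1) this] m(2) show ?thesis by (intro that[of m]) simp_all
qed

text \<open>Kept free of division, so that it can serve before \<open>zeta_reg s\<close> is known to
  be nonzero.\<close>

lemma zeta_reg_deriv:
  assumes s: "Re s > 1"
  shows "(s - 1) * deriv zeta_reg s = zeta_reg s * (1 - (s - 1) * mangoldt_series s)"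
proof -
  have "((\<lambda>s. (s - 1) * zeta s) has_field_derivative (zeta s + (s - 1) * deriv zeta s)) (at s)"
  proof -
    have "(zeta has_field_derivative deriv zeta s) (at s)"
      using zeta_has_derivative(1)[OF s] DERIV_imp_deriv by metis
    then show ?thesis by (auto intro!: derivative_eq_intros)
  qed
  then have "(zeta_reg has_field_derivative (zeta s + (s - 1) * deriv zeta s)) (at s)"
    by (rule has_field_derivative_transform_within_open[where S="{s. Re s > 1}"])
       (use s in \<open>auto simp: zeta_reg_eq open_halfspace_Re_gt\<close>)
  then have "deriv zeta_reg s = zeta s + (s - 1) * deriv zeta s" by (rule DERIV_imp_deriv)
  also have "deriv zeta s = - (mangoldt_series s * zeta s)" using mangoldt_series_eq[OF s] by simp
  finally have D: "deriv zeta_reg s = zeta s + (s - 1) * - (mangoldt_series s * zeta s)" .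
  show ?thesis unfolding D zeta_reg_eq[OF s] by (simp add: algebra_simps)
qed

lemma Re_mangoldt_series_sums:
  assumes "Re s > 1"
  shows "(\<lambda>n. mangoldt n * real n powr (- Re s) * cos (Im s * ln (real n))) sums Re (mangoldt_series s)"
proof -
  have "Re (mangoldt n * of_nat n powr (-s)) = mangoldt n * real n powr (- Re s) * cos (Im s * ln (real n))" for n
    by (cases "n = 0") (auto simp: Re_nat_powr)
  then show ?thesis using sums_Re[OF mangoldt_sums[OF assms]] by (simp only:)
qed

lemma norm_mangoldt_series_le:
  assumes "Re s \<ge> \<sigma>" "\<sigma> > 1"
  shows "norm (mangoldt_series s) \<le> (\<Sum>n. mangoldt n * real n powr (- \<sigma>))"
proof -
  have "norm (mangoldt_series s) \<le> (\<Sum>n. norm (mangoldt n * of_nat n powr (-s) :: complex))"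
    unfolding mangoldt_series_def using assms by (intro summable_norm summable_norm_mangoldt) auto
  also have "\<dots> \<le> (\<Sum>n. mangoldt n * real n powr (- \<sigma>))"
  proof (rule suminf_le)
    show "norm (mangoldt n * of_nat n powr (-s) :: complex) \<le> mangoldt n * real n powr (- \<sigma>)" for n
      using assms by (cases "n = 0") (auto simp: norm_mult norm_nat_powr mangoldt_nonneg intro!: mult_left_mono powr_mono)
    have "(\<lambda>n. norm (mangoldt n * of_nat n powr (- of_real \<sigma>) :: complex)) = (\<lambda>n. mangoldt n * real n powr (- \<sigma>))"
      by (auto simp: norm_mult norm_nat_powr fun_eq_iff)
    then show "summable (\<lambda>n. mangoldt n * real n powr (- \<sigma>))"
      using summable_norm_mangoldt[of "of_real \<sigma>"] assms by simp
  qed (use assms in \<open>auto intro!: summable_norm_mangoldt\<close>)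
  finally show ?thesis .
qed

text \<open>At a zero of order m > 0 the logarithmic derivative would grow like m / \<delta>, but to
  the right of s it equals 1 / (w - 1) minus the von Mangoldt series, and both are bounded
  there.\<close>

lemma zeta_reg_nonzero_gt_1:
  assumes s: "Re s > 1" shows "zeta_reg s \<noteq> 0"
proof -
  have "Re s > 0" using s by simp
  then obtain m :: nat where m: "((\<lambda>\<delta>. of_real \<delta> * (deriv zeta_reg (s + of_real \<delta>) / zeta_reg (s + of_real \<delta>))) \<longlongrightarrow> of_nat m) (at_right 0)"
    "m = 0 \<longleftrightarrow> zeta_reg s \<noteq> 0" by (rule zeta_reg_order)
  define B where "B = 1 / (Re s - 1) + (\<Sum>n. mangoldt n * real n powr (- Re s))"
  have "((\<lambda>\<delta>. of_real \<delta> * (deriv zeta_reg (s + of_real \<delta>) / zeta_reg (s + of_real \<delta>))) \<longlongrightarrow> 0) (at_right 0)"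
  proof (rule Lim_null_comparison)
    show "((\<lambda>\<delta>. \<delta> * B) \<longlongrightarrow> 0) (at_right 0)" by (auto intro!: tendsto_eq_intros)
    show "\<forall>\<^sub>F \<delta> in at_right 0. norm (of_real \<delta> * (deriv zeta_reg (s + of_real \<delta>) / zeta_reg (s + of_real \<delta>))) \<le> \<delta> * B"
      using eventually_at_right_less[of "0::real"]
    proof eventually_elim
      case (elim \<delta>)
      define w where "w = s + of_real \<delta>"
      have w: "Re w > 1" "Re w \<ge> Re s" using s elim by (auto simp: w_def)
      have w1: "norm (w - 1) \<ge> Re s - 1" using w abs_Re_le_cmod[of "w - 1"] by simp
      have "norm (deriv zeta_reg w / zeta_reg w) \<le> B"
      proof (cases "zeta_reg w = 0")
        \<comment> \<open>Here the quotient is 0 by the convention x / 0 = 0, so only the bound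
          itself must be nonnegative.\<close>
        case True
        have "norm (mangoldt_series s) \<le> (\<Sum>n. mangoldt n * real n powr (- Re s))"
          by (rule norm_mangoldt_series_le) (use s in auto)
        then have "0 \<le> (\<Sum>n. mangoldt n * real n powr (- Re s))" using norm_ge_zero order_trans by blast
        then show ?thesis using True s by (simp add: B_def)
      next
        case False
        have "w \<noteq> 1" using w by auto
        then have "deriv zeta_reg w / zeta_reg w = 1 / (w - 1) - mangoldt_series w"
          using zeta_reg_deriv[OF w(1)] False by (simp add: field_simps)
        also have "norm \<dots> \<le> norm (1 / (w - 1)) + norm (mangoldt_series w)" by (rule norm_triangle_ineq4)
        also have "\<dots> \<le> B" unfolding B_def norm_divide
          using w w1 s by (intro add_mono norm_mangoldt_series_le) (auto intro!: divide_left_mono mult_pos_pos)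
        finally show ?thesis .
      qed
      moreover have "norm (of_real \<delta> * z) = \<delta> * norm z" for z :: complex
        using elim by (simp add: norm_mult)
      ultimately show ?case
        using elim unfolding w_def by (simp only: mult_le_cancel_left_pos)
    qed
  qed
  from tendsto_unique[OF _ m(1) this] have "m = 0" by simp
  with m(2) show ?thesis by simp
qed

text \<open>The classical 3-4-1 argument, phrased with the orders m1, m2 of the zeros at 1 + it and 1 + 2it:
  multiplying the inequality by the distance to the line Re s = 1 gives 3 - 4 m1 - m2 \<ge> 0.\<close>
lemma zeta_reg_nonzero:
  assumes s: "Re s \<ge> 1" shows "zeta_reg s \<noteq> 0"
proof (cases "Re s > 1 \<or> s = 1")
  case True then show ?thesis using zeta_reg_nonzero_gt_1 by auto
next
  case False
  define t where "t = Im s"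
  define pt where "pt = (\<lambda>u. Complex 1 u)"
  have st: "s = pt t" "t \<noteq> 0" using False s by (auto simp: pt_def t_def complex_eq_iff)
  \<comment> \<open>Zeros enter the von Mangoldt series with a minus sign; the value 1 at u = 0 is
    the pole of the series at s = 1.\<close>
  have lim: "\<exists>m::nat. ((\<lambda>\<delta>. \<delta> * Re (mangoldt_series (pt u + of_real \<delta>))) \<longlongrightarrow> (if u = 0 then 1 else 0) - real m) (at_right 0)
     \<and> (m = 0 \<longleftrightarrow> zeta_reg (pt u) \<noteq> 0)" for u
  proof -
    have "Re (pt u) > 0" by (simp add: pt_def)
    then obtain m :: nat where m: "((\<lambda>\<delta>. of_real \<delta> * (deriv zeta_reg (pt u + of_real \<delta>) / zeta_reg (pt u + of_real \<delta>))) \<longlongrightarrow> of_nat m) (at_right 0)"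
      "m = 0 \<longleftrightarrow> zeta_reg (pt u) \<noteq> 0" by (rule zeta_reg_order)
    have 1: "((\<lambda>\<delta>. of_real \<delta> / (pt u + of_real \<delta> - 1)) \<longlongrightarrow> (if u = 0 then 1 else 0)) (at_right 0)"
    proof (cases "u = 0")
      case True
      then have "pt u = 1" by (simp add: pt_def complex_eq_iff)
      then have "\<forall>\<^sub>F \<delta> in at_right 0. 1 = of_real \<delta> / (pt u + of_real \<delta> - 1)"
        using eventually_at_right_less[of "0::real"]
        by (auto elim!: eventually_mono)
      then show ?thesis using True by (auto intro: Lim_transform_eventually)
    next
      case False
      then have "pt u - 1 \<noteq> 0" by (auto simp: pt_def complex_eq_iff)
      then have "((\<lambda>\<delta>. of_real \<delta> / (pt u + of_real \<delta> - 1)) \<longlongrightarrow> of_real 0 / (pt u + of_real 0 - 1)) (at_right 0)"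
        by (intro tendsto_intros) auto
      then show ?thesis using False by simp
    qed
    have "((\<lambda>\<delta>. of_real \<delta> / (pt u + of_real \<delta> - 1)
        - of_real \<delta> * (deriv zeta_reg (pt u + of_real \<delta>) / zeta_reg (pt u + of_real \<delta>))) \<longlongrightarrow> (if u = 0 then 1 else 0) - of_nat m) (at_right 0)"
      by (intro tendsto_diff 1 m)
    moreover have "\<forall>\<^sub>F \<delta> in at_right 0. of_real \<delta> / (pt u + of_real \<delta> - 1)
        - of_real \<delta> * (deriv zeta_reg (pt u + of_real \<delta>) / zeta_reg (pt u + of_real \<delta>))
        = of_real \<delta> * mangoldt_series (pt u + of_real \<delta>)"
      using eventually_at_right_less[of "0::real"]
    proof eventually_elim
      case (elim \<delta>)
      define w where "w = pt u + of_real \<delta>"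
      have w: "Re w > 1" using elim by (simp add: w_def pt_def)
      have "w \<noteq> 1" using w by auto
      then have Q: "deriv zeta_reg w / zeta_reg w = 1 / (w - 1) - mangoldt_series w"
        using zeta_reg_deriv[OF w] zeta_reg_nonzero_gt_1[OF w] by (simp add: field_simps)
      show ?case unfolding w_def[symmetric] Q by (simp add: right_diff_distrib)
    qed
    ultimately have "((\<lambda>\<delta>. of_real \<delta> * mangoldt_series (pt u + of_real \<delta>)) \<longlongrightarrow> (if u = 0 then 1 else 0) - of_nat m) (at_right 0)"
      by (rule Lim_transform_eventually)
    from tendsto_Re[OF this] m(2) show ?thesis by (intro exI[of _ m]) (auto split: if_splits)
  qed
  obtain m0 m1 m2 :: nat where
    m0: "((\<lambda>\<delta>. \<delta> * Re (mangoldt_series (pt 0 + of_real \<delta>))) \<longlongrightarrow> 1 - real m0) (at_right 0)" "m0 = 0 \<longleftrightarrow> zeta_reg (pt 0) \<noteq> 0" and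
    m1: "((\<lambda>\<delta>. \<delta> * Re (mangoldt_series (pt t + of_real \<delta>))) \<longlongrightarrow> 0 - real m1) (at_right 0)" "m1 = 0 \<longleftrightarrow> zeta_reg (pt t) \<noteq> 0" and
    m2: "((\<lambda>\<delta>. \<delta> * Re (mangoldt_series (pt (2*t) + of_real \<delta>))) \<longlongrightarrow> 0 - real m2) (at_right 0)"
    using lim[of 0] lim[of t] lim[of "2*t"] st by auto
  have "pt 0 = 1" by (simp add: pt_def complex_eq_iff)
  then have "m0 = 0" using m0(2) by simp
  have "3 * (1 - real m0) + 4 * (0 - real m1) + (0 - real m2) \<ge> 0"
  proof (rule tendsto_lowerbound)
    show "((\<lambda>\<delta>. 3 * (\<delta> * Re (mangoldt_series (pt 0 + of_real \<delta>))) + 4 * (\<delta> * Re (mangoldt_series (pt t + of_real \<delta>)))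
       + \<delta> * Re (mangoldt_series (pt (2*t) + of_real \<delta>))) \<longlongrightarrow> 3 * (1 - real m0) + 4 * (0 - real m1) + (0 - real m2)) (at_right 0)"
      by (intro tendsto_intros m0 m1 m2)
    show "\<forall>\<^sub>F \<delta> in at_right 0. 0 \<le> 3 * (\<delta> * Re (mangoldt_series (pt 0 + of_real \<delta>))) + 4 * (\<delta> * Re (mangoldt_series (pt t + of_real \<delta>)))
       + \<delta> * Re (mangoldt_series (pt (2*t) + of_real \<delta>))"
      using eventually_at_right_less[of "0::real"]
    proof eventually_elim
      case (elim \<delta>)
      have sm: "(\<lambda>n. mangoldt n * real n powr (- (1 + \<delta>)) * cos (u * ln (real n))) sums Re (mangoldt_series (pt u + of_real \<delta>))" for u
        using Re_mangoldt_series_sums[of "pt u + of_real \<delta>"] elim by (simp add: pt_def)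
      have "0 \<le> 3 * Re (mangoldt_series (pt 0 + of_real \<delta>)) + 4 * Re (mangoldt_series (pt t + of_real \<delta>)) + Re (mangoldt_series (pt (2*t) + of_real \<delta>))"
      proof (rule sums_le[OF _ sums_zero sums_add[OF sums_add[OF sums_mult[OF sm] sums_mult[OF sm]] sm]])
        fix n
        define x where "x = t * ln (real n)"
        have "3 + 4 * cos x + cos (2 * x) = 2 * (1 + cos x)\<^sup>2"
          unfolding cos_double_cos by (simp add: power2_eq_square algebra_simps)
        then have "0 \<le> 3 + 4 * cos x + cos (2 * x)" by simp
        then have "0 \<le> mangoldt n * real n powr (- (1 + \<delta>)) * (3 + 4 * cos x + cos (2 * x))"
          by (intro mult_nonneg_nonneg) (auto simp: mangoldt_nonneg)
        then show "0 \<le> 3 * (mangoldt n * real n powr - (1 + \<delta>) * cos (0 * ln (real n))) +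
           4 * (mangoldt n * real n powr - (1 + \<delta>) * cos (t * ln (real n))) +
           mangoldt n * real n powr - (1 + \<delta>) * cos (2 * t * ln (real n))"
          by (simp add: x_def algebra_simps)
      qed
      then have "0 \<le> \<delta> * (3 * Re (mangoldt_series (pt 0 + of_real \<delta>)) + 4 * Re (mangoldt_series (pt t + of_real \<delta>)) + Re (mangoldt_series (pt (2*t) + of_real \<delta>)))"
        using elim by simp
      then show ?case by (simp add: algebra_simps)
    qed
  qed auto
  then have "real m1 < 1" using \<open>m0 = 0\<close> by simp
  then have "m1 = 0" by simp
  then show ?thesis using m1(2) st by simp
qed

text \<open>The continuation of \<open>mangoldt_series s - zeta s\<close>. The first summand is the
  von Mangoldt series minus 1 / (s - 1), the second subtracts zeta minus 1 / (s - 1), so the two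
  poles at 1 cancel before they appear.\<close>

definition zeta_diff :: "complex \<Rightarrow> complex" where
  "zeta_diff s = - (deriv zeta_reg s / zeta_reg s)
      - (if s = 1 then deriv zeta_reg 1 else (zeta_reg s - zeta_reg 1) / (s - 1))"

lemma zeta_diff_holomorphic:
  "open {s. Re s > 0 \<and> zeta_reg s \<noteq> 0}" "zeta_diff holomorphic_on {s. Re s > 0 \<and> zeta_reg s \<noteq> 0}"
proof -
  have o: "open {s. Re s > 0}" by (rule open_halfspace_Re_gt)
  have "open ({s. Re s > 0} \<inter> zeta_reg -` (- {0}))"
    by (intro continuous_open_preimage holomorphic_on_imp_continuous_on zeta_reg_holomorphic o) auto
  also have "{s. Re s > 0} \<inter> zeta_reg -` (- {0}) = {s. Re s > 0 \<and> zeta_reg s \<noteq> 0}" by auto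
  finally show 1: "open {s. Re s > 0 \<and> zeta_reg s \<noteq> 0}" .
  have h: "zeta_reg holomorphic_on {s. Re s > 0 \<and> zeta_reg s \<noteq> 0}"
    using zeta_reg_holomorphic by (rule holomorphic_on_subset) auto
  show "zeta_diff holomorphic_on {s. Re s > 0 \<and> zeta_reg s \<noteq> 0}"
    unfolding zeta_diff_def
    by (intro holomorphic_on_diff holomorphic_on_minus holomorphic_on_divide holomorphic_deriv h 1 pole_lemma_open) auto
qed

lemma zeta_diff_eq:
  assumes s: "Re s > 1"
  shows "zeta_diff s = mangoldt_series s - zeta s"
proof -
  have "s - 1 \<noteq> 0" using s by auto
  have n: "zeta_reg s \<noteq> 0" using zeta_reg_nonzero s by simp
  have "deriv zeta_reg s / zeta_reg s = 1 / (s - 1) - mangoldt_series s"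
    using zeta_reg_deriv[OF s] n \<open>s - 1 \<noteq> 0\<close> by (simp add: field_simps)
  moreover have "(zeta_reg s - 1) / (s - 1) = zeta s - 1 / (s - 1)"
    using \<open>s - 1 \<noteq> 0\<close> by (simp add: zeta_reg_eq[OF s] diff_divide_distrib)
  ultimately show ?thesis using s by (auto simp: zeta_diff_def)
qed

section \<open>Chebyshev's function and primes in short intervals\<close>

definition psi :: "nat \<Rightarrow> real" where "psi n = (\<Sum>k\<le>n. mangoldt k)"

lemma psi_0 [simp]: "psi 0 = 0" by (simp add: psi_def)
lemma psi_Suc: "psi (Suc n) = psi n + mangoldt (Suc n)" by (simp add: psi_def)
lemma psi_mono: "m \<le> n \<Longrightarrow> psi m \<le> psi n"
  unfolding psi_def by (intro sum_mono2) (auto simp: mangoldt_nonneg)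
lemma psi_nonneg: "psi n \<ge> 0" unfolding psi_def by (intro sum_nonneg) (auto simp: mangoldt_nonneg)

lemma ln_fact_mangoldt: "ln (fact n) = (\<Sum>d\<in>{1..n}. mangoldt d * real (n div d))"
proof -
  have "ln (fact n) = (\<Sum>m\<in>{1..n}. ln (real m))"
    by (induction n) (auto simp: ln_mult)
  also have "\<dots> = (\<Sum>m\<in>{1..n}. \<Sum>d\<in>{1..n}. if d dvd m then mangoldt d else 0)"
  proof (rule sum.cong[OF refl])
    fix m assume m: "m \<in> {1..n}"
    have "ln (real m) = (\<Sum>d | d dvd m. mangoldt d)" using mangoldt_sum[of m, where ?'a = real] m by simp
    also have "\<dots> = (\<Sum>d\<in>{1..n}. if d dvd m then mangoldt d else 0)"
    proof -
      have "1 \<le> d \<and> d \<le> n" if "d dvd m" for d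
        using dvd_imp_le[OF that] that m by (cases "d = 0") auto
      then show ?thesis by (intro sum.mono_neutral_cong_left) auto
    qed
    finally show "ln (real m) = (\<Sum>d\<in>{1..n}. if d dvd m then mangoldt d else 0)" .
  qed
  also have "\<dots> = (\<Sum>d\<in>{1..n}. \<Sum>m\<in>{1..n}. if d dvd m then mangoldt d else 0)"
    by (rule sum.swap)
  also have "\<dots> = (\<Sum>d\<in>{1..n}. mangoldt d * real (n div d))"
  proof (rule sum.cong[OF refl])
    fix d assume d: "d \<in> {1..n}"
    have "{m\<in>{1..n}. d dvd m} = (\<lambda>k. d * k) ` {1..n div d}"
      using d by (auto simp: less_eq_div_iff_mult_less_eq mult.commute elim!: dvdE intro!: Nat.gr0I)
    then have "card {m\<in>{1..n}. d dvd m} = n div d"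
      using d by (simp add: card_image inj_on_def)
    then show "(\<Sum>m\<in>{1..n}. if d dvd m then mangoldt d else 0) = mangoldt d * real (n div d)"
      by (simp flip: sum.inter_filter)
  qed
  finally show ?thesis .
qed

text \<open>The integer [2n/d] - 2[n/d] is never negative and is at least 1 for n < d \<le> 2n.
  Weighted by \<open>mangoldt\<close>, these integers sum to the logarithm of the central binomial
  coefficient, which is at most 2^(2n).\<close>

lemma psi_double: "psi (2 * n) \<le> psi n + 2 * real n * ln 2"
proof -
  have "psi (2 * n) - psi n = (\<Sum>d\<in>{n<..2*n}. mangoldt d)"
  proof -
    have "{..2*n} = {..n} \<union> {n<..2*n}" by auto
    then show ?thesis unfolding psi_def by (simp add: sum.union_disjoint ivl_disj_int)
  qed
  also have "\<dots> \<le> (\<Sum>d\<in>{n<..2*n}. mangoldt d * (real (2*n div d) - 2 * real (n div d)))"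
  proof (rule sum_mono)
    fix d assume "d \<in> {n<..2*n}"
    then have "n div d = 0" "2 * n div d \<ge> 1" by (auto simp: div_greater_zero_iff Suc_le_eq)
    then show "mangoldt d \<le> mangoldt d * (real (2*n div d) - 2 * real (n div d))"
      using mult_left_mono[of 1 "real (2*n div d)" "mangoldt d"] by (simp add: mangoldt_nonneg)
  qed
  also have "\<dots> \<le> (\<Sum>d\<in>{1..2*n}. mangoldt d * (real (2*n div d) - 2 * real (n div d)))"
  proof (rule sum_mono2)
    fix d
    have "2 * (n div d) \<le> 2 * n div d"
      by (cases "d = 0") (auto simp: less_eq_div_iff_mult_less_eq)
    then have "real (2 * (n div d)) \<le> real (2 * n div d)" by (rule of_nat_mono)
    then show "0 \<le> mangoldt d * (real (2*n div d) - 2 * real (n div d))"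
      by (intro mult_nonneg_nonneg) (auto simp: mangoldt_nonneg)
  qed auto
  also have "\<dots> = ln (fact (2*n)) - 2 * ln (fact n)"
  proof -
    have "(\<Sum>d\<in>{1..n}. mangoldt d * real (n div d)) = (\<Sum>d\<in>{1..2*n}. mangoldt d * real (n div d))"
      by (intro sum.mono_neutral_left) auto
    then show ?thesis unfolding ln_fact_mangoldt
      by (simp add: sum_subtractf right_diff_distrib sum_distrib_left mult_ac)
  qed
  also have "\<dots> = ln (real ((2*n) choose n))"
    by (simp add: binomial_fact ln_div ln_mult)
  also have "\<dots> \<le> ln (2 ^ (2*n))"
  proof (subst ln_le_cancel_iff)
    have "(2*n) choose n \<le> (\<Sum>k\<le>2*n. (2*n) choose k)" by (rule member_le_sum) auto
    also have "\<dots> = 2 ^ (2*n)" by (rule choose_row_sum)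
    finally show "real ((2*n) choose n) \<le> 2 ^ (2*n)" by (metis of_nat_le_iff of_nat_numeral of_nat_power)
  qed auto
  also have "\<dots> = 2 * real n * ln 2" by (simp add: ln_realpow)
  finally show ?thesis by simp
qed

lemma psi_le: "psi n \<le> 4 * real n"
proof (induction n rule: less_induct)
  case (less n)
  have l2: "ln 2 \<le> (1::real)" using ln_le_minus_one[of 2] by simp
  consider "n = 0" | "n = 1" | m where "n = 2 * m" "m > 0" | m where "n = 2 * m + 1" "m > 0"
    by (metis One_nat_def add.commute mult_0_right neq0_conv oddE evenE plus_1_eq_Suc)
  then show ?case
  proof cases
    case 3
    have "psi n \<le> psi m + 2 * real m * ln 2" using psi_double 3 by simp
    also have "\<dots> \<le> 4 * real m + 2 * real m * 1" using less[of m] 3 l2 by (intro add_mono mult_left_mono) auto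
    finally show ?thesis using 3 by simp
  next
    \<comment> \<open>Rounding up to 2(m + 1) costs something; the constant 4 absorbs it, since 6(m
      + 1) \<le> 4(2m + 1) as soon as m is at least 1.\<close>
    case 4
    have "psi n \<le> psi (2 * (m + 1))" using 4 by (intro psi_mono) auto
    also have "\<dots> \<le> psi (m + 1) + 2 * real (m + 1) * ln 2" by (rule psi_double)
    also have "\<dots> \<le> 4 * real (m + 1) + 2 * real (m + 1) * 1"
      using less[of "m + 1"] 4 l2 by (intro add_mono mult_left_mono) auto
    also have "\<dots> \<le> 4 * real n" using 4 by simp
    finally show ?thesis .
  qed (auto simp: psi_def)
qed

section \<open>The error of psi and Newman's theorem\<close>

definition psi_err :: "nat \<Rightarrow> real" where "psi_err n = psi n - real n"

lemma psi_err_0 [simp]: "psi_err 0 = 0" by (simp add: psi_err_def)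
lemma psi_err_le: "\<bar>psi_err n\<bar> \<le> 4 * real n"
  using psi_le[of n] psi_nonneg[of n] by (auto simp: psi_err_def)

text \<open>For n > 0 this is s times the integral of u^(-s-1) over [n, n + 1].\<close>

definition pdiff :: "nat \<Rightarrow> complex \<Rightarrow> complex" where
  "pdiff n s = of_nat n powr (-s) - of_nat (Suc n) powr (-s)"

text \<open>pdiff n s / s, with the removable singularity at s = 0 filled in.\<close>
definition pquot :: "nat \<Rightarrow> complex \<Rightarrow> complex" where
  "pquot n s = (if s = 0 then deriv (pdiff n) 0 else (pdiff n s - pdiff n 0) / (s - 0))"

text \<open>Shifted by 1 so that the line Re s = 1 becomes the imaginary axis. At z = 0 the
  coefficients with n > 0 are the weights 1/(n(n+1)); the term with n = 0 vanishes because
  \<open>psi_err 0 = 0\<close>.\<close>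

definition psi_partial :: "nat \<Rightarrow> complex \<Rightarrow> complex" where
  "psi_partial N z = (\<Sum>n<Suc N. of_real (psi_err n) * pquot n (1 + z))"

lemma pquot_eq: "n > 0 \<Longrightarrow> s \<noteq> 0 \<Longrightarrow> pquot n s = pdiff n s / s"
  by (simp add: pquot_def pdiff_def del: of_nat_Suc)

lemma psi_partial_holomorphic: "psi_partial N holomorphic_on UNIV"
proof -
  have "pdiff n holomorphic_on UNIV" for n
    unfolding pdiff_def[abs_def] by (intro holomorphic_intros)
  then have "pquot n holomorphic_on UNIV" for n
    unfolding pquot_def[abs_def] by (rule pole_lemma_open) auto
  then have "(pquot n \<circ> (\<lambda>z. 1 + z)) holomorphic_on UNIV" for n
    by (intro holomorphic_on_compose_gen[where t=UNIV] holomorphic_intros) auto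
  then have "(\<lambda>z. pquot n (1 + z)) holomorphic_on UNIV" for n
    by (simp add: o_def)
  then show ?thesis unfolding psi_partial_def[abs_def] by (intro holomorphic_intros)
qed

text \<open>Chebyshev's |\<open>psi_err n\<close>| \<le> 4 n supplies the weight n of the power
  estimate, and division by s cancels its factor |s|. What remains is an increment in n, nonnegative
  for either sign of Re z.\<close>

lemma psi_term_le:
  assumes "n > 0" "Re z \<noteq> 0" "z \<noteq> -1"
  shows "norm (of_real (psi_err n) * pquot n (1 + z))
      \<le> 4 * (real (Suc n) powr (- Re z) - real n powr (- Re z)) / (- Re z)"
proof -
  define s where "s = 1 + z"
  have s: "s \<noteq> 0" "Re (-s) + 1 \<noteq> 0" "Re (-s) + 1 = - Re z"
    using assms by (auto simp: s_def add_eq_0_iff complex_eq_iff)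
  have "real n * norm (pdiff n s) \<le> norm s * (real (Suc n) powr (- Re z) - real n powr (- Re z)) / (- Re z)"
    using powr_diff_weighted_le[of "real n" "real (Suc n)" "-s"] assms(1) s
    by (simp add: pdiff_def norm_minus_commute del: of_nat_Suc)
  then have "real n * norm (pdiff n s) / norm s
      \<le> norm s * (real (Suc n) powr (- Re z) - real n powr (- Re z)) / (- Re z) / norm s"
    by (rule divide_right_mono) simp
  then have "real n * norm (pquot n s) \<le> (real (Suc n) powr (- Re z) - real n powr (- Re z)) / (- Re z)"
    using s assms by (simp add: pquot_eq norm_divide del: of_nat_Suc)
  then have "4 * (real n * norm (pquot n s)) \<le> 4 * ((real (Suc n) powr (- Re z) - real n powr (- Re z)) / (- Re z))"
    by (rule mult_left_mono) simp
  moreover have "\<bar>psi_err n\<bar> * norm (pquot n s) \<le> 4 * real n * norm (pquot n s)"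
    using psi_err_le by (intro mult_right_mono) auto
  ultimately show ?thesis by (simp add: s_def norm_mult)
qed

text \<open>Telescoping. It feeds both hypotheses of the Tauberian theorem: M tending to infinity
  for Re z > 0, and N = 0 for Re z < 0.\<close>

lemma psi_partial_diff_le:
  assumes "N \<le> M" "Re z \<noteq> 0" "z \<noteq> -1"
  shows "norm (psi_partial M z - psi_partial N z)
     \<le> 4 * (real (Suc M) powr (- Re z) - real (Suc N) powr (- Re z)) / (- Re z)"
  using assms(1)
proof (induction M rule: dec_induct)
  case (step M)
  have "psi_partial (Suc M) z - psi_partial N z
      = (psi_partial M z - psi_partial N z) + of_real (psi_err (Suc M)) * pquot (Suc M) (1 + z)"
    by (simp add: psi_partial_def)
  also have "norm \<dots> \<le> 4 * (real (Suc M) powr (- Re z) - real (Suc N) powr (- Re z)) / (- Re z)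
     + 4 * (real (Suc (Suc M)) powr (- Re z) - real (Suc M) powr (- Re z)) / (- Re z)"
    using step.IH psi_term_le[of "Suc M" z] assms by (intro norm_triangle_mono) auto
  also have "\<dots> = 4 * (real (Suc (Suc M)) powr (- Re z) - real (Suc N) powr (- Re z)) / (- Re z)"
    using assms by (simp add: field_simps del: of_nat_Suc)
  finally show ?case .
qed simp

lemma psi_abel_summation:
  "(\<Sum>n<Suc N. of_real (psi_err n) * pdiff n s)
    = (\<Sum>n<Suc N. mangoldt n * of_nat n powr (-s)) - (\<Sum>n<Suc N. of_nat n powr (-s))
       - of_real (psi_err N) * of_nat (Suc N) powr (-s)"
proof (induction N)
  case (Suc N)
  have "psi_err (Suc N) = psi_err N + mangoldt (Suc N) - 1" by (simp add: psi_err_def psi_Suc)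
  then have e: "complex_of_real (psi_err (Suc N)) = of_real (psi_err N) + mangoldt (Suc N) - 1"
    by simp
  show ?case unfolding sum.lessThan_Suc[of _ "Suc N"] Suc.IH
    unfolding e pdiff_def by (simp add: algebra_simps del: of_nat_Suc sum.lessThan_Suc)
qed simp

lemma psi_partial_tendsto:
  assumes "Re z > 0"
  shows "(\<lambda>N. psi_partial N z) \<longlonglongrightarrow> zeta_diff (1 + z) / (1 + z)"
proof -
  define s where "s = 1 + z"
  have s: "Re s > 1" "s \<noteq> 0" using assms by (auto simp: s_def complex_eq_iff)
  have "psi_partial N z = (\<Sum>n<Suc N. of_real (psi_err n) * pdiff n s) / s" for N
    unfolding psi_partial_def sum_divide_distrib s_def[symmetric]
  proof (rule sum.cong[OF refl])
    fix n show "of_real (psi_err n) * pquot n s = of_real (psi_err n) * pdiff n s / s"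
      using s by (cases "n = 0") (auto simp: pquot_eq)
  qed
  moreover have "(\<lambda>N. (\<Sum>n<Suc N. of_real (psi_err n) * pdiff n s) / s) \<longlonglongrightarrow> (mangoldt_series s - zeta s - 0) / s"
    unfolding psi_abel_summation
  proof (intro tendsto_intros s)
    show "(\<lambda>N. \<Sum>n<Suc N. mangoldt n * of_nat n powr (-s)) \<longlonglongrightarrow> mangoldt_series s"
      using mangoldt_sums[OF s(1)] unfolding sums_def by (rule LIMSEQ_Suc)
    show "(\<lambda>N. \<Sum>n<Suc N. of_nat n powr (-s)) \<longlonglongrightarrow> zeta s"
      using zeta_sums[OF s(1)] unfolding sums_def by (rule LIMSEQ_Suc)
    show "(\<lambda>N. of_real (psi_err N) * of_nat (Suc N) powr (-s)) \<longlonglongrightarrow> 0"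
    proof (rule Lim_null_comparison)
      show "(\<lambda>N. 4 * real (Suc N) powr (- Re z)) \<longlonglongrightarrow> 0"
        using assms by (intro tendsto_mult_right_zero tendsto_neg_powr filterlim_compose[OF filterlim_real_sequentially filterlim_Suc]) auto
      show "\<forall>\<^sub>F N in sequentially. norm (of_real (psi_err N) * of_nat (Suc N) powr (-s) :: complex) \<le> 4 * real (Suc N) powr (- Re z)"
      proof (intro always_eventually allI)
        fix N
        have "norm (of_real (psi_err N) * of_nat (Suc N) powr (-s) :: complex) = \<bar>psi_err N\<bar> * real (Suc N) powr (- Re s)"
          by (simp add: norm_mult norm_nat_powr del: of_nat_Suc)
        also have "\<dots> \<le> (4 * real (Suc N)) * real (Suc N) powr (- Re s)"
          using psi_err_le[of N] by (intro mult_right_mono) auto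
        also have "\<dots> = 4 * (real (Suc N) powr 1 * real (Suc N) powr (- Re s))" by simp
        also have "\<dots> = 4 * real (Suc N) powr (- Re z)" unfolding powr_add[symmetric] by (simp add: s_def)
        finally show "norm (of_real (psi_err N) * of_nat (Suc N) powr (-s) :: complex) \<le> 4 * real (Suc N) powr (- Re z)" .
      qed
    qed
  qed
  ultimately show ?thesis using zeta_diff_eq[OF s(1)] by (simp add: s_def)
qed

text \<open>Non-vanishing of \<open>zeta_reg\<close> on Re s \<ge> 1 is exactly what places the
  closed right half plane inside \<open>U\<close>. The choice L = ln(N + 1) turns exp(- L Re z) into
  the power (N + 1)^(- Re z) of the telescoped bounds.\<close>

lemma psi_partial_convergent: "convergent (\<lambda>N. psi_partial N 0)"
proof -
  define U where "U = (\<lambda>z. 1 + z) -` {s. Re s > 0 \<and> zeta_reg s \<noteq> 0}"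
  have "(\<lambda>N. psi_partial N 0) \<longlonglongrightarrow> zeta_diff (1 + 0) / (1 + 0)"
  proof (rule Newman_tauberian[where C=4 and L="\<lambda>N. ln (real (Suc N))" and U=U])
    show "open U" unfolding U_def
      by (intro open_vimage zeta_diff_holomorphic(1) continuous_intros)
    show "{z. 0 \<le> Re z} \<subseteq> U"
      using zeta_reg_nonzero by (auto simp: U_def)
    show "(\<lambda>z. zeta_diff (1 + z) / (1 + z)) holomorphic_on U"
    proof (intro holomorphic_intros)
      show "(\<lambda>z. zeta_diff (1 + z)) holomorphic_on U"
      proof -
        have "(zeta_diff \<circ> (\<lambda>z. 1 + z)) holomorphic_on U"
          by (rule holomorphic_on_compose_gen[OF _ zeta_diff_holomorphic(2)])
             (auto simp: U_def intro!: holomorphic_intros)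
        then show ?thesis by (simp add: o_def)
      qed
      show "1 + z \<noteq> 0" if "z \<in> U" for z using that by (auto simp: U_def add_eq_0_iff)
    qed
    show "filterlim (\<lambda>N. ln (real (Suc N))) at_top sequentially"
      by real_asymp
    have ex: "exp (- ln (real (Suc n)) * Re z) = real (Suc n) powr (- Re z)" for n z
      by (simp add: powr_def mult.commute)
    show "norm (zeta_diff (1 + z) / (1 + z) - psi_partial n z) \<le> 4 * exp (- ln (real (Suc n)) * Re z) / Re z"
      if z: "Re z > 0" for n z
      unfolding ex
    proof (rule tendsto_upperbound)
      show "(\<lambda>M. norm (psi_partial M z - psi_partial n z)) \<longlonglongrightarrow> norm (zeta_diff (1 + z) / (1 + z) - psi_partial n z)"
        by (intro tendsto_intros psi_partial_tendsto z)
      show "\<forall>\<^sub>F M in sequentially. norm (psi_partial M z - psi_partial n z) \<le> 4 * real (Suc n) powr (- Re z) / Re z"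
        using eventually_ge_at_top[of n]
      proof eventually_elim
        case (elim M)
        have "norm (psi_partial M z - psi_partial n z)
           \<le> 4 * (real (Suc M) powr (- Re z) - real (Suc n) powr (- Re z)) / (- Re z)"
          using z elim by (intro psi_partial_diff_le) auto
        also have "\<dots> = 4 * (real (Suc n) powr (- Re z) - real (Suc M) powr (- Re z)) / Re z"
          by (simp add: diff_divide_distrib right_diff_distrib del: of_nat_Suc)
        also have "\<dots> \<le> 4 * real (Suc n) powr (- Re z) / Re z"
          using z by (intro divide_right_mono) auto
        finally show ?case .
      qed
    qed auto
    show "norm (psi_partial n z) \<le> 4 * exp (- ln (real (Suc n)) * Re z) / (- Re z)"
      if z: "Re z < 0" "z \<noteq> -1" for n z
    proof -
      have "psi_partial 0 z = 0" by (simp add: psi_partial_def)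
      then have "norm (psi_partial n z) \<le> 4 * (real (Suc n) powr (- Re z) - real (Suc 0) powr (- Re z)) / (- Re z)"
        using psi_partial_diff_le[of 0 n z] z by simp
      also have "\<dots> \<le> 4 * real (Suc n) powr (- Re z) / (- Re z)"
        using z by (intro divide_right_mono) auto
      finally show ?thesis unfolding ex .
    qed
  qed (use psi_partial_holomorphic in auto)
  then show ?thesis by (rule convergentI)
qed

text \<open>Only smallness of late blocks is extracted, not the value of the limit: it is
  incompatible with psi staying a fixed proportion away from n throughout a block of proportional
  length.\<close>

lemma psi_err_Cauchy:
  assumes "e > 0"
  shows "\<exists>N. \<forall>m\<ge>N. \<forall>n\<ge>m. \<bar>\<Sum>k\<in>{m..<n}. psi_err k / (real k * real (Suc k))\<bar> < e"
proof -
  have pd: "psi_partial N 0 = of_real (\<Sum>k<Suc N. psi_err k / (real k * real (Suc k)))" for N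
    unfolding psi_partial_def of_real_sum
  proof (rule sum.cong[OF refl])
    fix n show "of_real (psi_err n) * pquot n (1 + 0) = of_real (psi_err n / (real n * real (Suc n)))"
    proof (cases "n = 0")
      case False
      then have "pquot n 1 = 1 / of_nat n - 1 / of_nat (Suc n)"
        by (simp add: pquot_eq pdiff_def powr_minus divide_inverse del: of_nat_Suc)
      also have "\<dots> = 1 / (of_nat n * of_nat (Suc n))"
        using False by (simp add: field_simps del: of_nat_Suc, simp)
      finally show ?thesis by (simp del: of_nat_Suc)
    qed simp
  qed
  have "Cauchy (\<lambda>N. psi_partial N 0)" using psi_partial_convergent by (simp add: Cauchy_convergent_iff)
  then obtain N where N: "\<And>m n. m \<ge> N \<Longrightarrow> n \<ge> N \<Longrightarrow> norm (psi_partial m 0 - psi_partial n 0) < e"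
    using CauchyD assms by metis
  show ?thesis
  proof (intro exI[of _ "Suc N"] allI impI)
    fix m n assume mn: "Suc N \<le> m" "m \<le> n"
    define f where "f = (\<lambda>k. psi_err k / (real k * real (Suc k)))"
    have "psi_partial (n - 1) 0 - psi_partial (m - 1) 0 = of_real (sum f {..<n} - sum f {..<m})"
      using mn unfolding pd f_def[symmetric] by (simp del: sum.lessThan_Suc)
    also have "sum f {..<n} - sum f {..<m} = sum f {m..<n}"
      using mn sum_diff_nat_ivl[of 0 m n f] by (simp add: atLeast0LessThan)
    finally show "\<bar>\<Sum>k\<in>{m..<n}. psi_err k / (real k * real (Suc k))\<bar> < e"
      using N[of "n - 1" "m - 1"] mn by (simp only: f_def norm_of_real)
  qed
qed

section \<open>The prime number theorem for psi and primes in short intervals\<close>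

lemma sum_inverse_telescope:
  assumes "0 < m" "m \<le> n"
  shows "(\<Sum>k\<in>{m..<n}. 1 / (real k * real (Suc k))) = 1 / real m - 1 / real n"
  using assms(2)
proof (induction n rule: dec_induct)
  case (step n)
  have "1 / (real n * real (Suc n)) = 1 / real n - 1 / real (Suc n)"
    using step assms(1) by (simp add: field_simps)
  then show ?case using step by simp
qed simp

text \<open>psi is monotone, so an excess of \<eta> n at n leaves an excess of at least (\<eta>/2) n
  at every k up to (1 + \<eta>/2) n. The weights of this block sum to about (1 - 1/(1 + \<eta>/2)) /
  n, so its sum is at least the constant \<open>e\<close>.\<close>

lemma psi_upper:
  assumes "0 < \<eta>" shows "\<exists>N. \<forall>n\<ge>N. psi n < (1 + \<eta>) * real n"
proof -
  define e where "e = \<eta> / 2 * (1 - 1 / (1 + \<eta> / 2))"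
  have "e > 0" using assms by (simp add: e_def)
  then obtain N where N: "\<And>m n. m \<ge> N \<Longrightarrow> n \<ge> m \<Longrightarrow> \<bar>\<Sum>k\<in>{m..<n}. psi_err k / (real k * real (Suc k))\<bar> < e"
    using psi_err_Cauchy by blast
  show ?thesis
  proof (intro exI[of _ "Suc N"] allI impI, rule ccontr)
    fix n assume n: "n \<ge> Suc N" and "\<not> psi n < (1 + \<eta>) * real n"
    then have ps: "psi n \<ge> (1 + \<eta>) * real n" by simp
    \<comment> \<open>One more than the floor: every k < M is still at most (1 + \<eta>/2) n, while
      M itself is large enough for the lower bound on the weights.\<close>
    define M where "M = Suc (nat \<lfloor>(1 + \<eta> / 2) * real n\<rfloor>)"
    have M: "(1 + \<eta> / 2) * real n \<le> real M" "real M \<le> (1 + \<eta> / 2) * real n + 1"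
    proof -
      have "0 \<le> (1 + \<eta> / 2) * real n" using assms by simp
      then show "(1 + \<eta> / 2) * real n \<le> real M" "real M \<le> (1 + \<eta> / 2) * real n + 1"
        unfolding M_def by linarith+
    qed
    have nM: "n \<le> M"
    proof -
      have "real n \<le> (1 + \<eta> / 2) * real n" using assms by (simp add: algebra_simps)
      then show ?thesis using M(1) by linarith
    qed
    have "\<eta> / 2 * real n * (1 / real n - 1 / real M) = (\<Sum>k\<in>{n..<M}. \<eta> / 2 * real n * (1 / (real k * real (Suc k))))"
      using sum_inverse_telescope[of n M] n nM by (simp only: sum_distrib_left[symmetric])
    also have "\<dots> \<le> (\<Sum>k\<in>{n..<M}. psi_err k / (real k * real (Suc k)))"
    proof (rule sum_mono)
      fix k assume k: "k \<in> {n..<M}"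
      have "psi k \<ge> (1 + \<eta>) * real n" using ps psi_mono[of n k] k by auto
      moreover have "real k \<le> (1 + \<eta> / 2) * real n" using k M(2) by auto
      ultimately have "\<eta> / 2 * real n \<le> psi_err k" by (simp add: psi_err_def algebra_simps)
      from divide_right_mono[OF this, of "real k * real (Suc k)"]
      show "\<eta> / 2 * real n * (1 / (real k * real (Suc k))) \<le> psi_err k / (real k * real (Suc k))" by simp
    qed
    also have "\<dots> < e" using N[of n M] n nM by auto
    finally have "\<eta> / 2 * real n * (1 / real n - 1 / real M) < e" .
    moreover have "1 / real M \<le> 1 / ((1 + \<eta> / 2) * real n)"
      using M n nM assms by (intro divide_left_mono mult_pos_pos) auto
    then have "\<eta> / 2 * real n * (1 / real n - 1 / real M) \<ge> \<eta> / 2 * real n * (1 / real n - 1 / ((1 + \<eta> / 2) * real n))"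
      using assms by (intro mult_left_mono) auto
    moreover have "\<eta> / 2 * real n * (1 / real n - 1 / ((1 + \<eta> / 2) * real n)) = e"
    proof -
      have "real n * (1 / real n - 1 / ((1 + \<eta> / 2) * real n)) = 1 - 1 / (1 + \<eta> / 2)"
        using n by (simp add: right_diff_distrib)
      then show ?thesis by (simp add: e_def mult.assoc)
    qed
    ultimately show False by linarith
  qed
qed

text \<open>The mirror image: a deficit of \<eta> n at n forces a deficit of at least (\<eta>/2) n
  on the block from (1 - \<eta>/2) n up to n.\<close>

lemma psi_lower:
  assumes "0 < \<eta>" "\<eta> < 1" shows "\<exists>N. \<forall>n\<ge>N. psi n > (1 - \<eta>) * real n"
proof -
  define e where "e = \<eta>\<^sup>2 / 8"
  have "e > 0" using assms by (simp add: e_def)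
  then obtain N where N: "\<And>m n. m \<ge> N \<Longrightarrow> n \<ge> m \<Longrightarrow> \<bar>\<Sum>k\<in>{m..<n}. psi_err k / (real k * real (Suc k))\<bar> < e"
    using psi_err_Cauchy by blast
  show ?thesis
  \<comment> \<open>The part 2 N ensures m \<ge> n/2 \<ge> N; the part 4 / \<eta> makes the rounding
    error 1 at most (\<eta>/4) n, so that m \<le> (1 - \<eta>/4) n. The block then weighs at least
    (\<eta>/4) / n, whence e = (\<eta>/2)(\<eta>/4).\<close>
  proof (intro exI[of _ "2 * N + nat \<lceil>4 / \<eta>\<rceil> + 1"] allI impI, rule ccontr)
    fix n assume n: "n \<ge> 2 * N + nat \<lceil>4 / \<eta>\<rceil> + 1" and "\<not> psi n > (1 - \<eta>) * real n"
    then have ps: "psi n \<le> (1 - \<eta>) * real n" by simp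
    have n4: "real n \<ge> 4 / \<eta>" "n > 0" "n \<ge> 2 * N" using n by linarith+
    define m where "m = nat \<lceil>(1 - \<eta> / 2) * real n\<rceil>"
    have pos: "(1 - \<eta> / 2) * real n > 0" using assms n4 by simp
    have m: "real m \<ge> (1 - \<eta> / 2) * real n" "real m \<le> (1 - \<eta> / 2) * real n + 1" "m > 0"
      unfolding m_def using pos by linarith+
    have e4: "\<eta> * real n \<ge> 4" using n4 assms by (simp add: field_simps)
    have mn: "m \<le> n" "m \<ge> N"
    proof -
      have "real m \<le> real n" using m e4 by (simp add: algebra_simps)
      then show "m \<le> n" by simp
      have "real m \<ge> real n / 2"
        using m(1) assms mult_right_mono[of \<eta> 1 "real n"] by (simp add: algebra_simps)
      then show "m \<ge> N" using n4 by linarith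
    qed
    have "(\<Sum>k\<in>{m..<n}. psi_err k / (real k * real (Suc k))) \<le> (\<Sum>k\<in>{m..<n}. - (\<eta> / 2 * real n) * (1 / (real k * real (Suc k))))"
    proof (rule sum_mono)
      fix k assume k: "k \<in> {m..<n}"
      have "psi k \<le> (1 - \<eta>) * real n" using ps psi_mono[of k n] k by auto
      moreover have "real k \<ge> (1 - \<eta> / 2) * real n" using k m(1) by auto
      ultimately have "psi_err k \<le> - (\<eta> / 2 * real n)" by (simp add: psi_err_def algebra_simps)
      from divide_right_mono[OF this, of "real k * real (Suc k)"]
      show "psi_err k / (real k * real (Suc k)) \<le> - (\<eta> / 2 * real n) * (1 / (real k * real (Suc k)))" by simp
    qed
    also have "\<dots> = - (\<eta> / 2 * real n) * (\<Sum>k\<in>{m..<n}. 1 / (real k * real (Suc k)))"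
      by (rule sum_distrib_left[symmetric])
    also have "\<dots> = - (\<eta> / 2 * real n * (1 / real m - 1 / real n))"
      unfolding sum_inverse_telescope[OF m(3) mn(1)] by (rule mult_minus_left)
    finally have "\<eta> / 2 * real n * (1 / real m - 1 / real n) < e"
      using N[OF mn(2,1)] by linarith
    moreover have "1 / real m - 1 / real n \<ge> \<eta> / 4 / real n"
    proof -
      have "real m \<le> (1 - \<eta> / 4) * real n" using m(2) e4 by (simp add: algebra_simps)
      then have "1 / real m \<ge> 1 / ((1 - \<eta> / 4) * real n)"
        using m assms n4 by (intro divide_left_mono) auto
      moreover have "1 / (1 - \<eta> / 4) \<ge> 1 + \<eta> / 4" using assms by (simp add: field_simps)
      then have "1 / (1 - \<eta> / 4) / real n \<ge> (1 + \<eta> / 4) / real n" by (intro divide_right_mono) auto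
      ultimately show ?thesis by (simp add: add_divide_distrib)
    qed
    then have "\<eta> / 2 * real n * (1 / real m - 1 / real n) \<ge> \<eta> / 2 * real n * (\<eta> / 4 / real n)"
      using assms by (intro mult_left_mono) auto
    moreover have "\<eta> / 2 * real n * (\<eta> / 4 / real n) = e" using n4 by (simp add: e_def power2_eq_square)
    ultimately show False by linarith
  qed
qed

lemma card_proper_prime_powers_le:
  assumes "x > 0"
  shows "real (card {n. n \<le> x \<and> primepow n \<and> \<not> prime n}) \<le> (sqrt (real x) + 1) * (log 2 (real x) + 1)"
proof -
  define P where "P = {..nat \<lfloor>sqrt (real x)\<rfloor>}"
  define K where "K = {..nat \<lfloor>log 2 (real x)\<rfloor>}"
  have "{n. n \<le> x \<and> primepow n \<and> \<not> prime n} \<subseteq> (\<lambda>(p, k). p ^ k) ` (P \<times> K)"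
  proof safe
    fix n assume n: "n \<le> x" "primepow n" "\<not> prime n"
    then obtain p k where pk: "prime p" "k > 0" "n = p ^ k" by (auto simp: primepow_def)
    then have "k \<noteq> 1" using n by auto
    then have k: "k \<ge> 2" using pk by simp
    have p2: "p \<ge> 2" using pk prime_ge_2_nat by auto
    have "p ^ 2 \<le> p ^ k" using k p2 by (intro power_increasing) auto
    then have "real (p ^ 2) \<le> real x" using n pk by (simp only: of_nat_le_iff)
    then have "real p \<le> sqrt (real x)" by (intro real_le_rsqrt) simp
    moreover have "2 ^ k \<le> p ^ k" using p2 by (intro power_mono) auto
    then have "real (2 ^ k) \<le> real x" using n pk by (simp only: of_nat_le_iff)
    then have "real k \<le> log 2 (real x)" using assms by (simp add: le_log_of_power)
    ultimately have "p \<in> P" "k \<in> K" unfolding P_def K_def by (auto simp: le_nat_floor)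
    then show "n \<in> (\<lambda>(p, k). p ^ k) ` (P \<times> K)" using pk by auto
  qed
  moreover have "finite (P \<times> K)" by (simp add: P_def K_def)
  ultimately have "card {n. n \<le> x \<and> primepow n \<and> \<not> prime n} \<le> card (P \<times> K)"
    using surj_card_le by blast
  then have "real (card {n. n \<le> x \<and> primepow n \<and> \<not> prime n}) \<le> real (card P) * real (card K)"
    by (metis card_cartesian_product of_nat_le_iff of_nat_mult)
  also have "\<dots> \<le> (sqrt (real x) + 1) * (log 2 (real x) + 1)"
    using assms unfolding P_def K_def by (intro mult_mono) (auto simp: of_nat_nat)
  finally show ?thesis .
qed

text \<open>With \<eta> = \<epsilon>/4 the increment of psi over the interval exceeds (\<epsilon>/2)
  x. Without a prime in it, only proper prime powers contribute, each at most ln x, and these are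
  about sqrt x * log x in number: the base is at most sqrt x because the exponent is at least
  2.\<close>

theorem primes_in_short_intervals:
  fixes \<epsilon> :: real
  assumes "0 < \<epsilon>" "\<epsilon> < 1"
  shows "\<exists>N. \<forall>x\<ge>N. \<exists>p. prime p \<and> (1 - \<epsilon>) * real x \<le> real p \<and> p \<le> x"
proof -
  define \<eta> where "\<eta> = \<epsilon> / 4"
  have \<eta>: "0 < \<eta>" "\<eta> < 1" using assms by (auto simp: \<eta>_def)
  obtain N1 where N1: "\<And>n. n \<ge> N1 \<Longrightarrow> psi n < (1 + \<eta>) * real n" using psi_upper \<eta> by blast
  obtain N2 where N2: "\<And>n. n \<ge> N2 \<Longrightarrow> psi n > (1 - \<eta>) * real n" using psi_lower \<eta> by blast
  have "\<forall>\<^sub>F x in sequentially. (sqrt (real x) + 1) * (log 2 (real x) + 1) * ln (real x) < \<epsilon> / 2 * real x"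
    using assms by real_asymp
  moreover have "\<forall>\<^sub>F x in sequentially. (1 - \<epsilon>) * real x \<ge> real N1 + 1"
    using assms by real_asymp
  ultimately have "\<forall>\<^sub>F x in sequentially. \<exists>p. prime p \<and> (1 - \<epsilon>) * real x \<le> real p \<and> p \<le> x"
    using eventually_ge_at_top[of N2] eventually_gt_at_top[of 0]
  proof eventually_elim
    case (elim x)
    define y where "y = nat \<lfloor>(1 - \<epsilon>) * real x\<rfloor>"
    have pos: "(1 - \<epsilon>) * real x \<ge> 0" using assms by simp
    have y: "real y \<le> (1 - \<epsilon>) * real x" "(1 - \<epsilon>) * real x < real y + 1"
      unfolding y_def using pos by linarith+
    have yx: "y \<le> x"
    proof -
      have "(1 - \<epsilon>) * real x \<le> real x" using assms by (simp add: algebra_simps)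
      then show ?thesis using y by linarith
    qed
    have "y \<ge> N1" using elim(2) y by linarith
    show ?case
    proof (rule ccontr)
      assume no: "\<not> ?case"
      have np: "\<not> prime k" if "k \<in> {y<..x}" for k
      proof
        assume "prime k"
        moreover have "(1 - \<epsilon>) * real x \<le> real k" "k \<le> x" using y that by auto
        ultimately show False using no by blast
      qed
      have "psi x - psi y = (\<Sum>k\<in>{y<..x}. mangoldt k)"
      proof -
        have "{..x} = {..y} \<union> {y<..x}" using yx by auto
        then show ?thesis unfolding psi_def by (simp add: sum.union_disjoint ivl_disj_int)
      qed
      also have "\<dots> = (\<Sum>k\<in>{k\<in>{y<..x}. primepow k}. mangoldt k)"
        by (intro sum.mono_neutral_right) (auto simp: mangoldt_def)
      also have "\<dots> \<le> (\<Sum>k\<in>{k\<in>{y<..x}. primepow k}. ln (real x))"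
      proof (rule sum_mono)
        fix k assume k: "k \<in> {k\<in>{y<..x}. primepow k}"
        then have "mangoldt k \<le> ln (real k)" by (intro mangoldt_le) auto
        also have "\<dots> \<le> ln (real x)" using k by auto
        finally show "mangoldt k \<le> ln (real x)" .
      qed
      also have "\<dots> = real (card {k\<in>{y<..x}. primepow k}) * ln (real x)" by simp
      also have "\<dots> \<le> real (card {n. n \<le> x \<and> primepow n \<and> \<not> prime n}) * ln (real x)"
        using np elim(4) by (intro mult_right_mono of_nat_mono card_mono) auto
      also have "\<dots> \<le> (sqrt (real x) + 1) * (log 2 (real x) + 1) * ln (real x)"
        using elim(4) by (intro mult_right_mono card_proper_prime_powers_le) auto
      also have "\<dots> < \<epsilon> / 2 * real x" by (rule elim(1))
      finally have "psi x - psi y < \<epsilon> / 2 * real x" .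
      moreover have "psi x > (1 - \<eta>) * real x" using N2 elim by simp
      moreover have "psi y \<le> (1 + \<eta>) * ((1 - \<epsilon>) * real x)"
        using N1[OF \<open>y \<ge> N1\<close>] mult_left_mono[OF y(1), of "1 + \<eta>"] \<eta> by linarith
      moreover have "(1 - \<eta>) * real x - (1 + \<eta>) * ((1 - \<epsilon>) * real x) \<ge> \<epsilon> / 2 * real x"
      proof -
        have "(1 - \<eta>) - (1 + \<eta>) * (1 - \<epsilon>) \<ge> \<epsilon> / 2" using assms by (simp add: \<eta>_def field_simps)
        from mult_right_mono[OF this, of "real x"] show ?thesis by (simp add: algebra_simps)
      qed
      ultimately show False by linarith
    qed
  qed
  then show ?thesis by (simp add: eventually_sequentially)
qed

section \<open>The lower bound\<close>

text \<open>Each vertex of a bipartite graph (parts P and Q, edges t joining P t to Q t) is replaced by three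
  copies, vertex c becoming 3c, 3c+1, 3c+2. A Berge-C4 projects to a closed walk with distinct edges
  and possible stays; four stays are impossible because there are only three copies.\<close>
lemma blowup_C4_free:
  fixes P Q :: "'t \<Rightarrow> nat"
  assumes dist: "distinct ts"
    and PQ: "\<And>s t. s \<in> set ts \<Longrightarrow> t \<in> set ts \<Longrightarrow> P s \<noteq> Q t"
    and inj: "\<And>s t. s \<in> set ts \<Longrightarrow> t \<in> set ts \<Longrightarrow> P s = P t \<Longrightarrow> Q s = Q t \<Longrightarrow> s = t"
    and C4: "\<And>s t u w. {s, t, u, w} \<subseteq> set ts \<Longrightarrow> P s = P t \<Longrightarrow> Q t = Q u \<Longrightarrow> P u = P w \<Longrightarrow> Q w = Q s \<Longrightarrow> s = t \<or> t = u"
  shows "\<not> has_berge_C4 (map (\<lambda>t. {v. v div 3 = P t \<or> v div 3 = Q t}) ts)"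
proof
  assume "has_berge_C4 (map (\<lambda>t. {v. v div 3 = P t \<or> v div 3 = Q t}) ts)"
  then obtain v1 v2 v3 v4 i1 i2 i3 i4 where v: "distinct [v1, v2, v3, v4]" and i: "distinct [i1, i2, i3, i4]"
    "i1 < length ts" "i2 < length ts" "i3 < length ts" "i4 < length ts"
    and inc: "v1 div 3 = P (ts ! i1) \<or> v1 div 3 = Q (ts ! i1)" "v2 div 3 = P (ts ! i1) \<or> v2 div 3 = Q (ts ! i1)"
    "v2 div 3 = P (ts ! i2) \<or> v2 div 3 = Q (ts ! i2)" "v3 div 3 = P (ts ! i2) \<or> v3 div 3 = Q (ts ! i2)"
    "v3 div 3 = P (ts ! i3) \<or> v3 div 3 = Q (ts ! i3)" "v4 div 3 = P (ts ! i3) \<or> v4 div 3 = Q (ts ! i3)"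
    "v4 div 3 = P (ts ! i4) \<or> v4 div 3 = Q (ts ! i4)" "v1 div 3 = P (ts ! i4) \<or> v1 div 3 = Q (ts ! i4)"
    unfolding has_berge_C4_def by auto
  define t1 t2 t3 t4 where "t1 = ts ! i1" and "t2 = ts ! i2" and "t3 = ts ! i3" and "t4 = ts ! i4"
  note t_def = this
  define c1 c2 c3 c4 where "c1 = v1 div 3" and "c2 = v2 div 3" and "c3 = v3 div 3" and "c4 = v4 div 3"
  note c_def = this
  have tm: "t1 \<in> set ts" "t2 \<in> set ts" "t3 \<in> set ts" "t4 \<in> set ts" using i by (auto simp: t_def)
  have td: "distinct [t1, t2, t3, t4]" using i dist by (auto simp: t_def nth_eq_iff_index_eq)
  have c: "\<not> (c1 = c2 \<and> c2 = c3 \<and> c3 = c4)"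
  proof
    assume e: "c1 = c2 \<and> c2 = c3 \<and> c3 = c4"
    have inj3: "u mod 3 \<noteq> w mod 3" if "u \<noteq> w" "u div 3 = w div 3" for u w :: nat
      using that by (metis div_mult_mod_eq)
    have "distinct [v1 mod 3, v2 mod 3, v3 mod 3, v4 mod 3]"
      using v e inj3[of v1 v2] inj3[of v1 v3] inj3[of v1 v4] inj3[of v2 v3] inj3[of v2 v4] inj3[of v3 v4]
      by (auto simp: c_def)
    then have "card (set [v1 mod 3, v2 mod 3, v3 mod 3, v4 mod 3]) = 4" by (simp only: distinct_card) simp
    moreover have "set [v1 mod 3, v2 mod 3, v3 mod 3, v4 mod 3] \<subseteq> {..<3}" by auto
    then have "card (set [v1 mod 3, v2 mod 3, v3 mod 3, v4 mod 3]) \<le> card {..<3::nat}" by (intro card_mono) auto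
    ultimately show False by simp
  qed
  \<comment> \<open>A class shared by two consecutive edges is an end of both on the same side,
    since the two parts have no label in common.\<close>
  have s1: "(c1 = P t4 \<and> c1 = P t1) \<or> (c1 = Q t4 \<and> c1 = Q t1)" and s2: "(c2 = P t1 \<and> c2 = P t2) \<or> (c2 = Q t1 \<and> c2 = Q t2)"
    and s3: "(c3 = P t2 \<and> c3 = P t3) \<or> (c3 = Q t2 \<and> c3 = Q t3)" and s4: "(c4 = P t3 \<and> c4 = P t4) \<or> (c4 = Q t3 \<and> c4 = Q t4)"
    using inc PQ tm unfolding t_def[symmetric] c_def[symmetric] by metis+
  have A: "P t1 = P t2 \<Longrightarrow> Q t2 = Q t3 \<Longrightarrow> P t3 = P t4 \<Longrightarrow> Q t4 = Q t1 \<Longrightarrow> False"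
    using C4[of t1 t2 t3 t4] tm td by auto
  have B: "P t2 = P t3 \<Longrightarrow> Q t3 = Q t4 \<Longrightarrow> P t4 = P t1 \<Longrightarrow> Q t1 = Q t2 \<Longrightarrow> False"
    using C4[of t2 t3 t4 t1] tm td by auto
  have N: "\<not> (P s = P t \<and> Q s = Q t)" if "s \<noteq> t" "s \<in> set ts" "t \<in> set ts" for s t
    using inj that by blast
  have N': "\<not> (P t1 = P t2 \<and> Q t1 = Q t2)" "\<not> (P t1 = P t3 \<and> Q t1 = Q t3)" "\<not> (P t1 = P t4 \<and> Q t1 = Q t4)"
    "\<not> (P t2 = P t3 \<and> Q t2 = Q t3)" "\<not> (P t2 = P t4 \<and> Q t2 = Q t4)" "\<not> (P t3 = P t4 \<and> Q t3 = Q t4)"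
    using N tm td by auto
  \<comment> \<open>Equal sides throughout put all four vertices into one class. One odd side, or
    two P's followed by two Q's, makes two of the edges agree at both ends. Alternating sides are
    the genuine 4-cycles excluded by \<open>A\<close> and \<open>B\<close>.\<close>
  show False using s1 s2 s3 s4 c A B N' by (smt (verit))
qed

text \<open>The triple (x, a, b) encodes the incidence of the point (x, ax + b) with the line y = ax
  + b. Points are numbered in base p below p^2, lines in base p from p^2 on.\<close>

definition flag_point :: "nat \<Rightarrow> nat \<times> nat \<times> nat \<Rightarrow> nat" where
  "flag_point p = (\<lambda>(x, a, b). (a * x + b) mod p + x * p)"

definition flag_line :: "nat \<Rightarrow> nat \<times> nat \<times> nat \<Rightarrow> nat" where
  "flag_line p = (\<lambda>(x, a, b). p * p + (b + a * p))"

lemma div_mod_unique: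
  fixes r p :: nat
  assumes "r < p" "r' < p" "r + q * p = r' + q' * p" shows "r = r'" "q = q'"
proof -
  have "r = (r + q * p) mod p" using assms(1) by simp
  also have "\<dots> = (r' + q' * p) mod p" by (simp only: assms(3))
  also have "\<dots> = r'" using assms(2) by simp
  finally show "r = r'" .
  then show "q = q'" using assms by auto
qed

lemma digits_less:
  fixes r p :: nat
  assumes "r < p" "q < p" shows "r + q * p < p * p"
proof -
  have "r + q * p < p + q * p" using assms by simp
  also have "\<dots> = Suc q * p" by simp
  also have "\<dots> \<le> p * p" using assms by (intro mult_right_mono) auto
  finally show ?thesis .
qed

text \<open>Subtracting the two congruences gives (a - a')(x - x') = 0 modulo p, and p is prime;
  equal slopes then force equal intercepts.\<close>

lemma lines_meet_once:
  fixes p a a' b b' x x' :: nat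
  assumes p: "prime p" and lt: "a < p" "a' < p" "b < p" "b' < p" "x < p" "x' < p"
    and eq: "(a * x + b) mod p = (a' * x + b') mod p" "(a * x' + b) mod p = (a' * x' + b') mod p"
  shows "(a = a' \<and> b = b') \<or> x = x'"
proof -
  have 1: "[int (a * x + b) = int (a' * x + b')] (mod int p)" "[int (a * x' + b) = int (a' * x' + b')] (mod int p)"
    using eq unfolding cong_int_iff by (simp_all add: cong_def)
  have "int p dvd (int (a * x + b) - int (a' * x + b')) - (int (a * x' + b) - int (a' * x' + b'))"
    using dvd_diff[OF 1[unfolded cong_iff_dvd_diff]] .
  also have "\<dots> = (int a - int a') * (int x - int x')" by (simp add: algebra_simps)
  finally have "int p dvd int a - int a' \<or> int p dvd int x - int x'"
    using p by (simp add: prime_dvd_mult_iff)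
  moreover have eqI: "u = w" if "int p dvd int u - int w" "u < p" "w < p" for u w
    using that by (metis cong_iff_dvd_diff cong_int_iff cong_less_modulus_unique_nat)
  moreover have "b = b'" if "a = a'"
  proof (rule eqI)
    show "int p dvd int b - int b'" using 1(1) that by (simp add: cong_iff_dvd_diff)
  qed (use lt in auto)
  ultimately show ?thesis using lt by blast
qed

lemma card_two_classes: "c \<noteq> d \<Longrightarrow> card {v::nat. v div 3 = c \<or> v div 3 = d} = 6"
proof -
  assume cd: "c \<noteq> d"
  have *: "{v::nat. v div 3 = c} = {3 * c..<3 * c + 3}" for c by auto
  have "{v::nat. v div 3 = c \<or> v div 3 = d} = {3 * c..<3 * c + 3} \<union> {3 * d..<3 * d + 3}"
    using * by blast
  moreover have "card ({3 * c..<3 * c + 3} \<union> {3 * d..<3 * d + 3}) = 6"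
    using cd by (subst card_Un_disjoint) auto
  ultimately show ?thesis by simp
qed

text \<open>There are 2 p^2 points and lines, each tripled, and p^3 incidences, each giving a
  hyperedge of size 6 that contributes 3.\<close>

lemma affine_plane_hypergraph:
  assumes p: "prime p" and n: "6 * p\<^sup>2 \<le> n"
  shows "\<exists>H. hypergraph_on n H \<and> \<not> has_berge_C4 H \<and> excess H = 3 * real p ^ 3"
proof -
  define ts where "ts = List.product [0..<p] (List.product [0..<p] [0..<p])"
  have ts: "(x, a, b) \<in> set ts \<longleftrightarrow> x < p \<and> a < p \<and> b < p" for x a b by (auto simp: ts_def)
  have dist: "distinct ts" by (auto simp: ts_def intro!: distinct_product)
  have len: "length ts = p * (p * p)" by (simp add: ts_def)
  define H where "H = map (\<lambda>t. {v. v div 3 = flag_point p t \<or> v div 3 = flag_line p t}) ts"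
  have p0: "p > 0" using p prime_gt_0_nat by simp
  have pl: "flag_point p t < p * p" "p * p \<le> flag_line p t" "flag_line p t < 2 * (p * p)" if "t \<in> set ts" for t
  proof -
    obtain x a b where t: "t = (x, a, b)" by (cases t) auto
    then have "x < p" "a < p" "b < p" using that ts by auto
    then have "(a * x + b) mod p + x * p < p * p" "b + a * p < p * p" using p0 by (simp_all add: digits_less)
    then show "flag_point p t < p * p" "p * p \<le> flag_line p t" "flag_line p t < 2 * (p * p)"
      by (simp_all add: t flag_point_def flag_line_def)
  qed
  have PQ: "flag_point p s \<noteq> flag_line p t" if "s \<in> set ts" "t \<in> set ts" for s t
    using pl(1)[OF that(1)] pl(2)[OF that(2)] by simp
  have P: "x = x' \<and> (a * x + b) mod p = (a' * x + b') mod p" if "flag_point p (x, a, b) = flag_point p (x', a', b')"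
    for x a b x' a' b'
    using div_mod_unique[of "(a * x + b) mod p" p "(a' * x' + b') mod p" x x'] that p0
    by (auto simp: flag_point_def)
  have Q: "a = a' \<and> b = b'" if "flag_line p (x, a, b) = flag_line p (x', a', b')" "b < p" "b' < p"
    for x a b x' a' b'
    using div_mod_unique[of b p b' a a'] that by (auto simp: flag_line_def)
  have "\<not> has_berge_C4 H" unfolding H_def
  proof (rule blowup_C4_free[OF dist PQ])
    fix s t assume st: "s \<in> set ts" "t \<in> set ts" "flag_point p s = flag_point p t" "flag_line p s = flag_line p t"
    obtain x a b x' a' b' where [simp]: "s = (x, a, b)" "t = (x', a', b')" by (cases s, cases t) auto
    show "s = t" using st P[of x a b x' a' b'] Q[of x a b x' a' b'] by (auto simp: ts)
  next
    fix s t u w assume m: "{s, t, u, w} \<subseteq> set ts" and e: "flag_point p s = flag_point p t" "flag_line p t = flag_line p u"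
      "flag_point p u = flag_point p w" "flag_line p w = flag_line p s"
    obtain x1 a1 b1 x2 a2 b2 x3 a3 b3 x4 a4 b4 where [simp]: "s = (x1, a1, b1)" "t = (x2, a2, b2)" "u = (x3, a3, b3)" "w = (x4, a4, b4)"
      by (cases s, cases t, cases u, cases w) auto
    have lt: "x1 < p" "a1 < p" "b1 < p" "x2 < p" "a2 < p" "b2 < p" "x3 < p" "a3 < p" "b3 < p" "x4 < p" "a4 < p" "b4 < p"
      using m by (auto simp: ts)
    have 1: "x1 = x2 \<and> (a1 * x1 + b1) mod p = (a2 * x1 + b2) mod p" using e(1) by (intro P) simp
    have 2: "a2 = a3 \<and> b2 = b3" using e(2) lt by (intro Q) auto
    have 3: "x3 = x4 \<and> (a3 * x3 + b3) mod p = (a4 * x3 + b4) mod p" using e(3) by (intro P) simp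
    have 4: "a4 = a1 \<and> b4 = b1" using e(4) lt by (intro Q) auto
    have "(a1 * x3 + b1) mod p = (a2 * x3 + b2) mod p" using 2 3 4 by metis
    \<comment> \<open>Two lines agreeing at the abscissas \<open>x1\<close> and \<open>x3\<close>
      coincide, giving s = t, unless these abscissas are equal, giving t = u.\<close>
    then have "(a1 = a2 \<and> b1 = b2) \<or> x1 = x3"
      using lt 1 by (intro lines_meet_once[OF p]) blast+
    then show "s = t \<or> t = u" using 1 2 by auto
  qed
  moreover have "hypergraph_on n H"
    unfolding hypergraph_on_def
  proof (intro ballI subsetI)
    fix h v assume "h \<in> set H" "v \<in> h"
    then obtain t where t: "t \<in> set ts" "v div 3 = flag_point p t \<or> v div 3 = flag_line p t" by (auto simp: H_def)
    then have "v div 3 < 2 * (p * p)" using pl[OF t(1)] by auto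
    then have "v < 6 * (p * p)" by auto
    then show "v \<in> {..<n}" using n by (simp add: power2_eq_square)
  qed
  moreover have "excess H = 3 * real p ^ 3"
  proof -
    have "excess H = (\<Sum>i<length ts. 3)"
      unfolding excess_def by (rule sum.cong) (use PQ in \<open>auto simp: H_def card_two_classes\<close>)
    then show ?thesis by (simp add: len power3_eq_cube)
  qed
  ultimately show ?thesis by blast
qed

lemma berge_C4_free_excess_lower:
  fixes \<epsilon> :: real assumes "\<epsilon> > 0"
  shows "\<exists>N. \<forall>n\<ge>N. \<exists>H. hypergraph_on n H \<and> \<not> has_berge_C4 H \<and>
            excess H \<ge> (1 - \<epsilon>) * (1 / (2 * sqrt 6)) * real n powr (3/2)"
proof -
  \<comment> \<open>A factor 1 - \<delta> is lost twice, to the floor of sqrt(n/6) and to the prime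
    below it, and the count is cubic in p: (1 - \<delta>)^6 \<ge> 1 - 6 \<delta> by
    Bernoulli.\<close>
  define \<delta> where "\<delta> = min \<epsilon> 1 / 6"
  have \<delta>: "0 < \<delta>" "\<delta> < 1" "6 * \<delta> \<le> \<epsilon>" using assms by (auto simp: \<delta>_def)
  obtain N where N: "\<And>x. x \<ge> N \<Longrightarrow> \<exists>p. prime p \<and> (1 - \<delta>) * real x \<le> real p \<and> p \<le> x"
    using primes_in_short_intervals[OF \<delta>(1,2)] by blast
  have "\<forall>\<^sub>F n in sequentially. \<delta> * sqrt (real n / 6) \<ge> 1" using \<delta> by real_asymp
  moreover have "\<forall>\<^sub>F n in sequentially. sqrt (real n / 6) \<ge> real N + 1" by real_asymp
  ultimately have "\<forall>\<^sub>F n in sequentially. \<exists>H. hypergraph_on n H \<and> \<not> has_berge_C4 H \<and>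
            excess H \<ge> (1 - \<epsilon>) * (1 / (2 * sqrt 6)) * real n powr (3/2)"
    using eventually_gt_at_top[of 0]
  proof eventually_elim
    case (elim n)
    define r where "r = sqrt (real n / 6)"
    have r: "r > 0" "r * r = real n / 6" using elim by (auto simp: r_def)
    define s where "s = nat \<lfloor>r\<rfloor>"
    have s: "real s \<le> r" "r < real s + 1" using r unfolding s_def by linarith+
    have "s \<ge> N" using elim(2) s unfolding r_def by linarith
    then obtain p where p: "prime p" "(1 - \<delta>) * real s \<le> real p" "p \<le> s" using N by blast
    have "real p \<le> r" using p(3) s(1) by linarith
    then have "real p * real p \<le> r * r" using r by (intro mult_mono) auto
    then have "real (6 * p\<^sup>2) \<le> real n" using r by (simp add: power2_eq_square)
    then have "6 * p\<^sup>2 \<le> n" by (simp only: of_nat_le_iff)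
    then obtain H where H: "hypergraph_on n H" "\<not> has_berge_C4 H" "excess H = 3 * real p ^ 3"
      using affine_plane_hypergraph[OF p(1)] by blast
    have "real s \<ge> (1 - \<delta>) * r" using s elim(1) by (simp add: r_def algebra_simps)
    then have "(1 - \<delta>) * ((1 - \<delta>) * r) \<le> (1 - \<delta>) * real s" using \<delta> by (intro mult_left_mono) auto
    then have "(1 - \<delta>)\<^sup>2 * r \<le> real p" using p(2) by (simp add: power2_eq_square)
    then have "((1 - \<delta>)\<^sup>2 * r) ^ 3 \<le> real p ^ 3" using r by (intro power_mono) auto
    then have "(1 - \<delta>) ^ 6 * r ^ 3 \<le> real p ^ 3" by (simp add: power_mult_distrib flip: power_mult)
    moreover have "1 - \<epsilon> \<le> (1 - \<delta>) ^ 6"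
      using Bernoulli_inequality[of "- \<delta>" 6] \<delta> by simp
    then have "(1 - \<epsilon>) * r ^ 3 \<le> (1 - \<delta>) ^ 6 * r ^ 3" using r by (intro mult_right_mono) auto
    ultimately have "3 * ((1 - \<epsilon>) * r ^ 3) \<le> excess H" using H(3) by simp
    moreover have "3 * r ^ 3 = 1 / (2 * sqrt 6) * real n powr (3/2)"
    proof -
      have "real n powr (3/2) = real n * sqrt (real n)"
        using elim powr_add[of "real n" 1 "1/2"] by (simp add: powr_half_sqrt)
      moreover have "r ^ 3 = (real n / 6) * (sqrt (real n) / sqrt 6)"
        using r by (simp add: power3_eq_cube r_def real_sqrt_divide)
      ultimately show ?thesis by simp
    qed
    then have "3 * ((1 - \<epsilon>) * r ^ 3) = (1 - \<epsilon>) * (1 / (2 * sqrt 6)) * real n powr (3/2)"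
      by (simp only: mult.left_commute[of 3] mult.assoc)
    ultimately show ?case using H by auto
  qed
  then show ?thesis by (simp add: eventually_sequentially)
qed

section \<open>The upper bound\<close>

definition P4_free_on :: "('a \<Rightarrow> 'a \<Rightarrow> bool) \<Rightarrow> 'a set \<Rightarrow> bool" where
  "P4_free_on W U \<longleftrightarrow> (\<forall>a\<in>U. \<forall>b\<in>U. \<forall>c\<in>U. \<forall>d\<in>U. distinct [a, b, c, d] \<longrightarrow> \<not> (W a b \<and> W b c \<and> W c d))"

text \<open>Ordered pairs, so the bounds by 6 below are twice the bounds by 3 for unordered
  pairs.\<close>

definition nonadj_pairs :: "('a \<Rightarrow> 'a \<Rightarrow> bool) \<Rightarrow> 'a set \<Rightarrow> ('a \<times> 'a) set" where
  "nonadj_pairs W U = {(x, y). x \<in> U \<and> y \<in> U \<and> x \<noteq> y \<and> \<not> W x y}"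

lemma P4_free_onD:
  "P4_free_on W U \<Longrightarrow> a \<in> U \<Longrightarrow> b \<in> U \<Longrightarrow> c \<in> U \<Longrightarrow> d \<in> U \<Longrightarrow> distinct [a, b, c, d] \<Longrightarrow>
    W a b \<Longrightarrow> W b c \<Longrightarrow> W c d \<Longrightarrow> False"
  unfolding P4_free_on_def by blast

lemma finite_nonadj_pairs: "finite U \<Longrightarrow> finite (nonadj_pairs W U)"
  by (rule finite_subset[of _ "U \<times> U"]) (auto simp: nonadj_pairs_def)

text \<open>Otherwise every vertex has two neighbours. Take x with neighbours y and z, and a further
  vertex p. An edge from p to y or z gives p-y-x-z or p-z-x-y; an edge p-x together with a second
  neighbour w of p gives w-p-x-y. So p misses x, y and z after all.\<close>

lemma P4_free_small_degree:
  assumes "finite U" "card U \<ge> 5" "symp W" "P4_free_on W U"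
  shows "\<exists>x\<in>U. card {y\<in>U. y \<noteq> x \<and> W x y} \<le> card U - 4"
proof (rule ccontr)
  assume contr: "\<not> ?thesis"
  have sym: "W a b \<longleftrightarrow> W b a" for a b using assms(3) by (meson sympD)
  define N where "N = (\<lambda>x. {y\<in>U. y \<noteq> x \<and> W x y})"
  have fN: "finite (N x)" for x using assms(1) by (simp add: N_def)
  have deg: "card (N x) > card U - 4" if "x \<in> U" for x using contr that by (auto simp: N_def)
  have two: "\<exists>y\<in>N x. y \<noteq> w" if "x \<in> U" for x w
  proof (rule ccontr)
    assume "\<not> ?thesis"
    then have "N x \<subseteq> {w}" by auto
    then have "card (N x) \<le> 1" using card_mono[of "{w}" "N x"] by simp
    then show False using deg[OF that] assms(2) by simp
  qed
  obtain x where x: "x \<in> U" using assms(2) by fastforce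
  obtain y where y: "y \<in> N x" using two x by blast
  obtain z where z: "z \<in> N x" "z \<noteq> y" using two x by blast
  have "card {x, y, z} \<le> 3" by (simp add: card_insert_if)
  then have "\<not> U \<subseteq> {x, y, z}" using card_mono[of "{x, y, z}" U] assms(2) by auto
  then obtain p where p: "p \<in> U" "p \<notin> {x, y, z}" by auto
  have yz: "y \<in> U" "z \<in> U" "y \<noteq> x" "z \<noteq> x" "W x y" "W x z" using y z by (auto simp: N_def)
  have py: "y \<notin> N p"
  proof
    assume "y \<in> N p"
    then have "W p y" by (simp add: N_def)
    then show False using P4_free_onD[OF assms(4), of p y x z] p x yz z sym by auto
  qed
  have pz: "z \<notin> N p"
  proof
    assume "z \<in> N p"
    then have "W p z" by (simp add: N_def)
    then show False using P4_free_onD[OF assms(4), of p z x y] p x yz z sym by auto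
  qed
  have px: "x \<notin> N p"
  proof
    assume "x \<in> N p"
    then have "W p x" by (simp add: N_def)
    moreover obtain w where "w \<in> N p" "w \<noteq> x" using two[OF p(1)] by blast
    moreover from this have "w \<in> U" "w \<noteq> p" "W p w" "w \<noteq> y" using py by (auto simp: N_def)
    ultimately show False using P4_free_onD[OF assms(4), of w p x y] p x yz sym by auto
  qed
  have "N p \<subseteq> U - {x, y, z, p}" using px py pz by (auto simp: N_def)
  then have "card (N p) \<le> card (U - {x, y, z, p})" using assms(1) by (intro card_mono) auto
  also have "\<dots> = card U - 4" using x yz z p assms(1) by (subst card_Diff_subset) auto
  finally show False using deg[OF p(1)] by simp
qed

text \<open>The six pairs split into three perfect matchings. If both pairs of one matching are
  adjacent, any further edge would complete a path, so the other four pairs are non-adjacent; if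
  this happens for no matching, each one contains a non-adjacent pair.\<close>

lemma P4_free_nonadj_pairs_4:
  assumes "card U = 4" "symp W" "P4_free_on W U"
  shows "card (nonadj_pairs W U) \<ge> 6"
proof -
  have fin: "finite U" using assms(1) by (metis card.infinite zero_neq_numeral)
  obtain p q r t where U: "U = {p, q, r, t}" and d: "distinct [p, q, r, t]"
    using assms(1) by (auto simp: card_Suc_eq numeral_eq_Suc)
  have d': "q \<noteq> p" "r \<noteq> p" "t \<noteq> p" "r \<noteq> q" "t \<noteq> q" "t \<noteq> r" using d by auto
  have sym: "W a b \<longleftrightarrow> W b a" for a b using assms(2) by (meson sympD)
  have P: "\<not> (W a b \<and> W b c \<and> W c e)" if "distinct [a, b, c, e]" "{a, b, c, e} \<subseteq> U" for a b c e
    using P4_free_onD[OF assms(3), of a b c e] that by auto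
  have "\<not> (W p q \<and> W r t \<and> W p r)" "\<not> (W p q \<and> W r t \<and> W q t)"
    "\<not> (W p q \<and> W r t \<and> W p t)" "\<not> (W p q \<and> W r t \<and> W q r)"
    using P[of q p r t] P[of p q t r] P[of q p t r] P[of p q r t] d d'
    by (auto simp: U sym[of q p] sym[of t r])
  then have m1: "W p q \<and> W r t \<Longrightarrow> \<not> W p r \<and> \<not> W q t \<and> \<not> W p t \<and> \<not> W q r" by blast
  have "\<not> (W p r \<and> W q t \<and> W p q)" "\<not> (W p r \<and> W q t \<and> W r t)"
    "\<not> (W p r \<and> W q t \<and> W p t)" "\<not> (W p r \<and> W q t \<and> W q r)"
    using P[of r p q t] P[of p r t q] P[of r p t q] P[of p r q t] d d'
    by (auto simp: U sym[of r p] sym[of t q] sym[of r q])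
  then have m2: "W p r \<and> W q t \<Longrightarrow> \<not> W p q \<and> \<not> W r t \<and> \<not> W p t \<and> \<not> W q r" by blast
  have "\<not> (W p t \<and> W q r \<and> W p q)" "\<not> (W p t \<and> W q r \<and> W r t)"
    "\<not> (W p t \<and> W q r \<and> W p r)" "\<not> (W p t \<and> W q r \<and> W q t)"
    using P[of t p q r] P[of p t r q] P[of t p r q] P[of p t q r] d d'
    by (auto simp: U sym[of t p] sym[of r q] sym[of t r] sym[of t q])
  then have m3: "W p t \<and> W q r \<Longrightarrow> \<not> W p q \<and> \<not> W r t \<and> \<not> W p r \<and> \<not> W q t" by blast
  have "card (nonadj_pairs W U) = (\<Sum>z\<in>U \<times> U. if z \<in> nonadj_pairs W U then 1 else 0)"
    using fin by (subst sum.If_cases) (auto simp: nonadj_pairs_def intro!: arg_cong[where f=card])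
  also have "\<dots> = (\<Sum>x\<in>U. \<Sum>y\<in>U. if x \<noteq> y \<and> \<not> W x y then 1 else 0)"
    unfolding sum.cartesian_product by (rule sum.cong) (auto simp: nonadj_pairs_def)
  also have "\<dots> = 2 * ((if W p q then 0 else 1) + (if W r t then 0 else 1) + (if W p r then 0 else 1)
     + (if W q t then 0 else 1) + (if W p t then 0 else 1) + (if W q r then 0 else 1))"
    using d d' unfolding U by (simp add: sym[of q p] sym[of t r] sym[of r p] sym[of t q] sym[of t p] sym[of r q])
  also have "\<dots> \<ge> 6"
  proof -
    consider "W p q \<and> W r t" | "W p r \<and> W q t" | "W p t \<and> W q r"
      | "\<not> (W p q \<and> W r t)" "\<not> (W p r \<and> W q t)" "\<not> (W p t \<and> W q r)" by blast
    then show ?thesis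
    proof cases
      case 1 then show ?thesis using m1[OF 1] by simp
    next
      case 2 then show ?thesis using m2[OF 2] by simp
    next
      case 3 then show ?thesis using m3[OF 3] by simp
    next
      case 4
      have "6 \<le> 2 * (a + b + c + d + e + f)" if "a + b \<ge> 1" "c + d \<ge> 1" "e + f \<ge> 1" for a b c d e f :: nat
        using that by simp
      then show ?thesis by this (use 4 in auto)
    qed
  qed
  finally show ?thesis .
qed

text \<open>Removing a vertex of degree at most |U| - 4 removes at least three non-neighbours, that
  is six ordered pairs.\<close>

lemma P4_free_nonadj_pairs:
  assumes "finite U" "symp W" "P4_free_on W U"
  shows "card (nonadj_pairs W U) \<ge> 6 * (card U - 3)"
  using assms(1,3)
proof (induction "card U" arbitrary: U rule: less_induct)
  case less
  consider "card U \<le> 3" | "card U = 4" | "card U \<ge> 5" by linarith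
  then show ?case
  proof cases
    case 2
    then show ?thesis using P4_free_nonadj_pairs_4[OF 2 assms(2) less.prems(2)] by simp
  next
    case 3
    then obtain x where x: "x \<in> U" "card {y\<in>U. y \<noteq> x \<and> W x y} \<le> card U - 4"
      using P4_free_small_degree[OF less.prems(1) 3 assms(2) less.prems(2)] by auto
    define V where "V = U - {x}"
    have cV: "card V = card U - 1" using x less.prems by (simp add: V_def)
    have "P4_free_on W V" using less.prems(2) unfolding P4_free_on_def V_def by blast
    then have IH: "6 * (card V - 3) \<le> card (nonadj_pairs W V)"
      using less.hyps[of V] less.prems cV 3 by (simp add: V_def)
    define A where "A = {y\<in>V. \<not> W x y}"
    have fin: "finite A" "finite V" "finite (nonadj_pairs W V)"
      using less.prems by (auto simp: A_def V_def finite_nonadj_pairs)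
    have "card {y\<in>U. y \<noteq> x \<and> W x y} + card A = card V"
    proof -
      have "V = {y\<in>U. y \<noteq> x \<and> W x y} \<union> A" by (auto simp: A_def V_def)
      then show ?thesis using less.prems fin
        by (subst card_Un_disjoint[symmetric]) (auto simp: A_def)
    qed
    then have cA: "card A \<ge> 3" using x(2) cV 3 by linarith
    have "nonadj_pairs W V \<union> (Pair x ` A \<union> (\<lambda>y. (y, x)) ` A) \<subseteq> nonadj_pairs W U"
      using x(1) assms(2) by (auto simp: nonadj_pairs_def V_def A_def dest: sympD)
    then have "card (nonadj_pairs W V \<union> (Pair x ` A \<union> (\<lambda>y. (y, x)) ` A)) \<le> card (nonadj_pairs W U)"
      using less.prems by (intro card_mono finite_nonadj_pairs)
    moreover have "card (nonadj_pairs W V \<union> (Pair x ` A \<union> (\<lambda>y. (y, x)) ` A))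
        = card (nonadj_pairs W V) + (card A + card A)"
      using fin by (subst card_Un_disjoint, simp, simp, force simp: nonadj_pairs_def V_def,
          subst card_Un_disjoint) (auto simp: A_def V_def card_image inj_on_def)
    ultimately show ?thesis using IH cA cV 3 by linarith
  qed simp
qed

text \<open>A largest symmetric set of non-adjacent pairs with all degrees at most 6: vertices of degree 6
  contribute 6 each, and on the remaining vertices all non-adjacent pairs were taken.\<close>
lemma bounded_degree_nonadj_pairs:
  assumes "finite h" "symp W" "P4_free_on W h"
  shows "\<exists>L. L \<subseteq> nonadj_pairs W h \<and> sym L \<and> (\<forall>x. card (L `` {x}) \<le> 6) \<and> card L \<ge> 6 * (card h - 3)"
proof -
  define P where "P = (\<lambda>L. L \<subseteq> nonadj_pairs W h \<and> sym L \<and> (\<forall>x. card (L `` {x}) \<le> 6))"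
  have finp: "finite (nonadj_pairs W h)" by (rule finite_nonadj_pairs[OF assms(1)])
  have "\<exists>L. P L \<and> (\<forall>L'. P L' \<longrightarrow> card L' \<le> card L)"
    by (rule ex_has_greatest_nat[of P "{}" card "Suc (card (nonadj_pairs W h))"])
       (auto simp: P_def sym_def less_Suc_eq_le intro: card_mono[OF finp])
  then obtain L where L: "L \<subseteq> nonadj_pairs W h" "sym L" "\<And>x. card (L `` {x}) \<le> 6"
    and maxi: "\<And>L'. P L' \<Longrightarrow> card L' \<le> card L" unfolding P_def by auto
  have finL: "finite L" using L(1) finp finite_subset by blast
  have finI: "finite (L `` {x})" for x using finL by (rule finite_Image)
  define U where "U = {x\<in>h. card (L `` {x}) < 6}"
  have finU: "finite U" using assms(1) by (simp add: U_def)
  have sub: "nonadj_pairs W U \<subseteq> L"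
  proof
    fix z assume "z \<in> nonadj_pairs W U"
    then obtain x y where z: "z = (x, y)" "x \<in> U" "y \<in> U" "x \<noteq> y" "\<not> W x y"
      by (auto simp: nonadj_pairs_def)
    show "z \<in> L"
    proof (rule ccontr)
      assume "z \<notin> L"
      define L' where "L' = insert (x, y) (insert (y, x) L)"
      have "P L'" unfolding P_def
      proof (intro conjI allI)
        show "L' \<subseteq> nonadj_pairs W h"
          using L(1) z assms(2) by (auto simp: L'_def nonadj_pairs_def U_def dest: sympD)
        show "sym L'" using L(2) unfolding L'_def sym_def by blast
        fix w
        have "L' `` {w} = (if w = x then insert y (L `` {x}) else if w = y then insert x (L `` {y}) else L `` {w})"
          using z(4) by (auto simp: L'_def)
        then show "card (L' `` {w}) \<le> 6" using z L(3)[of w] finI by (auto simp: U_def card_insert_if)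
      qed
      then have "card L' \<le> card L" by (rule maxi)
      moreover have "card L < card L'"
        using finL \<open>z \<notin> L\<close> z(1) by (intro psubset_card_mono) (auto simp: L'_def)
      ultimately show False by simp
    qed
  qed
  have cardL: "card L = (\<Sum>x\<in>h. card (L `` {x}))"
  proof -
    have "L = (SIGMA x:h. L `` {x})" using L(1) by (auto simp: nonadj_pairs_def)
    then have "card L = card (SIGMA x:h. L `` {x})" by simp
    also have "\<dots> = (\<Sum>x\<in>h. card (L `` {x}))" using assms(1) finI by simp
    finally show ?thesis .
  qed
  have "h = (h - U) \<union> U" by (auto simp: U_def)
  then have "card L = (\<Sum>x\<in>h - U. card (L `` {x})) + (\<Sum>x\<in>U. card (L `` {x}))"
    unfolding cardL using assms(1) finU by (subst sum.union_disjoint[symmetric]) auto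
  moreover have "(\<Sum>x\<in>h - U. card (L `` {x})) = 6 * (card h - card U)"
  proof -
    have "(\<Sum>x\<in>h - U. card (L `` {x})) = (\<Sum>x\<in>h - U. 6)"
      using L(3) by (intro sum.cong) (auto simp: U_def intro: antisym not_less[THEN iffD1])
    also have "\<dots> = 6 * (card h - card U)"
      using assms(1) finU by (simp add: card_Diff_subset U_def)
    finally show ?thesis .
  qed
  moreover have "card (nonadj_pairs W U) \<le> (\<Sum>x\<in>U. card (L `` {x}))"
  proof -
    have "nonadj_pairs W U \<subseteq> (SIGMA x:U. L `` {x})" using sub by (auto simp: nonadj_pairs_def)
    then have "card (nonadj_pairs W U) \<le> card (SIGMA x:U. L `` {x})"
      using finU finI by (intro card_mono) auto
    then show ?thesis using finU finI by simp
  qed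
  moreover have "P4_free_on W U" using assms(3) by (auto simp: P4_free_on_def U_def)
  then have "6 * (card U - 3) \<le> card (nonadj_pairs W U)"
    using finU assms(2) by (intro P4_free_nonadj_pairs)
  moreover have "card U \<le> card h" using assms(1) by (intro card_mono) (auto simp: U_def)
  ultimately have "card L \<ge> 6 * (card h - 3)" by linarith
  then show ?thesis using L by blast
qed

section \<open>Heavy and light pairs in a Berge-C4-free hypergraph\<close>

locale berge_C4_free =
  fixes n :: nat and H :: "nat set list"
  assumes on: "hypergraph_on n H" and free: "\<not> has_berge_C4 H"
begin

definition edges_at :: "nat \<Rightarrow> nat \<Rightarrow> nat set" where
  "edges_at x y = {i. i < length H \<and> x \<in> H ! i \<and> y \<in> H ! i}"

definition heavy :: "nat \<Rightarrow> nat \<Rightarrow> bool" where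
  "heavy x y \<longleftrightarrow> card (edges_at x y) \<ge> 4"

lemma finite_edges_at [simp]: "finite (edges_at x y)" by (simp add: edges_at_def)

lemma edges_at_commute: "edges_at x y = edges_at y x" by (auto simp: edges_at_def)

lemma edge_subset: "i < length H \<Longrightarrow> H ! i \<subseteq> {..<n}"
  using on by (auto simp: hypergraph_on_def)

lemma finite_edge: "i < length H \<Longrightarrow> finite (H ! i)"
  using edge_subset finite_subset by blast

lemma no_C4:
  assumes "distinct [a, b, c, d]" "distinct [i, j, k, l]"
    "i \<in> edges_at a b" "j \<in> edges_at b c" "k \<in> edges_at c d" "l \<in> edges_at d a"
  shows False
  using free assms unfolding has_berge_C4_def edges_at_def by blast

lemma symp_heavy: "symp heavy"
  by (auto simp: symp_def heavy_def edges_at_commute)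

lemma pick_edge:
  assumes "heavy x y" "finite F" "card F \<le> 3"
  shows "\<exists>i\<in>edges_at x y. i \<notin> F"
proof (rule ccontr)
  assume "\<not> ?thesis"
  then have "edges_at x y \<subseteq> F" by auto
  then have "card (edges_at x y) \<le> card F" using assms by (intro card_mono)
  then show False using assms by (simp add: heavy_def)
qed

lemma P4_free_heavy:
  assumes "i < length H" shows "P4_free_on heavy (H ! i)"
  unfolding P4_free_on_def
proof (intro ballI impI notI)
  fix a b c d assume v: "a \<in> H ! i" "b \<in> H ! i" "c \<in> H ! i" "d \<in> H ! i" "distinct [a, b, c, d]"
    and h: "heavy a b \<and> heavy b c \<and> heavy c d"
  have c: "card {x, y} \<le> 3" "card {x, y, z} \<le> 3" for x y z :: nat
    by (simp_all add: card_insert_if)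
  obtain i1 where i1: "i1 \<in> edges_at a b" "i1 \<notin> {i}" using pick_edge[of a b "{i}"] h by auto
  obtain i2 where i2: "i2 \<in> edges_at b c" "i2 \<notin> {i, i1}"
    using pick_edge[of b c "{i, i1}"] h c(1)[of i i1] by auto
  obtain i3 where i3: "i3 \<in> edges_at c d" "i3 \<notin> {i, i1, i2}"
    using pick_edge[of c d "{i, i1, i2}"] h c(2)[of i i1 i2] by auto
  have "i \<in> edges_at d a" using v assms by (simp add: edges_at_def)
  then show False using no_C4[OF v(5), of i1 i2 i3 i] i1 i2 i3 by auto
qed

end

text \<open>\<open>L i\<close> is the set of pairs coloured i, in both orders. Hyperedges with at
  most three vertices choose nothing, so wherever a colour occurs the hyperedge has size at least 4
  and its size is bounded linearly by \<open>card (L i)\<close>.\<close>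

locale berge_selection = berge_C4_free +
  fixes L :: "nat \<Rightarrow> (nat \<times> nat) set"
  assumes L_sub: "i < length H \<Longrightarrow> L i \<subseteq> nonadj_pairs heavy (H ! i)"
    and L_sym: "i < length H \<Longrightarrow> sym (L i)"
    and L_deg: "i < length H \<Longrightarrow> card (L i `` {x}) \<le> 6"
    and L_card: "i < length H \<Longrightarrow> card (L i) \<ge> 6 * (card (H ! i) - 3)"
    and L_empty: "i < length H \<Longrightarrow> card (H ! i) \<le> 3 \<Longrightarrow> L i = {}"
begin

abbreviation m where "m \<equiv> length H"

lemma L_commute: "i < m \<Longrightarrow> (x, y) \<in> L i \<longleftrightarrow> (y, x) \<in> L i"
  using L_sym by (meson symD)

lemma finite_L: "i < m \<Longrightarrow> finite (L i)"
  using L_sub finite_nonadj_pairs[OF finite_edge] finite_subset by metis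

lemma finite_L_Image: "i < m \<Longrightarrow> finite (L i `` A)"
  using finite_L by (rule finite_Image)

lemma L_D:
  assumes "i < m" "(x, y) \<in> L i"
  shows "x \<in> H ! i" "y \<in> H ! i" "x \<noteq> y" "i \<in> edges_at x y" "card (edges_at x y) \<le> 3" "x < n" "y < n"
proof -
  have "(x, y) \<in> nonadj_pairs heavy (H ! i)" using L_sub assms by blast
  then show a: "x \<in> H ! i" "y \<in> H ! i" "x \<noteq> y" "i \<in> edges_at x y" "card (edges_at x y) \<le> 3"
    using assms(1) by (auto simp: nonadj_pairs_def heavy_def edges_at_def)
  show "x < n" "y < n" using a edge_subset[OF assms(1)] by auto
qed

section \<open>Two-coloured paths of length two between given ends\<close>

definition cherries :: "nat \<Rightarrow> nat \<Rightarrow> (nat \<times> nat \<times> nat) set" where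
  "cherries a b = {(v, i, j). i < m \<and> j < m \<and> i \<noteq> j \<and> (a, v) \<in> L i \<and> (v, b) \<in> L j}"

definition total :: nat where "total = (\<Sum>i<m. card (L i))"

lemma cherries_conflict:
  assumes "a \<noteq> b" "(v, i, j) \<in> cherries a b" "(v', i', j') \<in> cherries a b" "v \<noteq> v'"
  shows "i = i' \<or> i = j' \<or> j = i' \<or> j = j'"
proof (rule ccontr)
  assume c: "\<not> ?thesis"
  have *: "i < m" "j < m" "i \<noteq> j" "(a, v) \<in> L i" "(v, b) \<in> L j" "i' < m" "j' < m" "i' \<noteq> j'" "(a, v') \<in> L i'" "(v', b) \<in> L j'"
    using assms by (auto simp: cherries_def)
  have e: "i \<in> edges_at a v" "j \<in> edges_at v b" "j' \<in> edges_at b v'" "i' \<in> edges_at v' a"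
    using L_D(4)[OF *(1,4)] L_D(4)[OF *(2,5)] L_D(4)[OF *(7,10)] L_D(4)[OF *(6,9)]
    by (auto simp: edges_at_def)
  have d: "a \<noteq> v" "v \<noteq> b" "b \<noteq> v'" "v' \<noteq> a" 
    using L_D(3)[OF *(1,4)] L_D(3)[OF *(2,5)] L_D(3)[OF *(7,10)] L_D(3)[OF *(6,9)] by auto
  show False using no_C4[OF _ _ e] d c * assms by auto
qed

lemma cherries_finite: "finite (cherries a b)"
proof (rule finite_subset)
  show "cherries a b \<subseteq> {..<n} \<times> {..<m} \<times> {..<m}" using L_D(7) by (auto simp: cherries_def)
qed auto

lemma cherries_same_mid:
  "finite {t\<in>cherries a b. fst t = v}" "card {t\<in>cherries a b. fst t = v} \<le> 9"
proof -
  show "finite {t\<in>cherries a b. fst t = v}" using cherries_finite by simp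
  show "card {t\<in>cherries a b. fst t = v} \<le> 9"
  proof (cases "{t\<in>cherries a b. fst t = v} = {}")
    case False
    then obtain i j where ij: "(v, i, j) \<in> cherries a b" by auto
    then have c: "card (edges_at a v) \<le> 3" "card (edges_at v b) \<le> 3" using L_D(5) by (auto simp: cherries_def)
    have "{t\<in>cherries a b. fst t = v} \<subseteq> {v} \<times> edges_at a v \<times> edges_at v b"
      using L_D(4) by (auto simp: cherries_def)
    then have "card {t\<in>cherries a b. fst t = v} \<le> card ({v} \<times> edges_at a v \<times> edges_at v b)"
      by (intro card_mono) auto
    also have "\<dots> \<le> 3 * 3" unfolding card_cartesian_product using mult_le_mono[OF c] by simp
    finally show ?thesis by simp
  qed (simp only: card.empty)
qed

text \<open>Fixing the first colour leaves at most 6 midpoints by the degree bound, and the light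
  second pair leaves at most 3 colours.\<close>

lemma cherries_fst_color:
  assumes "c < m" shows "card {t\<in>cherries a b. fst (snd t) = c} \<le> 18"
proof -
  define X where "X = {v\<in>L c `` {a}. card (edges_at v b) \<le> 3}"
  have "X \<subseteq> L c `` {a}" by (auto simp: X_def)
  then have X: "finite X" "card X \<le> 6"
    using finite_L_Image[OF assms, of "{a}"] L_deg[OF assms, of a] card_mono[of "L c `` {a}" X] finite_subset
    by auto
  have "{t\<in>cherries a b. fst (snd t) = c} \<subseteq> (\<lambda>(v, j). (v, c, j)) ` (SIGMA v:X. edges_at v b)"
    using L_D(4,5) by (fastforce simp: cherries_def X_def)
  then have "card {t\<in>cherries a b. fst (snd t) = c} \<le> card (SIGMA v:X. edges_at v b)"
    using X by (intro surj_card_le) auto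
  also have "\<dots> = (\<Sum>v\<in>X. card (edges_at v b))" using X by simp
  also have "\<dots> \<le> (\<Sum>v\<in>X. 3)" by (rule sum_mono) (simp add: X_def)
  also have "\<dots> \<le> 18" using X by simp
  finally show ?thesis .
qed

lemma cherries_snd_color:
  assumes "c < m" shows "card {t\<in>cherries a b. snd (snd t) = c} \<le> 18"
proof -
  have "{t\<in>cherries a b. snd (snd t) = c} = (\<lambda>(v, i, j). (v, j, i)) ` {t\<in>cherries b a. fst (snd t) = c}"
    by (force simp: cherries_def L_commute)
  then have "card {t\<in>cherries a b. snd (snd t) = c} \<le> card {t\<in>cherries b a. fst (snd t) = c}"
    using cherries_finite by (simp add: card_image_le)
  then show ?thesis using cherries_fst_color[OF assms, of b a] by simp
qed

text \<open>Fix one path. Every other has the same midpoint, at most 9 of them, or carries one of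
  the two fixed colours in first or second position, at most 4 * 18.\<close>

lemma card_cherries_le:
  assumes "a \<noteq> b" shows "card (cherries a b) \<le> 81"
proof (cases "cherries a b = {}")
  case False
  then obtain v i j where t: "(v, i, j) \<in> cherries a b" by auto
  then have ij: "i < m" "j < m" by (auto simp: cherries_def)
  let ?A = "{t\<in>cherries a b. fst t = v}"
  let ?B = "\<lambda>c. {t\<in>cherries a b. fst (snd t) = c}" and ?C = "\<lambda>c. {t\<in>cherries a b. snd (snd t) = c}"
  have "cherries a b = ?A \<union> (?B i \<union> (?B j \<union> (?C i \<union> ?C j)))"
  proof (intro equalityI subsetI)
    fix t' assume t': "t' \<in> cherries a b"
    obtain v' i' j' where [simp]: "t' = (v', i', j')" by (cases t') auto
    have "v = v' \<or> i = i' \<or> i = j' \<or> j = i' \<or> j = j'"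
      using cherries_conflict[OF assms t, of v' i' j'] t' by auto
    then show "t' \<in> ?A \<union> (?B i \<union> (?B j \<union> (?C i \<union> ?C j)))" using t' by auto
  qed auto
  then have "card (cherries a b) = card (?A \<union> (?B i \<union> (?B j \<union> (?C i \<union> ?C j))))" by simp
  also have "\<dots> \<le> card ?A + (card (?B i) + (card (?B j) + (card (?C i) + card (?C j))))"
    by (meson card_Un_le order_trans add_left_mono)
  also have "\<dots> \<le> 9 + (18 + (18 + (18 + 18)))"
    using cherries_same_mid cherries_fst_color cherries_snd_color ij by (intro add_mono) auto
  finally show ?thesis by simp
qed simp

text \<open>Paths with different midpoints must share a colour. The harmless way is to agree in both
  colours in order; any other coincidence makes the pair of ends exceptional.\<close>

definition exceptional :: "(nat \<times> nat) set" where
  "exceptional = {(a, b). a \<noteq> b \<and> (\<exists>v i j v' i' j'. (v, i, j) \<in> cherries a b \<and> (v', i', j') \<in> cherries a b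
      \<and> v \<noteq> v' \<and> (i, j) \<noteq> (i', j'))}"

text \<open>If two midpoints occur, every path differs in midpoint from one of two fixed paths, so
  all paths carry the same two colours in the same order and the degree bound leaves at most 6.
  Otherwise there is a single midpoint.\<close>

lemma card_cherries_unexceptional:
  assumes "a \<noteq> b" "(a, b) \<notin> exceptional" shows "card (cherries a b) \<le> 9"
proof (cases "\<exists>v. \<forall>t\<in>cherries a b. fst t = v")
  case True
  then obtain v where "\<forall>t\<in>cherries a b. fst t = v" by auto
  then have "cherries a b = {t\<in>cherries a b. fst t = v}" by auto
  then show ?thesis using cherries_same_mid(2) by metis
next
  case False
  then obtain v i j v' i' j' where t: "(v, i, j) \<in> cherries a b" "(v', i', j') \<in> cherries a b" "v \<noteq> v'"
    by (metis prod.collapse)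
  have u: "(i1, j1) = (i2, j2)" if "(v1, i1, j1) \<in> cherries a b" "(v2, i2, j2) \<in> cherries a b" "v1 \<noteq> v2"
    for v1 i1 j1 v2 i2 j2 using assms that unfolding exceptional_def by blast
  have "cherries a b \<subseteq> (\<lambda>x. (x, i, j)) ` (L i `` {a})"
  proof
    fix t assume t': "t \<in> cherries a b"
    obtain x k l where "t = (x, k, l)" by (cases t) auto
    moreover from this have "(k, l) = (i, j)" using u t t' by (metis prod.inject)
    ultimately show "t \<in> (\<lambda>x. (x, i, j)) ` (L i `` {a})" using t' by (auto simp: cherries_def)
  qed
  then have "card (cherries a b) \<le> card (L i `` {a})"
    using t finite_L_Image by (intro surj_card_le) (auto simp: cherries_def)
  also have "\<dots> \<le> 6" using t L_deg by (auto simp: cherries_def)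
  finally show ?thesis by simp
qed

section \<open>Exceptional pairs are few\<close>

definition shared :: "nat \<Rightarrow> (nat \<times> nat) set" where
  "shared i = {(x, y). x \<in> H ! i \<and> y \<in> H ! i \<and> (\<exists>j<m. j \<noteq> i \<and> (x, y) \<in> L j)}"

lemma shared_commute: "(x, y) \<in> shared i \<longleftrightarrow> (y, x) \<in> shared i"
  using L_commute by (auto simp: shared_def)

lemma finite_shared: "i < m \<Longrightarrow> finite (shared i)"
  by (rule finite_subset[of _ "H ! i \<times> H ! i"]) (auto simp: shared_def finite_edge)

text \<open>If both ends of a shared pair had 15 shared neighbours, it would extend to a rainbow path of
  length three, which hyperedge i closes to a Berge-C4.\<close>
lemma shared_small_end:
  assumes i: "i < m" and xy: "(x, y) \<in> shared i"
  shows "card (shared i `` {x}) \<le> 14 \<or> card (shared i `` {y}) \<le> 14"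
proof (rule ccontr)
  assume "\<not> ?thesis"
  then have big: "card (shared i `` {x}) \<ge> 15" "card (shared i `` {y}) \<ge> 15" by auto
  have pick: "\<exists>w\<in>A. w \<notin> F" if "card A \<ge> 15" "finite F" "card F \<le> 14" for A F :: "nat set"
  proof (rule ccontr)
    assume "\<not> ?thesis"
    then have "A \<subseteq> F" by auto
    then show False using card_mono[OF that(2), of A] that by linarith
  qed
  obtain c where c: "c < m" "c \<noteq> i" "(x, y) \<in> L c" using xy by (auto simp: shared_def)
  have "card (L c `` {x} \<union> {y}) \<le> 6 + 1"
    using card_Un_le[of "L c `` {x}" "{y}"] L_deg[OF c(1), of x] by simp
  then obtain x' where x': "x' \<in> shared i `` {x}" "x' \<notin> L c `` {x} \<union> {y}"
    using pick[OF big(1), of "L c `` {x} \<union> {y}"] finite_L_Image[OF c(1)] by auto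
  then obtain c' where c': "c' < m" "c' \<noteq> i" "(x, x') \<in> L c'" by (auto simp: shared_def)
  \<comment> \<open>The continuation at y must avoid the neighbours in colours c and c', which makes
    its own colour new, and the vertices x and x'. These 14 forbidden vertices explain the threshold
    15.\<close>
  have "card (L c `` {y} \<union> L c' `` {y} \<union> {x, x'}) \<le> 6 + 6 + 2"
    using card_Un_le[of "L c `` {y} \<union> L c' `` {y}" "{x, x'}"] card_Un_le[of "L c `` {y}" "L c' `` {y}"]
      L_deg[OF c(1), of y] L_deg[OF c'(1), of y] card_insert_le_m1[of 2 "{x'}" x] by simp
  then obtain y' where y': "y' \<in> shared i `` {y}" "y' \<notin> L c `` {y} \<union> L c' `` {y} \<union> {x, x'}"
    using pick[OF big(2), of "L c `` {y} \<union> L c' `` {y} \<union> {x, x'}"] finite_L_Image[OF c(1)] finite_L_Image[OF c'(1)] by auto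
  then obtain c'' where c'': "c'' < m" "c'' \<noteq> i" "(y, y') \<in> L c''" by (auto simp: shared_def)
  have d: "c \<noteq> c'" "c'' \<noteq> c" "c'' \<noteq> c'" using x' y' c' c'' by auto
  have "c' \<in> edges_at x' x" "c \<in> edges_at x y" "c'' \<in> edges_at y y'" "i \<in> edges_at y' x'"
    using c c' c'' L_D x' y' i by (auto simp: edges_at_def shared_def)
  moreover have "distinct [x', x, y, y']" using x' y' L_D(3)[OF c(1,3)] L_D(3)[OF c'(1,3)] L_D(3)[OF c''(1,3)] by auto
  ultimately show False using no_C4[of x' x y y' c' c c'' i] d c c' c'' by auto
qed

text \<open>Every shared pair is charged to an end with at most 14 shared neighbours, in either
  order of the pair: 28 = 2 * 14.\<close>

lemma card_shared_le:
  assumes i: "i < m" shows "card (shared i) \<le> 28 * card (H ! i)"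
proof -
  define S where "S = {x\<in>H ! i. card (shared i `` {x}) \<le> 14}"
  have S: "finite S" "card S \<le> card (H ! i)" using finite_edge[OF i] by (auto simp: S_def intro: card_mono)
  have fin: "finite (shared i `` {x})" for x using finite_shared[OF i] by (rule finite_Image)
  define B where "B = (SIGMA x:S. shared i `` {x})"
  have "card B = (\<Sum>x\<in>S. card (shared i `` {x}))" unfolding B_def using S fin by simp
  also have "\<dots> \<le> (\<Sum>x\<in>S. 14)" by (rule sum_mono) (simp add: S_def)
  finally have B: "card B \<le> 14 * card (H ! i)" using S by simp
  have finB: "finite B" unfolding B_def using S fin by auto
  have "shared i \<subseteq> B \<union> prod.swap ` B"
  proof
    fix z assume z: "z \<in> shared i"
    obtain x y where [simp]: "z = (x, y)" by (cases z)
    have "x \<in> H ! i" "y \<in> H ! i" using z by (auto simp: shared_def)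
    then have "x \<in> S \<or> y \<in> S" using shared_small_end[OF i, of x y] z by (auto simp: S_def)
    then show "z \<in> B \<union> prod.swap ` B"
      using z shared_commute[of x y i] by (force simp: B_def image_iff)
  qed
  then have "card (shared i) \<le> card (B \<union> prod.swap ` B)" using finB by (intro card_mono) auto
  also have "\<dots> \<le> card B + card (prod.swap ` B)" by (rule card_Un_le)
  also have "card (prod.swap ` B) \<le> card B" using finB by (rule card_image_le)
  finally show ?thesis using B by simp
qed

text \<open>Paths a-v-b and a-v'-b with the same colour at a: v and v' are neighbours of a in colour
  i, and b is the midpoint of a two-coloured path from v to v'. Here p is (a, v).\<close>

definition exc1 :: "(nat \<times> nat) set" where
  "exc1 = (\<Union>i<m. \<Union>p\<in>L i. \<Union>v'\<in>L i `` {fst p} - {snd p}. (\<lambda>t. (fst p, fst t)) ` cherries (snd p) v')"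

text \<open>One colour i occurs at a in the first path and at b in the second. Then v and b lie in
  hyperedge i, although the pair (v, b) has another colour; here p is (v, b). The guard on
  \<open>L i\<close> lets the index set be counted against \<open>card (L i)\<close>.\<close>

definition exc2 :: "(nat \<times> nat) set" where
  "exc2 = (\<Union>i<m. \<Union>p\<in>(if L i = {} then {} else shared i). (\<lambda>a. (a, snd p)) ` (L i `` {fst p}))"

text \<open>A common colour can sit at a in both paths, at b in both, or at different ends; equal
  positions lead to \<open>exc1\<close>, crossed ones to \<open>exc2\<close>, and the images under
  \<open>prod.swap\<close> cover the cases with a and b exchanged.\<close>

lemma exceptional_subset: "exceptional \<subseteq> (exc1 \<union> prod.swap ` exc1) \<union> (exc2 \<union> prod.swap ` exc2)"
proof
  fix z assume "z \<in> exceptional"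
  then obtain a b v i j v' i' j' where z: "z = (a, b)" "a \<noteq> b" and t: "(v, i, j) \<in> cherries a b" "(v', i', j') \<in> cherries a b"
      and ne: "v \<noteq> v'" "(i, j) \<noteq> (i', j')" unfolding exceptional_def by blast
  have *: "i < m" "j < m" "i \<noteq> j" "(a, v) \<in> L i" "(v, b) \<in> L j" "i' < m" "j' < m" "i' \<noteq> j'" "(a, v') \<in> L i'" "(v', b) \<in> L j'"
    using t by (auto simp: cherries_def)
  have s: "(v, a) \<in> L i" "(b, v) \<in> L j" "(v', a) \<in> L i'" "(b, v') \<in> L j'" using * L_commute by blast+
  have in1: "(x, y) \<in> exc1" if "k < m" "(x, u) \<in> L k" "(x, u') \<in> L k" "u \<noteq> u'" "(y, k1, k2) \<in> cherries u u'"
    for x y u u' k k1 k2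
    unfolding exc1_def using that by (intro UN_I[of k] UN_I[of "(x, u)"] UN_I[of u'] image_eqI[of _ _ "(y, k1, k2)"]) auto
  have in2: "(x, y) \<in> exc2" if "k < m" "(u, y) \<in> shared k" "(u, x) \<in> L k" for x y u k
    unfolding exc2_def using that by (intro UN_I[of k] UN_I[of "(u, y)"] image_eqI[of _ _ x]) auto
  have swap: "z \<in> prod.swap ` X" if "(b, a) \<in> X" for X using that z by (force simp: image_iff)
  consider "i = i'" "j \<noteq> j'" | "j = j'" "i \<noteq> i'" | "i = j'" | "j = i'"
    using cherries_conflict[OF z(2) t ne(1)] ne by auto
  then show "z \<in> (exc1 \<union> prod.swap ` exc1) \<union> (exc2 \<union> prod.swap ` exc2)"
  proof cases
    case 1
    have "(b, j, j') \<in> cherries v v'" using * s 1 by (auto simp: cherries_def)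
    then have "(a, b) \<in> exc1" using in1[of i a v v'] * 1 ne by auto
    then show ?thesis using z by simp
  next
    case 2
    have "(a, i, i') \<in> cherries v v'" using * s 2 by (auto simp: cherries_def)
    then have "(b, a) \<in> exc1" using in1[of j b v v'] * s 2 ne by auto
    then show ?thesis using swap by blast
  next
    case 3
    have "(v, b) \<in> shared i" using * 3 L_D(1)[of i v a] L_D(2)[of i v' b] s by (auto simp: shared_def)
    then have "(a, b) \<in> exc2" using in2[of i v b a] * s by auto
    then show ?thesis using z by simp
  next
    case 4
    have "(v, a) \<in> shared j" using * 4 L_D(1)[of j v b] L_D(1)[of j a v'] s by (auto simp: shared_def)
    then have "(b, a) \<in> exc2" using in2[of j v a b] * s by auto
    then show ?thesis using swap by blast
  qed
qed

lemma card_exc1: "finite exc1" "card exc1 \<le> 486 * total"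
proof -
  let ?C = "\<lambda>i p v'. (\<lambda>t. (fst p, fst t)) ` cherries (snd p) v'"
  show "finite exc1" unfolding exc1_def using finite_L finite_L_Image cherries_finite by auto
  \<comment> \<open>486 = 6 * 81: at most six choices of v', with at most 81 paths for each.\<close>
  have 1: "card (\<Union>v'\<in>L i `` {fst p} - {snd p}. ?C i p v') \<le> 486" if i: "i < m" for i p
  proof -
    have "card (\<Union>v'\<in>L i `` {fst p} - {snd p}. ?C i p v') \<le> (\<Sum>v'\<in>L i `` {fst p} - {snd p}. card (?C i p v'))"
      using finite_L_Image[OF i] by (intro card_UN_le) auto
    also have "\<dots> \<le> (\<Sum>v'\<in>L i `` {fst p} - {snd p}. 81)"
    proof (rule sum_mono)
      fix v' assume "v' \<in> L i `` {fst p} - {snd p}"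
      then have "card (cherries (snd p) v') \<le> 81" by (intro card_cherries_le) auto
      then show "card (?C i p v') \<le> 81" using card_image_le[OF cherries_finite] order_trans by blast
    qed
    also have "\<dots> \<le> 486"
      using L_deg[OF i, of "fst p"] card_mono[of "L i `` {fst p}" "L i `` {fst p} - {snd p}"] finite_L_Image[OF i] by auto
    finally show ?thesis .
  qed
  have "card exc1 \<le> (\<Sum>i<m. card (\<Union>p\<in>L i. \<Union>v'\<in>L i `` {fst p} - {snd p}. ?C i p v'))"
    unfolding exc1_def by (rule card_UN_le) simp
  also have "\<dots> \<le> (\<Sum>i<m. \<Sum>p\<in>L i. card (\<Union>v'\<in>L i `` {fst p} - {snd p}. ?C i p v'))"
    using finite_L by (intro sum_mono card_UN_le) auto
  also have "\<dots> \<le> (\<Sum>i<m. \<Sum>p\<in>L i. 486)" using 1 by (intro sum_mono) auto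
  finally show "card exc1 \<le> 486 * total" by (simp add: total_def mult.commute flip: sum_distrib_right)
qed

lemma card_exc2: "finite exc2" "card exc2 \<le> 112 * total"
proof -
  let ?S = "\<lambda>i. if L i = {} then {} else shared i"
  show "finite exc2" unfolding exc2_def using finite_shared finite_L_Image by auto
  \<comment> \<open>For |h| \<ge> 4 one has |h| \<le> 4(|h| - 3) \<le> (4/6)
    \<open>card (L i)\<close>, so 6 * 28 |h| is at most 112 \<open>card (L i)\<close>.\<close>
  have 1: "6 * card (?S i) \<le> 112 * card (L i)" if i: "i < m" for i
  proof (cases "L i = {}")
    case False
    then have "\<not> card (H ! i) \<le> 3" using L_empty[OF i] by blast
    then show ?thesis using card_shared_le[OF i] L_card[OF i] False by simp
  qed simp
  have "card exc2 \<le> (\<Sum>i<m. card (\<Union>p\<in>?S i. (\<lambda>a. (a, snd p)) ` (L i `` {fst p})))"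
    unfolding exc2_def by (rule card_UN_le) simp
  also have "\<dots> \<le> (\<Sum>i<m. \<Sum>p\<in>?S i. card ((\<lambda>a. (a, snd p)) ` (L i `` {fst p})))"
    using finite_shared by (intro sum_mono card_UN_le) auto
  also have "\<dots> \<le> (\<Sum>i<m. \<Sum>p\<in>?S i. 6)"
  proof (intro sum_mono)
    fix i p assume "i \<in> {..<m}"
    then have i: "i < m" by simp
    show "card ((\<lambda>a. (a, snd p)) ` (L i `` {fst p})) \<le> 6"
      using card_image_le[OF finite_L_Image[OF i]] L_deg[OF i] order_trans by blast
  qed
  also have "\<dots> = (\<Sum>i<m. 6 * card (?S i))" by (simp only: sum_constant mult.commute of_nat_id)
  also have "\<dots> \<le> (\<Sum>i<m. 112 * card (L i))" using 1 by (intro sum_mono) auto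
  finally show "card exc2 \<le> 112 * total" by (simp add: total_def sum_distrib_left)
qed

lemma card_exceptional: "finite exceptional" "card exceptional \<le> 1196 * total"
proof -
  show "finite exceptional"
    using finite_subset[OF exceptional_subset] card_exc1(1) card_exc2(1) by simp
  have "card exceptional \<le> card ((exc1 \<union> prod.swap ` exc1) \<union> (exc2 \<union> prod.swap ` exc2))"
    using card_exc1(1) card_exc2(1) by (intro card_mono exceptional_subset) simp
  also have "\<dots> \<le> (card exc1 + card (prod.swap ` exc1)) + (card exc2 + card (prod.swap ` exc2))"
    by (meson add_mono card_Un_le order_trans)
  also have "\<dots> \<le> (card exc1 + card exc1) + (card exc2 + card exc2)"
    using card_exc1(1) card_exc2(1) by (intro add_mono card_image_le) auto
  finally show "card exceptional \<le> 1196 * total" using card_exc1(2) card_exc2(2) by simp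
qed

section \<open>Counting paths by their midpoint\<close>

definition star :: "nat \<Rightarrow> (nat \<times> nat) set" where
  "star v = {(i, a). i < m \<and> (v, a) \<in> L i}"

lemma finite_star: "finite (star v)"
  by (rule finite_subset[of _ "{..<m} \<times> {..<n}"]) (auto simp: star_def dest: L_D)

lemma sum_card_star: "(\<Sum>v<n. card (star v)) = total"
proof -
  have "(\<Sum>v<n. card (star v)) = card (SIGMA v:{..<n}. star v)" using finite_star by simp
  also have "\<dots> = card (SIGMA i:{..<m}. L i)"
    by (rule bij_betw_same_card[of "\<lambda>(v, i, a). (i, v, a)"], rule bij_betw_byWitness[where f'="\<lambda>(i, v, a). (v, i, a)"])
       (auto simp: star_def dest: L_D)
  also have "\<dots> = total" using finite_L by (simp add: total_def)
  finally show ?thesis .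
qed

text \<open>For a fixed coloured edge at v, at most 6 others repeat its colour and at most 3 repeat
  its other end; each bound includes the edge itself.\<close>

lemma card_star_square:
  "card (star v) * card (star v) \<le> 9 * card (star v)
     + (\<Sum>p\<in>star v. card {q\<in>star v. fst q \<noteq> fst p \<and> snd q \<noteq> snd p})"
proof -
  have "card (star v) \<le> 9 + card {q\<in>star v. fst q \<noteq> fst p \<and> snd q \<noteq> snd p}" if p: "p \<in> star v" for p
  proof -
    obtain i a where [simp]: "p = (i, a)" by (cases p)
    have ia: "i < m" "(v, a) \<in> L i" using p by (auto simp: star_def)
    have "star v \<subseteq> Pair i ` (L i `` {v}) \<union> ((\<lambda>j. (j, a)) ` edges_at v a \<union> {q\<in>star v. fst q \<noteq> fst p \<and> snd q \<noteq> snd p})"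
      using L_D(4) by (auto simp: star_def)
    then have "card (star v) \<le> card (Pair i ` (L i `` {v}) \<union> ((\<lambda>j. (j, a)) ` edges_at v a \<union> {q\<in>star v. fst q \<noteq> fst p \<and> snd q \<noteq> snd p}))"
      using finite_L_Image[OF ia(1)] finite_star by (intro card_mono) auto
    also have "\<dots> \<le> card (Pair i ` (L i `` {v})) + (card ((\<lambda>j. (j, a)) ` edges_at v a) + card {q\<in>star v. fst q \<noteq> fst p \<and> snd q \<noteq> snd p})"
      by (meson add_left_mono card_Un_le order_trans)
    also have "\<dots> \<le> 6 + (3 + card {q\<in>star v. fst q \<noteq> fst p \<and> snd q \<noteq> snd p})"
      using L_deg[OF ia(1), of v] L_D(5)[OF ia] by (simp add: card_image inj_on_def)
    finally show ?thesis by simp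
  qed
  then have "(\<Sum>p\<in>star v. card (star v)) \<le> (\<Sum>p\<in>star v. 9 + card {q\<in>star v. fst q \<noteq> fst p \<and> snd q \<noteq> snd p})"
    by (intro sum_mono)
  then show ?thesis by (simp add: sum.distrib mult.commute)
qed

text \<open>Double counting: the same paths sorted by their ends (a, b), with 9 for every pair and a
  surplus of 81 for each exceptional one.\<close>

lemma sum_rainbow_cherries:
  "(\<Sum>v<n. \<Sum>p\<in>star v. card {q\<in>star v. fst q \<noteq> fst p \<and> snd q \<noteq> snd p}) \<le> 9 * n\<^sup>2 + 81 * card exceptional"
proof -
  let ?R = "\<lambda>v p. {q\<in>star v. fst q \<noteq> fst p \<and> snd q \<noteq> snd p}"
  define A where "A = {(a, b). a < n \<and> b < n \<and> a \<noteq> b}"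
  have fA: "finite A" by (rule finite_subset[of _ "{..<n} \<times> {..<n}"]) (auto simp: A_def)
  have "(\<Sum>v<n. \<Sum>p\<in>star v. card (?R v p)) = card (SIGMA v:{..<n}. SIGMA p:star v. ?R v p)"
    using finite_star by simp
  also have "\<dots> \<le> card (SIGMA z:A. cherries (fst z) (snd z))"
  proof (rule surj_card_le)
    show "finite (SIGMA z:A. cherries (fst z) (snd z))" using fA cherries_finite by auto
    show "(SIGMA v:{..<n}. SIGMA p:star v. ?R v p)
       \<subseteq> (\<lambda>((a, b), (v, i, j)). (v, (i, a), (j, b))) ` (SIGMA z:A. cherries (fst z) (snd z))"
    proof
      fix x assume "x \<in> (SIGMA v:{..<n}. SIGMA p:star v. ?R v p)"
      then obtain v i a j b where x: "x = (v, (i, a), (j, b))" "(i, a) \<in> star v" "(j, b) \<in> star v" "i \<noteq> j" "a \<noteq> b"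
        by force
      then have "((a, b), (v, i, j)) \<in> (SIGMA z:A. cherries (fst z) (snd z))"
        using L_D(7) L_commute by (auto simp: A_def cherries_def star_def)
      then show "x \<in> (\<lambda>((a, b), (v, i, j)). (v, (i, a), (j, b))) ` (SIGMA z:A. cherries (fst z) (snd z))"
        unfolding x(1) by (rule rev_image_eqI) simp
    qed
  qed
  also have "\<dots> = (\<Sum>z\<in>A. card (cherries (fst z) (snd z)))" using fA cherries_finite by simp
  also have "\<dots> \<le> (\<Sum>z\<in>A. 9 + (if z \<in> exceptional then 81 else 0))"
  proof (rule sum_mono)
    fix z assume "z \<in> A"
    then show "card (cherries (fst z) (snd z)) \<le> 9 + (if z \<in> exceptional then 81 else 0)"
      using card_cherries_le[of "fst z" "snd z"] card_cherries_unexceptional[of "fst z" "snd z"]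
      by (auto simp: A_def)
  qed
  also have "\<dots> = 9 * card A + 81 * card (A \<inter> exceptional)"
    using fA by (simp add: sum.distrib sum.If_cases Int_def)
  also have "card A \<le> n\<^sup>2"
    using card_mono[of "{..<n} \<times> {..<n}" A] by (auto simp: A_def power2_eq_square)
  also have "card (A \<inter> exceptional) \<le> card exceptional" using card_exceptional(1) by (intro card_mono) auto
  finally show ?thesis by simp
qed

lemma total_square_le: "(real total)\<^sup>2 \<le> 9 * real n ^ 3 + 96885 * real n * real total"
proof -
  have "(\<Sum>v<n. card (star v) * card (star v)) \<le> (\<Sum>v<n. 9 * card (star v)
     + (\<Sum>p\<in>star v. card {q\<in>star v. fst q \<noteq> fst p \<and> snd q \<noteq> snd p}))"
    by (intro sum_mono card_star_square)
  also have "\<dots> \<le> 9 * total + (9 * n\<^sup>2 + 81 * card exceptional)"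
    unfolding sum.distrib sum_distrib_left[symmetric] sum_card_star using sum_rainbow_cherries by simp
  \<comment> \<open>96885 = 9 + 81 * 1196.\<close>
  also have "\<dots> \<le> 9 * n\<^sup>2 + 96885 * total" using card_exceptional(2) by simp
  finally have sq: "(\<Sum>v<n. card (star v) * card (star v)) \<le> 9 * n\<^sup>2 + 96885 * total" .
  have "(real total)\<^sup>2 = (\<Sum>v<n. real (card (star v)))\<^sup>2" unfolding sum_card_star[symmetric] by simp
  also have "\<dots> \<le> (\<Sum>v<n. (real (card (star v)))\<^sup>2) * real (card {..<n})"
    by (rule sum_squared_le_sum_of_squares)
  also have "(\<Sum>v<n. (real (card (star v)))\<^sup>2) = real (\<Sum>v<n. card (star v) * card (star v))"
    by (simp add: power2_eq_square)
  also have "\<dots> * real (card {..<n}) \<le> real (9 * n\<^sup>2 + 96885 * total) * real (card {..<n})"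
    using sq by (intro mult_right_mono of_nat_mono) auto
  also have "\<dots> = 9 * real n ^ 3 + 96885 * real n * real total"
    by (simp add: algebra_simps power2_eq_square power3_eq_cube)
  finally show ?thesis .
qed

lemma excess_le_total: "6 * excess H \<le> real total"
proof -
  have "6 * excess H = (\<Sum>i<m. 6 * (real (card (H ! i)) - 3))" by (simp add: excess_def sum_distrib_left)
  also have "\<dots> \<le> (\<Sum>i<m. real (card (L i)))"
  proof (rule sum_mono)
    fix i assume "i \<in> {..<m}"
    then have "6 * (card (H ! i) - 3) \<le> card (L i)" using L_card by simp
    then have "real (6 * (card (H ! i) - 3)) \<le> real (card (L i))" by (rule of_nat_mono)
    \<comment> \<open>Truncated subtraction only helps: a hyperedge with fewer than three vertices
      contributes a negative amount to the excess and 0 on the right.\<close>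
    moreover have "real (card (H ! i)) - 3 \<le> real (card (H ! i) - 3)"
      by (cases "card (H ! i) \<ge> 3") (auto simp: of_nat_diff)
    ultimately show "6 * (real (card (H ! i)) - 3) \<le> real (card (L i))" by simp
  qed
  also have "\<dots> = real total" by (simp add: total_def)
  finally show ?thesis .
qed

end

section \<open>From the quadratic inequality to the asymptotic bound\<close>

lemma excess_quadratic_bound:
  assumes "hypergraph_on n H" "\<not> has_berge_C4 H"
  shows "\<exists>D::real. 6 * excess H \<le> D \<and> D\<^sup>2 \<le> 9 * real n ^ 3 + 96885 * real n * D"
proof -
  interpret berge_C4_free n H using assms by unfold_locales
  have "\<exists>L. L \<subseteq> nonadj_pairs heavy (H ! i) \<and> sym L \<and> (\<forall>x. card (L `` {x}) \<le> 6) \<and>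
      card L \<ge> 6 * (card (H ! i) - 3) \<and> (card (H ! i) \<le> 3 \<longrightarrow> L = {})" if "i < length H" for i
  proof (cases "card (H ! i) \<le> 3")
    case True
    then show ?thesis by (intro exI[of _ "{}"]) (auto simp: sym_def)
  next
    case False
    then show ?thesis
      using bounded_degree_nonadj_pairs[OF finite_edge[OF that] symp_heavy P4_free_heavy[OF that]] by simp
  qed
  then obtain L where "\<And>i. i < length H \<Longrightarrow> L i \<subseteq> nonadj_pairs heavy (H ! i) \<and> sym (L i) \<and> (\<forall>x. card (L i `` {x}) \<le> 6) \<and>
      card (L i) \<ge> 6 * (card (H ! i) - 3) \<and> (card (H ! i) \<le> 3 \<longrightarrow> L i = {})" by metis
  then interpret berge_selection n H L by unfold_locales auto
  \<comment> \<open>The witness is \<open>real total\<close>; the existential statement hides the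
    selection \<open>L\<close>.\<close>
  show ?thesis using excess_le_total total_square_le by blast
qed

text \<open>If D exceeds \<open>t n\<close>, six times the claimed bound, then dividing the
  quadratic inequality by D gives D \<le> t / (1 + \<epsilon>)^2 + 96885 n, because 9 n^3 = t^2 / (1
  + \<epsilon>)^2. As t has order n^(3/2), this fails for large n.\<close>

lemma berge_C4_free_excess_upper:
  fixes \<epsilon> :: real assumes "\<epsilon> > 0"
  shows "\<exists>N. \<forall>n\<ge>N. \<forall>H. hypergraph_on n H \<and> \<not> has_berge_C4 H \<longrightarrow>
            excess H \<le> (1 + \<epsilon>) * (1/2) * real n powr (3/2)"
proof -
  define t where "t = (\<lambda>n::nat. 3 * (1 + \<epsilon>) * real n powr (3/2))"
  have "1 < 1 + \<epsilon>" using assms by simp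
  then have "9 < 9 * (1 + \<epsilon>)\<^sup>2" using power_strict_mono[of 1 "1 + \<epsilon>" 2] by simp
  \<comment> \<open>The negation of t - t / (1 + \<epsilon>)^2 \<le> 96885 n, divided by 3(1 +
    \<epsilon>) n; the quotient on the right is 1 - 1 / (1 + \<epsilon>)^2.\<close>
  have "\<forall>\<^sub>F n in sequentially. 96885 / (3 * (1 + \<epsilon>)) < (9 * (1 + \<epsilon>)\<^sup>2 - 9) / (9 * (1 + \<epsilon>)\<^sup>2) * real n powr (1/2)"
    using assms \<open>9 < 9 * (1 + \<epsilon>)\<^sup>2\<close> by real_asymp
  then have "\<forall>\<^sub>F n in sequentially. \<forall>H. hypergraph_on n H \<and> \<not> has_berge_C4 H \<longrightarrow>
            excess H \<le> (1 + \<epsilon>) * (1/2) * real n powr (3/2)"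
    using eventually_gt_at_top[of 0]
  proof eventually_elim
    case (elim n)
    define q where "q = real n powr (1/2)"
    have q: "q > 0" "q * q = real n" using elim by (auto simp: q_def simp flip: powr_add)
    have n32: "real n powr (3/2) = real n * q"
      using elim powr_add[of "real n" 1 "1/2"] by (simp add: q_def)
    show ?case
    proof (intro allI impI, elim conjE, rule ccontr)
      fix H assume H: "hypergraph_on n H" "\<not> has_berge_C4 H"
        and big: "\<not> excess H \<le> (1 + \<epsilon>) * (1/2) * real n powr (3/2)"
      obtain D where D: "6 * excess H \<le> D" "D\<^sup>2 \<le> 9 * real n ^ 3 + 96885 * real n * D"
        using excess_quadratic_bound[OF H] by auto
      have "t n = 6 * ((1 + \<epsilon>) * (1/2) * real n powr (3/2))" by (simp add: t_def)
      then have Dt: "D > t n" using D(1) big by linarith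
      have tn: "t n = 3 * (1 + \<epsilon>) * real n * q" by (simp add: t_def n32)
      have tpos: "t n > 0" using assms elim q by (simp add: tn)
      have sq: "9 * real n ^ 3 = (t n)\<^sup>2 / (1 + \<epsilon>)\<^sup>2"
      proof -
        have e: "(3 * e * x * y)\<^sup>2 = 9 * e\<^sup>2 * (x\<^sup>2 * (y * y))" for e x y :: real
          by (simp add: power_mult_distrib power2_eq_square)
        have "(t n)\<^sup>2 = 9 * (1 + \<epsilon>)\<^sup>2 * real n ^ 3"
          unfolding tn e q(2) by (simp only: power2_eq_square[of "real n"] power3_eq_cube)
        then show ?thesis using assms by simp
      qed
      also have "\<dots> \<le> t n * D / (1 + \<epsilon>)\<^sup>2" using Dt tpos by (simp add: power2_eq_square divide_right_mono)
      finally have "9 * real n ^ 3 \<le> t n / (1 + \<epsilon>)\<^sup>2 * D" by simp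
      then have "D * D \<le> (t n / (1 + \<epsilon>)\<^sup>2 + 96885 * real n) * D"
        using D(2) by (simp add: power2_eq_square algebra_simps)
      then have "D \<le> t n / (1 + \<epsilon>)\<^sup>2 + 96885 * real n" using Dt tpos by simp
      then have "t n - t n / (1 + \<epsilon>)\<^sup>2 < 96885 * real n" using Dt by simp
      then have "3 * (1 + \<epsilon>) * real n * (q * (1 - 1 / (1 + \<epsilon>)\<^sup>2)) < 3 * (1 + \<epsilon>) * real n * (96885 / (3 * (1 + \<epsilon>)))"
      proof -
        have "3 * e * x * (y * (1 - 1 / w)) = 3 * e * x * y - 3 * e * x * y / w"
          "e \<noteq> 0 \<Longrightarrow> 3 * e * x * (k / (3 * e)) = k * x" for e x y w k :: real
          by (simp_all add: right_diff_distrib)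
        with \<open>t n - t n / (1 + \<epsilon>)\<^sup>2 < 96885 * real n\<close> assms show ?thesis
          unfolding tn by (metis add_pos_pos less_irrefl zero_less_one)
      qed
      then have "q * (1 - 1 / (1 + \<epsilon>)\<^sup>2) < 96885 / (3 * (1 + \<epsilon>))"
      proof -
        have "0 < 3 * (1 + \<epsilon>) * real n" using assms elim by simp
        then show "3 * (1 + \<epsilon>) * real n * (q * (1 - 1 / (1 + \<epsilon>)\<^sup>2)) < 3 * (1 + \<epsilon>) * real n * (96885 / (3 * (1 + \<epsilon>)))
          \<Longrightarrow> ?thesis" by (simp only: mult_less_cancel_left_pos)
      qed
      moreover have "(9 * (1 + \<epsilon>)\<^sup>2 - 9) / (9 * (1 + \<epsilon>)\<^sup>2) = 1 - 1 / (1 + \<epsilon>)\<^sup>2"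
        using assms by (simp add: diff_divide_distrib)
      ultimately show False using elim(1) unfolding q_def by (simp add: mult.commute)
    qed
  qed
  then show ?thesis by (simp add: eventually_sequentially)
qed

theorem theorem1:
  shows "(\<forall>\<epsilon>>0. \<exists>N. \<forall>n\<ge>N. \<forall>H. hypergraph_on n H \<and> \<not> has_berge_C4 H \<longrightarrow>
            excess H \<le> (1 + \<epsilon>) * (1/2) * real n powr (3/2))
       \<and> (\<forall>\<epsilon>>0. \<exists>N. \<forall>n\<ge>N. \<exists>H. hypergraph_on n H \<and> \<not> has_berge_C4 H \<and>
            excess H \<ge> (1 - \<epsilon>) * (1 / (2 * sqrt 6)) * real n powr (3/2))"
  using berge_C4_free_excess_upper berge_C4_free_excess_lower by blast

end
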